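(* Let $G$ be a finite group and let $r$ be a prime. Then $G$ is a $CD1$-group with $a_k=r$ if and only if either $r=2$ and $G$ is isomorphic to one of the groups $S_3$, $D_8$ and $Q_8$, or $r=2^n-1$ is a Mersenne prime and $G$ is a doubly transitive Frobenius group of order $(2^n-1)2^n$.
   Context: All groups are finite. Let $\mathrm{Irr}(G)=\{\chi_1,\dots,\chi_k\}$ be the set of complex irreducible characters of $G$, with $\chi_1=1_G$ and $\chi_1(1)=1\le\chi_2(1)\le\dots\le\chi_k(1)$; put $a_k=\chi_k(1)$. A group $G$ is a $CD1$-group if $|G|>2$ and two columns of its character table differ by exactly one entry, i.e. there are non-conjugate $a,b\in G$ and an index $j$ with $\chi_j(a)\ne\chi_j(b)$ and $\chi_i(a)=\chi_i(b)$ for all $i\ne j$. A Frobenius group $G$ with Frobenius kernel $F$ and Frobenius complement $H$ is called doubly transitive if $|H|=|F|-1$. $S_3$ is the symmetric group on $3$ letters, $D_8$ the dihedral group of order $8$, $Q_8$ the quaternion group of order $8$. *)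

theory Defs
  imports
    "HOL-Algebra.Algebra"
    "HOL-Computational_Algebra.Primes"
    "Jordan_Normal_Form.VS_Connect"
begin

section \<open>Complex irreducible characters\<close>

definition GL :: "nat \<Rightarrow> complex mat monoid" where
  "GL n = units_of (ring_mat TYPE(complex) n ())"

definition mat_trace :: "'a::comm_monoid_add mat \<Rightarrow> 'a" where
  "mat_trace A = (\<Sum>i<dim_row A. A $$ (i, i))"

definition invariant_subspace ::
    "('a, 'b) monoid_scheme \<Rightarrow> nat \<Rightarrow> ('a \<Rightarrow> complex mat) \<Rightarrow> complex vec set \<Rightarrow> bool" where
  "invariant_subspace G n \<rho> W \<longleftrightarrow>
     VectorSpace.subspace class_ring W (module_vec TYPE(complex) n) \<and>
     (\<forall>g\<in>carrier G. \<forall>w\<in>W. \<rho> g *\<^sub>v w \<in> W)"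

text \<open>The degree is required to be positive: the zero representation is not irreducible.\<close>

definition irreducible_representation ::
    "('a, 'b) monoid_scheme \<Rightarrow> nat \<Rightarrow> ('a \<Rightarrow> complex mat) \<Rightarrow> bool" where
  "irreducible_representation G n \<rho> \<longleftrightarrow>
     n > 0 \<and> \<rho> \<in> hom G (GL n) \<and>
     (\<forall>W. invariant_subspace G n \<rho> W \<longrightarrow> W = {0\<^sub>v n} \<or> W = carrier_vec n)"

text \<open>Characters are restricted to the carrier (with value \<^const>\<open>undefined\<close> outside it), so that
  equality of elements of \<open>Irr G\<close> is equality of class functions on the group.\<close>

definition character_of ::
    "('a, 'b) monoid_scheme \<Rightarrow> ('a \<Rightarrow> complex mat) \<Rightarrow> 'a \<Rightarrow> complex" where
  "character_of G \<rho> = (\<lambda>g\<in>carrier G. mat_trace (\<rho> g))"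

definition Irr :: "('a, 'b) monoid_scheme \<Rightarrow> ('a \<Rightarrow> complex) set" where
  "Irr G = {character_of G \<rho> | n \<rho>. irreducible_representation G n \<rho>}"

text \<open>For irreducible characters listed by increasing degree, this is the degree \<open>a\<^sub>k = \<chi>\<^sub>k(1)\<close>
  of the last one.  The degrees are natural numbers, so taking real parts loses nothing;
  \<open>Irr G\<close> is finite for finite \<open>G\<close>.\<close>

definition max_irr_degree :: "('a, 'b) monoid_scheme \<Rightarrow> real" where
  "max_irr_degree G = Max ((\<lambda>\<chi>. Re (\<chi> \<one>\<^bsub>G\<^esub>)) ` Irr G)"

definition conjugate_in :: "('a, 'b) monoid_scheme \<Rightarrow> 'a \<Rightarrow> 'a \<Rightarrow> bool" where
  "conjugate_in G a b \<longleftrightarrow> (\<exists>g\<in>carrier G. b = g \<otimes>\<^bsub>G\<^esub> a \<otimes>\<^bsub>G\<^esub> inv\<^bsub>G\<^esub> g)"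

definition CD1_group :: "('a, 'b) monoid_scheme \<Rightarrow> bool" where
  "CD1_group G \<longleftrightarrow>
     Coset.order G > 2 \<and>
     (\<exists>a\<in>carrier G. \<exists>b\<in>carrier G. \<not> conjugate_in G a b \<and>
       (\<exists>\<chi>\<in>Irr G. \<chi> a \<noteq> \<chi> b \<and> (\<forall>\<psi>\<in>Irr G. \<psi> \<noteq> \<chi> \<longrightarrow> \<psi> a = \<psi> b)))"


section \<open>Frobenius groups\<close>

definition conjugate_subset :: "('a, 'b) monoid_scheme \<Rightarrow> 'a \<Rightarrow> 'a set \<Rightarrow> 'a set" where
  "conjugate_subset G g H = (\<lambda>h. g \<otimes>\<^bsub>G\<^esub> h \<otimes>\<^bsub>G\<^esub> inv\<^bsub>G\<^esub> g) ` H"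

definition frobenius_complement :: "('a, 'b) monoid_scheme \<Rightarrow> 'a set \<Rightarrow> bool" where
  "frobenius_complement G H \<longleftrightarrow>
     subgroup H G \<and> H \<noteq> {\<one>\<^bsub>G\<^esub>} \<and> H \<noteq> carrier G \<and>
     (\<forall>g\<in>carrier G - H. H \<inter> conjugate_subset G g H = {\<one>\<^bsub>G\<^esub>})"

definition frobenius_kernel :: "('a, 'b) monoid_scheme \<Rightarrow> 'a set \<Rightarrow> 'a set" where
  "frobenius_kernel G H =
     insert \<one>\<^bsub>G\<^esub> (carrier G - (\<Union>g\<in>carrier G. conjugate_subset G g H))"

definition doubly_transitive_frobenius_group :: "('a, 'b) monoid_scheme \<Rightarrow> bool" where
  "doubly_transitive_frobenius_group G \<longleftrightarrow>
     (\<exists>H. frobenius_complement G H \<and> card H = card (frobenius_kernel G H) - 1)"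


section \<open>Dihedral and quaternion groups\<close>

text \<open>The pair \<open>(a, s)\<close> stands for \<open>\<rho>\<^sup>a \<sigma>\<^sup>s\<close> with \<open>\<rho>\<close> the rotation of order \<open>n\<close> and \<open>\<sigma>\<close> a
  reflection, \<open>\<sigma> \<rho> = \<rho>\<^sup>-\<^sup>1 \<sigma>\<close>.  Thus \<open>dihedral_group n\<close> has order \<open>2 n\<close>, and the
  dihedral group of order 8 is \<open>dihedral_group 4\<close>.\<close>

definition dihedral_group :: "nat \<Rightarrow> (int \<times> bool) monoid" where
  "dihedral_group n =
     \<lparr>carrier = {0..<int n} \<times> UNIV,
      monoid.mult = (\<lambda>(a, s) (b, t). ((a + (if s then - b else b)) mod int n, s \<noteq> t)),
      one = (0, False)\<rparr>"

lemma group_dihedral_group: "n > 0 \<Longrightarrow> group (dihedral_group n)"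
proof (rule groupI)
  assume n: "n > 0"
  fix x assume "x \<in> carrier (dihedral_group n)"
  then obtain a s where x: "x = (a, s)" "0 \<le> a" "a < int n"
    by (auto simp: dihedral_group_def)
  show "\<exists>y\<in>carrier (dihedral_group n). y \<otimes>\<^bsub>dihedral_group n\<^esub> x = \<one>\<^bsub>dihedral_group n\<^esub>"
    by (rule bexI[of _ "(if s then a else (- a) mod int n, s)"])
       (use n x in \<open>auto simp: dihedral_group_def mod_simps\<close>)
qed (auto simp: dihedral_group_def mod_simps algebra_simps)

lemma order_dihedral_group: "Coset.order (dihedral_group n) = 2 * n"
  by (simp add: Coset.order_def dihedral_group_def card_cartesian_product)

text \<open>The quadruple \<open>(a, b, c, d)\<close> stands for the quaternion \<open>a + b i + c j + d k\<close>.\<close>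

fun hamilton_product :: "int \<times> int \<times> int \<times> int \<Rightarrow> int \<times> int \<times> int \<times> int \<Rightarrow> int \<times> int \<times> int \<times> int" where
  "hamilton_product (a, b, c, d) (a', b', c', d') =
     (a * a' - b * b' - c * c' - d * d',
      a * b' + b * a' + c * d' - d * c',
      a * c' - b * d' + c * a' + d * b',
      a * d' + b * c' - c * b' + d * a')"

definition quaternion_group :: "(int \<times> int \<times> int \<times> int) monoid" where
  "quaternion_group =
     \<lparr>carrier = {(1, 0, 0, 0), (-1, 0, 0, 0), (0, 1, 0, 0), (0, -1, 0, 0),
                 (0, 0, 1, 0), (0, 0, -1, 0), (0, 0, 0, 1), (0, 0, 0, -1)},
      monoid.mult = hamilton_product,
      one = (1, 0, 0, 0)\<rparr>"

lemma hamilton_product_assoc: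
  "hamilton_product (hamilton_product x y) z = hamilton_product x (hamilton_product y z)"
  by (cases x; cases y; cases z) (simp add: algebra_simps)

lemma group_quaternion_group: "group quaternion_group"
proof (rule groupI)
  fix x y z
  show "x \<otimes>\<^bsub>quaternion_group\<^esub> y \<otimes>\<^bsub>quaternion_group\<^esub> z =
        x \<otimes>\<^bsub>quaternion_group\<^esub> (y \<otimes>\<^bsub>quaternion_group\<^esub> z)"
    by (simp add: quaternion_group_def hamilton_product_assoc)
qed (auto simp: quaternion_group_def)

lemma order_quaternion_group: "Coset.order quaternion_group = 8"
  by (simp add: Coset.order_def quaternion_group_def)

end

theory Submission
  imports Defs "Jordan_Normal_Form.Spectral_Radius" "HOL-Library.Function_Algebras"
begin

text \<open>
  Let \<open>a\<close> and \<open>b\<close> be columns of the character table that differ in the row of \<open>\<chi>\<close> only.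
  Comparing the orthogonality relations of both columns with that of a third column \<open>g\<close> gives
  \<open>(\<chi> a - \<chi> b) \<chi> g\<^sup>-\<^sup>1 = 0\<close> unless \<open>g\<close> is conjugate to \<open>a\<close> or \<open>b\<close>.  For \<open>g = \<one>\<close> this forces one of
  the two elements to be \<open>\<one>\<close>, say \<open>a\<close>; for the other \<open>g\<close> it says that \<open>\<chi>\<close> vanishes outside
  \<open>N = {\<one>} \<union> b\<^sup>G\<close>.  All other irreducible characters are constant on \<open>N\<close>, and \<open>N\<close> turns out to be
  a normal subgroup on whose nontrivial elements \<open>G\<close> acts transitively.  Counting squares of
  degrees yields \<open>\<chi>(1)\<^sup>2 = |G / N| (|N| - 1)\<close>, and it shows at the same time that \<open>\<chi>\<close> has the
  largest degree (\<open>CD1_structure\<close>).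

  If this degree is a prime \<open>r\<close>, then \<open>|N| - 1\<close> is \<open>1\<close>, \<open>r\<close> or \<open>r\<^sup>2\<close>.  The last value is excluded
  because the size \<open>|N| - 1\<close> of a conjugacy class divides \<open>|G|\<close>, which would be \<open>r\<^sup>2 + 1\<close>.  If
  \<open>|N| = 2\<close>, then \<open>|G| = 2 r\<^sup>2\<close>; for odd \<open>r\<close> a Sylow \<open>r\<close>-subgroup would meet \<open>N\<close> trivially, so the
  trivial character would have multiplicity \<open>1 / r\<close> in the restriction of \<open>\<chi>\<close> to it.  For \<open>r = 2\<close>
  the centre lies in \<open>N\<close>, because characters do not vanish on central elements, and \<open>G\<close> is one
  of the two nonabelian groups of order \<open>8\<close>.  If \<open>|N| = r + 1\<close>, then \<open>|G| = r (r + 1)\<close>: for \<open>r = 2\<close>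
  this leads to \<open>S\<^sub>3\<close>, and for odd \<open>r\<close> the subgroup \<open>N\<close> has exponent \<open>2\<close>, hence order \<open>2\<^sup>n\<close>, and a
  subgroup of order \<open>r\<close> is a Frobenius complement with kernel \<open>N\<close>.

  Conversely, let \<open>N = {\<one>} \<union> b\<^sup>G\<close> be a subgroup with \<open>|G / N| (|N| - 1) = r\<^sup>2\<close>.  The squares of the
  degrees of those irreducible characters that distinguish \<open>b\<close> from \<open>\<one>\<close> add up to \<open>r\<^sup>2\<close>, so there
  is only one of them as soon as each has degree at least \<open>r\<close> (\<open>CD1_criterion\<close>).  In the groups
  of order \<open>6\<close> and \<open>8\<close> this bound holds because \<open>b\<close> is a commutator.  In the Frobenius groups \<open>b\<close>
  is an involution, so \<open>\<chi> b = - \<chi>(1) / r\<close> is an integer and \<open>r\<close> divides \<open>\<chi>(1)\<close>.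

  Values \<open>\<chi> g\<^sup>-\<^sup>1\<close> take the place of complex conjugates throughout.  The character theory rests
  on Schur's lemma and on one completeness statement, \<open>group_algebra_faithful\<close>: an element of the
  group algebra that acts as zero in every irreducible representation is zero.  It is applied to
  differences of class functions, which act as scalars, so that only traces have to be compared.
\<close>

section \<open>Traces and sums of matrices\<close>

lemma mat_trace_mult_comm:
  fixes A B :: "'a :: comm_semiring_1 mat"
  assumes "A \<in> carrier_mat m n" "B \<in> carrier_mat n m"
  shows "mat_trace (A * B) = mat_trace (B * A)"
proof -
  have "mat_trace (A * B) = (\<Sum>i<m. \<Sum>j<n. A $$ (i, j) * B $$ (j, i))"
    using assms by (auto simp: mat_trace_def scalar_prod_def lessThan_atLeast0 intro!: sum.cong)
  also have "\<dots> = (\<Sum>j<n. \<Sum>i<m. B $$ (j, i) * A $$ (i, j))"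
    by (subst sum.swap) (simp add: mult.commute)
  also have "\<dots> = mat_trace (B * A)"
    using assms by (auto simp: mat_trace_def scalar_prod_def lessThan_atLeast0 intro!: sum.cong)
  finally show ?thesis .
qed

lemma mat_trace_smult_one:
  "mat_trace (c \<cdot>\<^sub>m (1\<^sub>m n :: 'a :: comm_semiring_1 mat)) = of_nat n * c"
  by (simp add: mat_trace_def)

lemma mat_trace_smult:
  "A \<in> carrier_mat n n \<Longrightarrow> mat_trace (c \<cdot>\<^sub>m A) = (c :: 'a :: comm_semiring_1) * mat_trace A"
  by (auto simp: mat_trace_def sum_distrib_left)

lemma mat_trace_one: "mat_trace (1\<^sub>m n :: 'a :: comm_semiring_1 mat) = of_nat n"
  by (simp add: mat_trace_def)

text \<open>The type of matrices of all sizes is not a monoid under addition, so \<^const>\<open>sum\<close> is not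
  available for it; the sum of matrices of a common format is formed entry by entry.\<close>

definition mat_sum :: "nat \<Rightarrow> nat \<Rightarrow> ('b \<Rightarrow> 'a :: comm_monoid_add mat) \<Rightarrow> 'b set \<Rightarrow> 'a mat" where
  "mat_sum n m F S = mat n m (\<lambda>ij. \<Sum>x\<in>S. F x $$ ij)"

lemma mat_sum_carrier [simp]: "mat_sum n m F S \<in> carrier_mat n m"
  by (simp add: mat_sum_def)

lemma mat_sum_cong:
  "(\<And>x. x \<in> S \<Longrightarrow> F x = F' x) \<Longrightarrow> mat_sum n m F S = mat_sum n m F' S"
  by (simp add: mat_sum_def)

lemma mult_mat_sum:
  fixes A :: "'a :: comm_semiring_0 mat"
  assumes "A \<in> carrier_mat k n" "\<And>x. x \<in> S \<Longrightarrow> F x \<in> carrier_mat n m"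
  shows "A * mat_sum n m F S = mat_sum k m (\<lambda>x. A * F x) S"
proof (rule eq_matI)
  fix i j assume "i < dim_row (mat_sum k m (\<lambda>x. A * F x) S)"
    and "j < dim_col (mat_sum k m (\<lambda>x. A * F x) S)"
  then have ij: "i < k" "j < m" by (simp_all add: mat_sum_def)
  have "(A * mat_sum n m F S) $$ (i, j) = (\<Sum>l<n. A $$ (i, l) * (\<Sum>x\<in>S. F x $$ (l, j)))"
    using assms(1) ij by (simp add: mat_sum_def scalar_prod_def lessThan_atLeast0)
  also have "\<dots> = (\<Sum>x\<in>S. \<Sum>l<n. A $$ (i, l) * F x $$ (l, j))"
    unfolding sum_distrib_left by (rule sum.swap)
  also have "\<dots> = (\<Sum>x\<in>S. (A * F x) $$ (i, j))"
  proof (rule sum.cong[OF refl])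
    fix x assume "x \<in> S"
    with assms(2) have "F x \<in> carrier_mat n m" .
    then show "(\<Sum>l<n. A $$ (i, l) * F x $$ (l, j)) = (A * F x) $$ (i, j)"
      using assms(1) ij by (simp add: scalar_prod_def lessThan_atLeast0)
  qed
  finally show "(A * mat_sum n m F S) $$ (i, j) = mat_sum k m (\<lambda>x. A * F x) S $$ (i, j)"
    using ij by (simp add: mat_sum_def)
qed (use assms in \<open>auto simp: mat_sum_def\<close>)

lemma mat_sum_mult:
  fixes A :: "'a :: comm_semiring_0 mat"
  assumes "A \<in> carrier_mat m k" "\<And>x. x \<in> S \<Longrightarrow> F x \<in> carrier_mat n m"
  shows "mat_sum n m F S * A = mat_sum n k (\<lambda>x. F x * A) S"
proof (rule eq_matI)
  fix i j assume "i < dim_row (mat_sum n k (\<lambda>x. F x * A) S)"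
    and "j < dim_col (mat_sum n k (\<lambda>x. F x * A) S)"
  then have ij: "i < n" "j < k" by (simp_all add: mat_sum_def)
  have "(mat_sum n m F S * A) $$ (i, j) = (\<Sum>l<m. (\<Sum>x\<in>S. F x $$ (i, l)) * A $$ (l, j))"
    using assms(1) ij by (simp add: mat_sum_def scalar_prod_def lessThan_atLeast0)
  also have "\<dots> = (\<Sum>x\<in>S. \<Sum>l<m. F x $$ (i, l) * A $$ (l, j))"
    unfolding sum_distrib_right by (rule sum.swap)
  also have "\<dots> = (\<Sum>x\<in>S. (F x * A) $$ (i, j))"
  proof (rule sum.cong[OF refl])
    fix x assume "x \<in> S"
    with assms(2) have "F x \<in> carrier_mat n m" .
    then show "(\<Sum>l<m. F x $$ (i, l) * A $$ (l, j)) = (F x * A) $$ (i, j)"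
      using assms(1) ij by (simp add: scalar_prod_def lessThan_atLeast0)
  qed
  finally show "(mat_sum n m F S * A) $$ (i, j) = mat_sum n k (\<lambda>x. F x * A) S $$ (i, j)"
    using ij by (simp add: mat_sum_def)
qed (use assms in \<open>auto simp: mat_sum_def\<close>)

lemma mat_trace_mat_sum:
  assumes "\<And>x. x \<in> S \<Longrightarrow> F x \<in> carrier_mat n n"
  shows "mat_trace (mat_sum n n F S) = (\<Sum>x\<in>S. mat_trace (F x))"
proof -
  have "mat_trace (mat_sum n n F S) = (\<Sum>i<n. \<Sum>x\<in>S. F x $$ (i, i))"
    by (simp add: mat_trace_def mat_sum_def)
  also have "\<dots> = (\<Sum>x\<in>S. \<Sum>i<n. F x $$ (i, i))" by (rule sum.swap)
  also have "\<dots> = (\<Sum>x\<in>S. mat_trace (F x))"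
    using assms by (intro sum.cong) (auto simp: mat_trace_def)
  finally show ?thesis .
qed

lemma mat_sum_reindex_bij_betw:
  "bij_betw h S T \<Longrightarrow> mat_sum n m (\<lambda>x. F (h x)) S = mat_sum n m F T"
  by (simp add: mat_sum_def sum.reindex_bij_betw[where g = "\<lambda>x. F x $$ _"])

text \<open>The diagonal of an upper triangular idempotent consists of zeros and ones, and every complex
matrix is similar to an upper triangular one.\<close>

lemma idempotent_mat_trace_nat:
  fixes A :: "complex mat"
  assumes A: "A \<in> carrier_mat n n" and idem: "A * A = A"
  shows "\<exists>k :: nat. mat_trace A = of_nat k"
proof -
  obtain es where es: "char_poly A = (\<Prod>a\<leftarrow>es. [:- a, 1:])"
    using char_poly_factorized[OF A] by auto
  obtain B P Q where dec: "schur_decomposition A es = (B, P, Q)"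
    by (metis prod_cases3)
  have sim: "similar_mat_wit A B P Q" and ut: "upper_triangular B"
    using schur_decomposition[OF A es dec] by auto
  note w = similar_mat_witD2[OF A sim]
  have "B = Q * A * P"
  proof -
    have "Q * A * P = Q * (P * B * Q) * P" using w by simp
    also have "\<dots> = (Q * P) * B * (Q * P)"
      using w(5,6,7) by (simp add: assoc_mult_mat[of _ n n _ n _ n])
    also have "\<dots> = B" using w by simp
    finally show ?thesis by simp
  qed
  have BB: "B * B = B"
  proof -
    have "B * B = Q * A * P * (Q * A * P)" using \<open>B = Q * A * P\<close> by simp
    also have "\<dots> = Q * (A * (P * Q) * A) * P"
      using w(5,6,7) A by (simp add: assoc_mult_mat[of _ n n _ n _ n])
    also have "\<dots> = B" using w A idem \<open>B = Q * A * P\<close> by simp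
    finally show ?thesis .
  qed
  have diag: "B $$ (i, i) \<in> {0, 1}" if "i < n" for i
  proof -
    have "B $$ (i, i) = (\<Sum>l<n. B $$ (i, l) * B $$ (l, i))"
      using w(5) that by (subst BB[symmetric]) (simp add: scalar_prod_def lessThan_atLeast0)
    also have "\<dots> = (\<Sum>l<n. if l = i then B $$ (i, i) * B $$ (i, i) else 0)"
    proof (rule sum.cong[OF refl])
      fix l assume "l \<in> {..<n}"
      then show "B $$ (i, l) * B $$ (l, i) = (if l = i then B $$ (i, i) * B $$ (i, i) else 0)"
        using ut w(5) that by (cases l i rule: linorder_cases) (auto simp: upper_triangular_def)
    qed
    also have "\<dots> = B $$ (i, i) * B $$ (i, i)" using that by simp
    finally show ?thesis by auto
  qed
  have "mat_trace A = mat_trace (P * (B * Q))" using w by (simp add: assoc_mult_mat[of _ n n _ n _ n])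
  also have "\<dots> = mat_trace (B * Q * P)"
    using w by (intro mat_trace_mult_comm) auto
  also have "\<dots> = mat_trace B" using w by (simp add: assoc_mult_mat[of _ n n _ n _ n])
  also have "\<dots> = (\<Sum>i<n. B $$ (i, i))" using w(5) by (simp add: mat_trace_def)
  also have "\<dots> = (\<Sum>i<n. of_nat (if B $$ (i, i) = 0 then 0 else 1))"
    using diag by (intro sum.cong) auto
  also have "\<dots> = of_nat (\<Sum>i<n. if B $$ (i, i) = 0 then 0 else 1)" by simp
  finally show ?thesis by blast
qed

section \<open>Irreducible representations and Schur's lemma\<close>

lemma subspace_module_vec_iff:
  "VectorSpace.subspace class_ring W (module_vec TYPE(complex) n) \<longleftrightarrow>
     W \<subseteq> carrier_vec n \<and> 0\<^sub>v n \<in> W \<and> (\<forall>v\<in>W. \<forall>w\<in>W. v + w \<in> W) \<and> (\<forall>c. \<forall>v\<in>W. c \<cdot>\<^sub>v v \<in> W)"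
proof -
  have "module class_ring (module_vec TYPE(complex) n)" by (rule vec_module)
  moreover have "vectorspace class_ring (module_vec TYPE(complex) n)" by (rule vec_vs)
  ultimately show ?thesis
    unfolding VectorSpace.subspace_def submodule_def
    by (auto simp: module_vec_simps)
qed

lemma irreducible_representationD:
  assumes "irreducible_representation G n \<rho>"
  shows "n > 0" "\<rho> \<in> hom G (GL n)"
    "\<And>W. invariant_subspace G n \<rho> W \<Longrightarrow> W = {0\<^sub>v n} \<or> W = carrier_vec n"
  using assms by (auto simp: irreducible_representation_def)

lemma GL_simps:
  "A \<in> carrier (GL n) \<Longrightarrow> A \<in> carrier_mat n n"
  "monoid.mult (GL n) = (*)" "one (GL n) = 1\<^sub>m n"
  by (auto simp: GL_def units_of_def Units_def ring_mat_def)

lemma group_GL: "group (GL n)"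
proof -
  interpret R: Ring.ring "ring_mat TYPE(complex) n ()" by (rule ring_mat)
  show ?thesis unfolding GL_def by (rule R.units_group)
qed

lemma GL_I:
  "A \<in> carrier_mat n n \<Longrightarrow> B \<in> carrier_mat n n \<Longrightarrow> A * B = 1\<^sub>m n \<Longrightarrow> B * A = 1\<^sub>m n
    \<Longrightarrow> A \<in> carrier (GL n)"
  by (auto simp: GL_def units_of_def Units_def ring_mat_def)

lemma smult_mat_mult_vec:
  fixes v :: "'a :: comm_semiring_1 vec"
  shows "v \<in> carrier_vec n \<Longrightarrow> (k \<cdot>\<^sub>m 1\<^sub>m n) *\<^sub>v v = k \<cdot>\<^sub>v v"
  by (intro eq_vecI) auto

lemma mult_mat_zero_vec: "A \<in> carrier_mat m n \<Longrightarrow> A *\<^sub>v 0\<^sub>v n = (0\<^sub>v m :: 'a :: comm_semiring_1 vec)"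
  by (intro eq_vecI) auto

lemma minus_mat_eq_zeroD:
  fixes A B :: "'a :: ab_group_add mat"
  assumes "A \<in> carrier_mat m n" "B \<in> carrier_mat m n" "A - B = 0\<^sub>m m n"
  shows "A = B"
proof (rule eq_matI)
  fix i j assume "i < dim_row B" "j < dim_col B"
  then have "A $$ (i, j) - B $$ (i, j) = (A - B) $$ (i, j)"
    using assms(1,2) by auto
  also have "\<dots> = 0" using assms \<open>i < dim_row B\<close> \<open>j < dim_col B\<close> by auto
  finally show "A $$ (i, j) = B $$ (i, j)" by simp
qed (use assms in auto)

lemma zero_mat_if_mult_vec_zero:
  assumes "M \<in> carrier_mat m n" "\<And>v. v \<in> carrier_vec n \<Longrightarrow> M *\<^sub>v v = 0\<^sub>v m"
  shows "M = (0\<^sub>m m n :: 'a :: comm_semiring_1 mat)"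
proof (rule eq_matI)
  fix i j assume ij: "i < dim_row (0\<^sub>m m n :: 'a mat)" "j < dim_col (0\<^sub>m m n :: 'a mat)"
  have "M $$ (i, j) = (M *\<^sub>v unit_vec n j) $ i" using assms(1) ij by simp
  also have "\<dots> = 0" using assms(2)[of "unit_vec n j"] ij by simp
  finally show "M $$ (i, j) = 0\<^sub>m m n $$ (i, j)" using ij by simp
qed (use assms in auto)

locale finite_group = group G for G (structure) +
  assumes finite_carrier [simp, intro]: "finite (carrier G)"
begin

lemma representation_simps:
  assumes "\<rho> \<in> hom G (GL n)"
  shows "\<And>g. g \<in> carrier G \<Longrightarrow> \<rho> g \<in> carrier_mat n n"
    "\<And>g h. g \<in> carrier G \<Longrightarrow> h \<in> carrier G \<Longrightarrow> \<rho> (g \<otimes> h) = \<rho> g * \<rho> h"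
    "\<rho> \<one> = 1\<^sub>m n"
    "\<And>g. g \<in> carrier G \<Longrightarrow> \<rho> g * \<rho> (inv g) = 1\<^sub>m n"
    "\<And>g. g \<in> carrier G \<Longrightarrow> \<rho> (inv g) * \<rho> g = 1\<^sub>m n"
proof -
  show 1: "\<And>g. g \<in> carrier G \<Longrightarrow> \<rho> g \<in> carrier_mat n n"
    using assms GL_simps(1) by (auto simp: hom_def)
  show 2: "\<And>g h. g \<in> carrier G \<Longrightarrow> h \<in> carrier G \<Longrightarrow> \<rho> (g \<otimes> h) = \<rho> g * \<rho> h"
    using hom_mult[OF assms] by (simp add: GL_simps)
  show 3: "\<rho> \<one> = 1\<^sub>m n"
    using hom_one[OF assms is_group group_GL] by (simp add: GL_simps)
  show "\<And>g. g \<in> carrier G \<Longrightarrow> \<rho> g * \<rho> (inv g) = 1\<^sub>m n"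
    by (subst 2[symmetric]) (auto simp: 3)
  show "\<And>g. g \<in> carrier G \<Longrightarrow> \<rho> (inv g) * \<rho> g = 1\<^sub>m n"
    by (subst 2[symmetric]) (auto simp: 3)
qed

lemma invariant_kernel:
  assumes \<rho>: "\<rho> \<in> hom G (GL n)" and \<sigma>: "\<sigma> \<in> hom G (GL m)"
    and M: "M \<in> carrier_mat m n" and comm: "\<And>g. g \<in> carrier G \<Longrightarrow> M * \<rho> g = \<sigma> g * M"
  shows "invariant_subspace G n \<rho> {v \<in> carrier_vec n. M *\<^sub>v v = 0\<^sub>v m}"
proof -
  have "M *\<^sub>v (\<rho> g *\<^sub>v v) = 0\<^sub>v m"
    if "g \<in> carrier G" "v \<in> carrier_vec n" "M *\<^sub>v v = 0\<^sub>v m" for g v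
  proof -
    have "M *\<^sub>v (\<rho> g *\<^sub>v v) = (M * \<rho> g) *\<^sub>v v"
      using M that representation_simps(1)[OF \<rho>] by (metis assoc_mult_mat_vec)
    also have "\<dots> = \<sigma> g *\<^sub>v (M *\<^sub>v v)"
      using M that representation_simps(1)[OF \<sigma>] comm by (metis assoc_mult_mat_vec)
    also have "\<dots> = 0\<^sub>v m"
      using that representation_simps(1)[OF \<sigma>] by (simp add: mult_mat_zero_vec)
    finally show ?thesis .
  qed
  then show ?thesis
    using M representation_simps(1)[OF \<rho>]
    by (auto simp: invariant_subspace_def subspace_module_vec_iff mult_add_distrib_mat_vec
        mult_mat_vec mult_mat_zero_vec intro!: mult_mat_vec_carrier)
qed

lemma invariant_range:
  assumes \<rho>: "\<rho> \<in> hom G (GL n)" and \<sigma>: "\<sigma> \<in> hom G (GL m)"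
    and M: "M \<in> carrier_mat m n" and comm: "\<And>g. g \<in> carrier G \<Longrightarrow> M * \<rho> g = \<sigma> g * M"
  shows "invariant_subspace G m \<sigma> ((\<lambda>v. M *\<^sub>v v) ` carrier_vec n)" (is "invariant_subspace _ _ _ ?W")
proof -
  have "\<sigma> g *\<^sub>v (M *\<^sub>v v) = M *\<^sub>v (\<rho> g *\<^sub>v v)" if "g \<in> carrier G" "v \<in> carrier_vec n" for g v
    using M that representation_simps(1)[OF \<rho>] representation_simps(1)[OF \<sigma>] comm
    by (metis assoc_mult_mat_vec)
  then have "\<sigma> g *\<^sub>v w \<in> ?W" if "g \<in> carrier G" "w \<in> ?W" for g w
    using that representation_simps(1)[OF \<rho>] mult_mat_vec_carrier by fastforce
  moreover have "v + w \<in> ?W" if vw: "v \<in> ?W" "w \<in> ?W" for v w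
  proof -
    from vw obtain v' w' where "v' \<in> carrier_vec n" "w' \<in> carrier_vec n" "v = M *\<^sub>v v'" "w = M *\<^sub>v w'"
      by auto
    then have "v + w = M *\<^sub>v (v' + w')" "v' + w' \<in> carrier_vec n"
      using M by (auto simp: mult_add_distrib_mat_vec)
    then show ?thesis by blast
  qed
  moreover have "c \<cdot>\<^sub>v v \<in> ?W" if v: "v \<in> ?W" for c v
  proof -
    from v obtain v' where "v' \<in> carrier_vec n" "v = M *\<^sub>v v'" by auto
    then have "c \<cdot>\<^sub>v v = M *\<^sub>v (c \<cdot>\<^sub>v v')" "c \<cdot>\<^sub>v v' \<in> carrier_vec n"
      using M by (auto simp: mult_mat_vec)
    then show ?thesis by blast
  qed
  moreover have "0\<^sub>v m \<in> ?W"
    using M by (intro image_eqI[of _ _ "0\<^sub>v n"]) auto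
  moreover have "?W \<subseteq> carrier_vec m" using M by auto
  ultimately show ?thesis
    by (simp add: invariant_subspace_def subspace_module_vec_iff)
qed

text \<open>Kernel and image of \<open>M\<close> are invariant, so a nonzero \<open>M\<close> is bijective.  With an inverse \<open>Q\<close> of
\<open>M\<close>, cyclicity of the trace gives
\<open>tr (\<sigma> g) = tr (\<sigma> g M Q) = tr (M \<rho> g Q) = tr (\<rho> g Q M) = tr (\<rho> g)\<close>.
The argument covers rectangular \<open>M\<close>, so the two degrees need not be compared first.\<close>

lemma schur_intertwiner:
  assumes \<rho>: "irreducible_representation G n \<rho>" and \<sigma>: "irreducible_representation G m \<sigma>"
    and M: "M \<in> carrier_mat m n" and comm: "\<And>g. g \<in> carrier G \<Longrightarrow> M * \<rho> g = \<sigma> g * M"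
    and ne: "character_of G \<rho> \<noteq> character_of G \<sigma>"
  shows "M = 0\<^sub>m m n"
proof (rule ccontr)
  assume M0: "M \<noteq> 0\<^sub>m m n"
  note r = irreducible_representationD[OF \<rho>] and s = irreducible_representationD[OF \<sigma>]
  obtain v0 where v0: "v0 \<in> carrier_vec n" "M *\<^sub>v v0 \<noteq> 0\<^sub>v m"
    using zero_mat_if_mult_vec_zero[OF M] M0 by blast
  have ker: "v = 0\<^sub>v n" if v: "v \<in> carrier_vec n" "M *\<^sub>v v = 0\<^sub>v m" for v
  proof -
    let ?K = "{v \<in> carrier_vec n. M *\<^sub>v v = 0\<^sub>v m}"
    have "invariant_subspace G n \<rho> ?K" by (rule invariant_kernel[OF r(2) s(2) M comm])
    from r(3)[OF this] have "?K = {0\<^sub>v n}" using v0 by blast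
    then show ?thesis using v by blast
  qed
  have surj: "(\<lambda>v. M *\<^sub>v v) ` carrier_vec n = carrier_vec m"
  proof -
    have "invariant_subspace G m \<sigma> ((\<lambda>v. M *\<^sub>v v) ` carrier_vec n)"
      by (rule invariant_range[OF r(2) s(2) M comm])
    from s(3)[OF this] show ?thesis using v0 by blast
  qed
  \<comment> \<open>Preimages of the unit vectors are the columns of a right inverse of \<open>M\<close>.\<close>
  have "\<exists>w. w \<in> carrier_vec n \<and> M *\<^sub>v w = unit_vec m j" for j
    using surj unit_vec_carrier[of m j] by (metis imageE)
  then obtain w where w: "\<And>j. w j \<in> carrier_vec n" "\<And>j. M *\<^sub>v w j = unit_vec m j"
    by metis
  define Q where "Q = mat n m (\<lambda>(i, j). w j $ i)"
  have Q: "Q \<in> carrier_mat n m" by (simp add: Q_def)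
  have colQ: "col Q j = w j" if "j < m" for j
    using that w(1)[of j] by (intro eq_vecI) (auto simp: Q_def)
  have MQ: "M * Q = 1\<^sub>m m"
  proof (rule eq_matI)
    fix i j assume "i < dim_row (1\<^sub>m m :: complex mat)" "j < dim_col (1\<^sub>m m :: complex mat)"
    then have ij: "i < m" "j < m" by auto
    have "(M * Q) $$ (i, j) = (M *\<^sub>v w j) $ i"
      using ij M Q by (simp add: colQ)
    then show "(M * Q) $$ (i, j) = 1\<^sub>m m $$ (i, j)"
      using ij by (simp add: w unit_vec_def)
  qed (use M Q in auto)
  have QM: "Q * M = 1\<^sub>m n"
  proof -
    have "(Q * M - 1\<^sub>m n) *\<^sub>v v = 0\<^sub>v n" if v: "v \<in> carrier_vec n" for v
    proof (rule ker)
      have eq: "(Q * M - 1\<^sub>m n) *\<^sub>v v = Q *\<^sub>v (M *\<^sub>v v) - v"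
        using v M Q by (simp add: minus_mult_distrib_mat_vec[of _ n n] assoc_mult_mat_vec[of _ n m])
      show "(Q * M - 1\<^sub>m n) *\<^sub>v v \<in> carrier_vec n"
        using v M Q by (intro mult_mat_vec_carrier[of _ n n]) auto
      have "M *\<^sub>v (Q *\<^sub>v (M *\<^sub>v v)) = M * Q *\<^sub>v (M *\<^sub>v v)"
        using v M Q by (subst assoc_mult_mat_vec[of _ m n _ m]) auto
      then show "M *\<^sub>v ((Q * M - 1\<^sub>m n) *\<^sub>v v) = 0\<^sub>v m"
        using v M Q by (simp add: eq MQ mult_minus_distrib_mat_vec[of _ m n])
    qed
    then have "Q * M - 1\<^sub>m n = 0\<^sub>m n n"
      using M Q by (intro zero_mat_if_mult_vec_zero) auto
    from minus_mat_eq_zeroD[OF _ _ this] show ?thesis using M Q by auto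
  qed
  have "mat_trace (\<sigma> g) = mat_trace (\<rho> g)" if g: "g \<in> carrier G" for g
  proof -
    note cr = representation_simps(1)[OF r(2) g] and cs = representation_simps(1)[OF s(2) g]
    have "mat_trace (\<sigma> g) = mat_trace (\<sigma> g * (M * Q))" using cs MQ by simp
    also have "\<sigma> g * (M * Q) = (\<sigma> g * M) * Q"
      using M Q cs by (simp add: assoc_mult_mat[of _ m m _ n _ m])
    also have "\<dots> = M * (\<rho> g * Q)"
      using M Q cr by (simp add: comm[OF g, symmetric] assoc_mult_mat[of _ m n _ n _ m])
    also have "mat_trace (M * (\<rho> g * Q)) = mat_trace (\<rho> g * Q * M)"
      using M Q cr by (intro mat_trace_mult_comm) auto
    also have "\<dots> = mat_trace (\<rho> g)" using M Q cr QM by (simp add: assoc_mult_mat[of _ n n _ m _ n])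
    finally show ?thesis .
  qed
  then have "character_of G \<rho> = character_of G \<sigma>" by (auto simp: character_of_def)
  with ne show False ..
qed

text \<open>For an eigenvalue \<open>k\<close> of \<open>M\<close>, the kernel of \<open>M - k I\<close> is a nonzero invariant subspace, hence
everything; the trace then determines \<open>k\<close>.\<close>

lemma schur_scalar:
  assumes \<rho>: "irreducible_representation G n \<rho>"
    and M: "M \<in> carrier_mat n n" and comm: "\<And>g. g \<in> carrier G \<Longrightarrow> M * \<rho> g = \<rho> g * M"
  shows "M = (mat_trace M / of_nat n) \<cdot>\<^sub>m 1\<^sub>m n"
proof -
  note r = irreducible_representationD[OF \<rho>]
  obtain k v where v: "v \<in> carrier_vec n" "v \<noteq> 0\<^sub>v n" "M *\<^sub>v v = k \<cdot>\<^sub>v v"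
    using spectrum_non_empty[OF M r(1)] M
    by (auto simp: spectrum_def eigenvalue_def eigenvector_def)
  define N where "N = M - k \<cdot>\<^sub>m 1\<^sub>m n"
  have N: "N \<in> carrier_mat n n" using M by (auto simp: N_def)
  have Nv: "N *\<^sub>v x = M *\<^sub>v x - k \<cdot>\<^sub>v x" if "x \<in> carrier_vec n" for x
    using M that by (simp add: N_def minus_mult_distrib_mat_vec[of _ n n] smult_mat_mult_vec)
  have "N * \<rho> g = \<rho> g * N" if g: "g \<in> carrier G" for g
    using representation_simps(1)[OF r(2) g] M
    by (simp add: N_def minus_mult_distrib_mat[of _ n n] mult_minus_distrib_mat[of _ n n]
        comm[OF g] mult_smult_distrib[of _ n n _ n] mult_smult_assoc_mat[of _ n n]
        right_mult_one_mat[of _ n n])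
  then have inv: "invariant_subspace G n \<rho> {x \<in> carrier_vec n. N *\<^sub>v x = 0\<^sub>v n}" (is "invariant_subspace _ _ _ ?K")
    by (rule invariant_kernel[OF r(2) r(2) N])
  have "N *\<^sub>v v = 0\<^sub>v n" using v Nv[OF v(1)] by simp
  then have "?K \<noteq> {0\<^sub>v n}" using v(1,2) by blast
  then have K: "?K = carrier_vec n" using r(3)[OF inv] by blast
  have "N = 0\<^sub>m n n"
    by (rule zero_mat_if_mult_vec_zero[OF N]) (use K in blast)
  from minus_mat_eq_zeroD[OF M _ this[unfolded N_def]] have eq: "M = k \<cdot>\<^sub>m 1\<^sub>m n" by simp
  have "mat_trace M = of_nat n * k" by (simp add: eq mat_trace_smult_one)
  with r(1) eq show ?thesis by simp
qed

end

section \<open>Orthogonality of irreducible characters\<close>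

text \<open>Sandwiching a matrix unit isolates a product of two diagonal entries.  Summed over the group
and over all matrix units, this turns Schur's lemma into a statement about products of traces.\<close>

lemma mat_unit_sandwich_entry:
  fixes A B :: "'a :: comm_semiring_1 mat"
  assumes "A \<in> carrier_mat m m" "B \<in> carrier_mat n n" "i < m" "j < n"
  shows "(A * mat m n (\<lambda>p. if p = (i, j) then 1 else 0) * B) $$ (i, j) = A $$ (i, i) * B $$ (j, j)"
proof -
  let ?E = "mat m n (\<lambda>p. if p = (i, j) then 1 else 0) :: 'a mat"
  have AE: "(A * ?E) $$ (i, l) = (if l = j then A $$ (i, i) else 0)" if "l < n" for l
  proof -
    have "(A * ?E) $$ (i, l) = (\<Sum>k<m. A $$ (i, k) * ?E $$ (k, l))"
      using assms that by (simp add: scalar_prod_def lessThan_atLeast0)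
    also have "\<dots> = (\<Sum>k<m. if k = i then (if l = j then A $$ (i, i) else 0) else 0)"
      using that by (intro sum.cong) auto
    also have "\<dots> = (if l = j then A $$ (i, i) else 0)" using assms by simp
    finally show ?thesis .
  qed
  have "(A * ?E * B) $$ (i, j) = (\<Sum>l<n. (A * ?E) $$ (i, l) * B $$ (l, j))"
    using assms by (simp add: scalar_prod_def lessThan_atLeast0)
  also have "\<dots> = (\<Sum>l<n. if l = j then A $$ (i, i) * B $$ (j, j) else 0)"
    by (intro sum.cong) (auto simp: AE)
  finally show ?thesis using assms by simp
qed

lemma mat_trace_mat_unit:
  "mat_trace (mat n n (\<lambda>p. if p = (i, j) then 1 else (0 :: 'a :: comm_semiring_1)))
    = (if i = j \<and> i < n then 1 else 0)"
proof -
  have "mat_trace (mat n n (\<lambda>p. if p = (i, j) then 1 else (0 :: 'a)))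
      = (\<Sum>k<n. if k = i then (if i = j then 1 else 0) else 0)"
    by (auto simp: mat_trace_def intro!: sum.cong)
  then show ?thesis by auto
qed

context finite_group
begin

lemma character_of_apply: "g \<in> carrier G \<Longrightarrow> character_of G \<rho> g = mat_trace (\<rho> g)"
  by (simp add: character_of_def)

lemma character_of_one: "\<rho> \<in> hom G (GL n) \<Longrightarrow> character_of G \<rho> \<one> = of_nat n"
  by (simp add: character_of_apply representation_simps mat_trace_one)

lemma IrrE:
  assumes "\<chi> \<in> Irr G"
  obtains n \<rho> where "irreducible_representation G n \<rho>" "\<chi> = character_of G \<rho>"
    "\<chi> \<one> = of_nat n" "n > 0" "\<rho> \<in> hom G (GL n)"
    "\<And>g. g \<in> carrier G \<Longrightarrow> \<rho> g \<in> carrier_mat n n"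
    "\<And>g. g \<in> carrier G \<Longrightarrow> \<chi> g = mat_trace (\<rho> g)"
proof -
  obtain n \<rho> where r: "irreducible_representation G n \<rho>" "\<chi> = character_of G \<rho>"
    using assms unfolding Irr_def by blast
  note r' = irreducible_representationD[OF r(1)]
  show thesis
    using r r' representation_simps(1)[OF r'(2)] character_of_one[OF r'(2)] character_of_apply
    by (intro that) auto
qed

lemma Irr_I: "irreducible_representation G n \<rho> \<Longrightarrow> character_of G \<rho> \<in> Irr G"
  unfolding Irr_def by blast

lemma conj_bij_betw:
  assumes "h \<in> carrier G"
  shows "bij_betw (\<lambda>g. h \<otimes> g \<otimes> inv h) (carrier G) (carrier G)"
proof (rule bij_betw_byWitness[where f' = "\<lambda>g. inv h \<otimes> g \<otimes> h"])
  show "\<forall>a\<in>carrier G. inv h \<otimes> (h \<otimes> a \<otimes> inv h) \<otimes> h = a"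
    using assms by (metis inv_closed inv_solve_right' m_assoc m_closed inv_solve_left)
  show "\<forall>a\<in>carrier G. h \<otimes> (inv h \<otimes> a \<otimes> h) \<otimes> inv h = a"
    using assms by (metis inv_closed inv_solve_right' m_assoc m_closed inv_solve_left inv_solve_right)
qed (use assms in auto)

lemma conj_inv_cancel:
  "x \<in> carrier G \<Longrightarrow> g \<in> carrier G \<Longrightarrow> inv x \<otimes> (x \<otimes> g \<otimes> inv x) \<otimes> x = g"
  by (metis inv_closed inv_solve_right' m_assoc m_closed inv_solve_left)

lemma lmult_bij_betw:
  assumes "h \<in> carrier G"
  shows "bij_betw (\<lambda>g. h \<otimes> g) (carrier G) (carrier G)"
  using assms by (intro bij_betw_byWitness[where f' = "\<lambda>g. inv h \<otimes> g"])
    (auto simp flip: m_assoc)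

lemma character_conj:
  assumes "\<chi> \<in> Irr G" "g \<in> carrier G" "x \<in> carrier G"
  shows "\<chi> (x \<otimes> g \<otimes> inv x) = \<chi> g"
proof -
  obtain n \<rho> where r: "\<rho> \<in> hom G (GL n)" "\<And>g. g \<in> carrier G \<Longrightarrow> \<rho> g \<in> carrier_mat n n"
    "\<And>g. g \<in> carrier G \<Longrightarrow> \<chi> g = mat_trace (\<rho> g)" using IrrE[OF assms(1)] by metis
  have "\<chi> (x \<otimes> g \<otimes> inv x) = mat_trace (\<rho> x * (\<rho> g * \<rho> (inv x)))"
    using assms r representation_simps(2)[OF r(1)] by (simp add: assoc_mult_mat[of _ n n _ n _ n])
  also have "\<dots> = mat_trace (\<rho> g * \<rho> (inv x) * \<rho> x)"
    using assms r by (intro mat_trace_mult_comm[of _ n n] mult_carrier_mat[of _ n n]) auto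
  also have "\<dots> = mat_trace (\<rho> g)"
    using assms r representation_simps(5)[OF r(1)]
    by (simp add: assoc_mult_mat[of _ n n _ n _ n] right_mult_one_mat[of _ n n])
  finally show ?thesis using assms r by simp
qed

text \<open>A class function is a central element of the group algebra, so it acts as a scalar by Schur's
lemma; the trace identifies the scalar.\<close>

lemma class_function_scalar:
  assumes \<rho>: "irreducible_representation G n \<rho>"
    and f: "\<And>x g. x \<in> carrier G \<Longrightarrow> g \<in> carrier G \<Longrightarrow> f (x \<otimes> g \<otimes> inv x) = f g"
  shows "mat_sum n n (\<lambda>g. f g \<cdot>\<^sub>m \<rho> g) (carrier G) =
    ((\<Sum>g\<in>carrier G. f g * mat_trace (\<rho> g)) / of_nat n) \<cdot>\<^sub>m 1\<^sub>m n" (is "?M = _")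
proof -
  note r = irreducible_representationD[OF \<rho>]
  note s = representation_simps[OF r(2)]
  have "?M * \<rho> h = \<rho> h * ?M" if h: "h \<in> carrier G" for h
  proof -
    have "?M * \<rho> h = mat_sum n n (\<lambda>g. f g \<cdot>\<^sub>m \<rho> (g \<otimes> h)) (carrier G)"
      using h s by (subst mat_sum_mult[of _ n n]) (auto intro!: mat_sum_cong mult_smult_assoc_mat[of _ n n _ n])
    also have "\<dots> = mat_sum n n (\<lambda>g. f (h \<otimes> g \<otimes> inv h) \<cdot>\<^sub>m \<rho> (h \<otimes> g \<otimes> inv h \<otimes> h)) (carrier G)"
      by (rule mat_sum_reindex_bij_betw[OF conj_bij_betw[OF h], symmetric])
    also have "\<dots> = mat_sum n n (\<lambda>g. f g \<cdot>\<^sub>m \<rho> (h \<otimes> g)) (carrier G)"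
      using h f by (intro mat_sum_cong) (simp add: m_assoc)
    also have "\<dots> = \<rho> h * ?M"
      using h s by (subst mult_mat_sum[of _ n n])
        (auto intro!: mat_sum_cong mult_smult_distrib[of _ n n _ n, symmetric])
    finally show ?thesis .
  qed
  from schur_scalar[OF \<rho> _ this]
  have "?M = (mat_trace ?M / of_nat n) \<cdot>\<^sub>m 1\<^sub>m n" by simp
  moreover have "mat_trace ?M = (\<Sum>g\<in>carrier G. mat_trace (f g \<cdot>\<^sub>m \<rho> g))"
    by (rule mat_trace_mat_sum) (simp add: s)
  moreover have "\<dots> = (\<Sum>g\<in>carrier G. f g * mat_trace (\<rho> g))"
    by (intro sum.cong) (auto simp: mat_trace_smult[OF s(1)])
  ultimately show ?thesis by simp
qed

text \<open>Left translation by \<open>h\<close> permutes the summands of an average over the group.\<close>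

lemma averaged_intertwiner:
  assumes \<rho>: "\<rho> \<in> hom G (GL n)" and \<sigma>: "\<sigma> \<in> hom G (GL m)"
    and E: "E \<in> carrier_mat m n" and h: "h \<in> carrier G"
  defines "T \<equiv> mat_sum m n (\<lambda>g. \<sigma> g * E * \<rho> (inv g)) (carrier G)"
  shows "T * \<rho> h = \<sigma> h * T"
proof -
  note r = representation_simps[OF \<rho>] and s = representation_simps[OF \<sigma>]
  note c = mult_carrier_mat[of _ m m _ n] mult_carrier_mat[of _ m n _ n]
  have ct: "\<sigma> g * E * \<rho> (inv g) \<in> carrier_mat m n" if "g \<in> carrier G" for g
    using that by (intro mult_carrier_mat[OF mult_carrier_mat[OF s(1) E] r(1)]) auto
  have "T * \<rho> h = mat_sum m n (\<lambda>g. \<sigma> g * E * \<rho> (inv g) * \<rho> h) (carrier G)"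
    unfolding T_def using h r(1) ct by (intro mat_sum_mult) auto
  also have "\<dots> = mat_sum m n (\<lambda>g. \<sigma> (h \<otimes> g) * E * \<rho> (inv (h \<otimes> g)) * \<rho> h) (carrier G)"
    by (rule mat_sum_reindex_bij_betw[OF lmult_bij_betw[OF h], symmetric])
  also have "\<dots> = mat_sum m n (\<lambda>g. \<sigma> h * (\<sigma> g * E * \<rho> (inv g))) (carrier G)"
  proof (rule mat_sum_cong)
    fix g assume g: "g \<in> carrier G"
    have "\<rho> (inv (h \<otimes> g)) * \<rho> h = \<rho> (inv g)"
      using g h by (simp add: inv_mult_group m_assoc flip: r(2))
    then show "\<sigma> (h \<otimes> g) * E * \<rho> (inv (h \<otimes> g)) * \<rho> h = \<sigma> h * (\<sigma> g * E * \<rho> (inv g))"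
      using g h E r(1) s(1,2)
      by (simp add: assoc_mult_mat[of _ m m _ m _ n] assoc_mult_mat[of _ m m _ n _ n]
          assoc_mult_mat[of _ m n _ n _ n] c)
  qed
  also have "\<dots> = \<sigma> h * T"
    unfolding T_def using h s(1) ct by (intro mult_mat_sum[symmetric]) auto
  finally show ?thesis .
qed

lemma sum_trace_trace:
  assumes \<rho>: "\<rho> \<in> hom G (GL n)" and \<sigma>: "\<sigma> \<in> hom G (GL m)"
  shows "(\<Sum>g\<in>carrier G. mat_trace (\<sigma> g) * mat_trace (\<rho> (inv g))) =
    (\<Sum>i<m. \<Sum>j<n. mat_sum m n (\<lambda>g. \<sigma> g * mat m n (\<lambda>p. if p = (i, j) then 1 else 0) * \<rho> (inv g))
      (carrier G) $$ (i, j))"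
proof -
  note r = representation_simps[OF \<rho>] and s = representation_simps[OF \<sigma>]
  have "(\<Sum>g\<in>carrier G. mat_trace (\<sigma> g) * mat_trace (\<rho> (inv g))) =
      (\<Sum>g\<in>carrier G. \<Sum>i<m. \<Sum>j<n. \<sigma> g $$ (i, i) * \<rho> (inv g) $$ (j, j))"
  proof (rule sum.cong[OF refl])
    fix g assume "g \<in> carrier G"
    then have "dim_row (\<sigma> g) = m" "dim_row (\<rho> (inv g)) = n"
      using r(1) s(1) by (metis carrier_matD(1) inv_closed)+
    then show "mat_trace (\<sigma> g) * mat_trace (\<rho> (inv g)) =
        (\<Sum>i<m. \<Sum>j<n. \<sigma> g $$ (i, i) * \<rho> (inv g) $$ (j, j))"
      by (simp add: mat_trace_def sum_product)
  qed
  also have "\<dots> = (\<Sum>i<m. \<Sum>g\<in>carrier G. \<Sum>j<n. \<sigma> g $$ (i, i) * \<rho> (inv g) $$ (j, j))"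
    by (rule sum.swap)
  also have "\<dots> = (\<Sum>i<m. \<Sum>j<n. \<Sum>g\<in>carrier G. \<sigma> g $$ (i, i) * \<rho> (inv g) $$ (j, j))"
    by (intro sum.cong refl sum.swap)
  also have "\<dots> = (\<Sum>i<m. \<Sum>j<n. mat_sum m n (\<lambda>g. \<sigma> g * mat m n (\<lambda>p. if p = (i, j) then 1 else 0)
      * \<rho> (inv g)) (carrier G) $$ (i, j))"
  proof (intro sum.cong refl)
    fix i j assume "i \<in> {..<m}" "j \<in> {..<n}"
    then show "(\<Sum>g\<in>carrier G. \<sigma> g $$ (i, i) * \<rho> (inv g) $$ (j, j)) =
        mat_sum m n (\<lambda>g. \<sigma> g * mat m n (\<lambda>p. if p = (i, j) then 1 else 0) * \<rho> (inv g))
          (carrier G) $$ (i, j)"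
      unfolding mat_sum_def using r(1) s(1)
      by (simp add: mat_unit_sandwich_entry[of _ m _ n])
  qed
  finally show ?thesis .
qed

text \<open>By Schur's lemma the averages of the matrix units vanish if the characters differ and are
scalars of known trace if the representations coincide; \<open>sum_trace_trace\<close> reads off the sum.\<close>

theorem character_orthogonality:
  assumes "\<chi> \<in> Irr G" "\<psi> \<in> Irr G"
  shows "(\<Sum>g\<in>carrier G. \<psi> g * \<chi> (inv g)) = (if \<chi> = \<psi> then of_nat (Coset.order G) else 0)"
proof (cases "\<chi> = \<psi>")
  case False
  obtain n \<rho> where r: "irreducible_representation G n \<rho>" "\<chi> = character_of G \<rho>" "\<rho> \<in> hom G (GL n)"
    using IrrE[OF assms(1)] by metis
  obtain m \<sigma> where s: "irreducible_representation G m \<sigma>" "\<psi> = character_of G \<sigma>" "\<sigma> \<in> hom G (GL m)"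
    using IrrE[OF assms(2)] by metis
  have 0: "mat_sum m n (\<lambda>g. \<sigma> g * mat m n (\<lambda>p. if p = (i, j) then 1 else 0) * \<rho> (inv g)) (carrier G)
      = 0\<^sub>m m n" for i j
    using r s False averaged_intertwiner[OF r(3) s(3)]
    by (intro schur_intertwiner[OF r(1) s(1)]) auto
  have "(\<Sum>g\<in>carrier G. \<psi> g * \<chi> (inv g)) = (\<Sum>g\<in>carrier G. mat_trace (\<sigma> g) * mat_trace (\<rho> (inv g)))"
    by (intro sum.cong) (auto simp: r s character_of_apply)
  also have "\<dots> = 0"
    unfolding sum_trace_trace[OF r(3) s(3)] 0 by simp
  finally show ?thesis using False by simp
next
  case True
  obtain n \<rho> where r: "irreducible_representation G n \<rho>" "\<chi> = character_of G \<rho>" "\<rho> \<in> hom G (GL n)" "n > 0"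
    using IrrE[OF assms(1)] by metis
  note rs = representation_simps[OF r(3)]
  let ?T = "\<lambda>i j. mat_sum n n (\<lambda>g. \<rho> g * mat n n (\<lambda>p. if p = (i, j) then 1 else 0) * \<rho> (inv g)) (carrier G)"
  have T: "?T i j $$ (i, j) = (if i = j then of_nat (Coset.order G) / of_nat n else 0)"
    if ij: "i < n" "j < n" for i j
  proof -
    let ?E = "mat n n (\<lambda>p. if p = (i, j) then 1 else 0) :: complex mat"
    have "?T i j = (mat_trace (?T i j) / of_nat n) \<cdot>\<^sub>m 1\<^sub>m n"
      using averaged_intertwiner[OF r(3) r(3)] by (intro schur_scalar[OF r(1)]) auto
    moreover have "mat_trace (?T i j) = (\<Sum>g\<in>carrier G. mat_trace (\<rho> g * ?E * \<rho> (inv g)))"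
      using rs(1) by (intro mat_trace_mat_sum mult_carrier_mat[of _ n n]) auto
    moreover have "\<dots> = (\<Sum>g\<in>carrier G. mat_trace ?E)"
    proof (rule sum.cong[OF refl])
      fix g assume g: "g \<in> carrier G"
      have "mat_trace (\<rho> g * ?E * \<rho> (inv g)) = mat_trace (\<rho> (inv g) * (\<rho> g * ?E))"
        using g rs(1) by (intro mat_trace_mult_comm[of _ n n] mult_carrier_mat[of _ n n]) auto
      also have "\<dots> = mat_trace (\<rho> (inv g) * \<rho> g * ?E)"
        using g rs(1) by (subst assoc_mult_mat[of _ n n _ n _ n]) auto
      also have "\<dots> = mat_trace ?E" using g rs(5) by simp
      finally show "mat_trace (\<rho> g * ?E * \<rho> (inv g)) = mat_trace ?E" .
    qed
    ultimately have "?T i j = (of_nat (Coset.order G) * (if i = j then 1 else 0) / of_nat n) \<cdot>\<^sub>m 1\<^sub>m n"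
      using ij by (simp add: mat_trace_mat_unit Coset.order_def)
    then show ?thesis using ij by simp
  qed
  have "(\<Sum>g\<in>carrier G. \<psi> g * \<chi> (inv g)) = (\<Sum>g\<in>carrier G. mat_trace (\<rho> g) * mat_trace (\<rho> (inv g)))"
    unfolding True[symmetric] by (intro sum.cong) (auto simp: r character_of_apply)
  also have "\<dots> = (\<Sum>i<n. \<Sum>j<n. if i = j then of_nat (Coset.order G) / of_nat n else 0)"
    unfolding sum_trace_trace[OF r(3) r(3)] by (intro sum.cong refl T) auto
  also have "\<dots> = of_nat (Coset.order G)" using r(4) by (simp add: sum.delta)
  finally show ?thesis using True by simp
qed

lemma trivial_irreducible: "irreducible_representation G 1 (\<lambda>_. 1\<^sub>m 1)"
proof -
  have "W = {0\<^sub>v 1} \<or> W = carrier_vec 1" if W: "invariant_subspace G 1 (\<lambda>_. 1\<^sub>m 1) W" for W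
  proof (cases "W \<subseteq> {0\<^sub>v 1}")
    case True
    then show ?thesis using W by (auto simp: invariant_subspace_def subspace_module_vec_iff)
  next
    case False
    then obtain w where w: "w \<in> W" "w \<noteq> 0\<^sub>v 1" by auto
    have cw: "w \<in> carrier_vec 1" using W w by (auto simp: invariant_subspace_def subspace_module_vec_iff)
    with w have w0: "w $ 0 \<noteq> 0" by (metis carrier_vecD eq_vecI index_zero_vec less_one)
    have "v \<in> W" if v: "v \<in> carrier_vec 1" for v
    proof -
      have "v = (v $ 0 / w $ 0) \<cdot>\<^sub>v w" using v cw w0 by (intro eq_vecI) auto
      then show ?thesis using W w by (metis invariant_subspace_def subspace_module_vec_iff)
    qed
    then show ?thesis using W by (auto simp: invariant_subspace_def subspace_module_vec_iff)
  qed
  moreover have "1\<^sub>m 1 \<in> carrier (GL 1)" by (rule GL_I[where B = "1\<^sub>m 1"]) auto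
  ultimately show ?thesis
    by (auto simp: irreducible_representation_def hom_def GL_simps)
qed

definition trivial_character :: "'a \<Rightarrow> complex" where
  "trivial_character = (\<lambda>g\<in>carrier G. 1)"

lemma trivial_character_Irr: "trivial_character \<in> Irr G"
proof -
  have "character_of G (\<lambda>_. 1\<^sub>m 1) = trivial_character"
    by (auto simp: character_of_def trivial_character_def mat_trace_one)
  then show ?thesis using Irr_I[OF trivial_irreducible] by simp
qed

lemma sum_character_eq_0:
  assumes "\<chi> \<in> Irr G" "\<chi> \<noteq> trivial_character"
  shows "(\<Sum>g\<in>carrier G. \<chi> g) = 0"
proof -
  have "(\<Sum>g\<in>carrier G. \<chi> g) = (\<Sum>g\<in>carrier G. \<chi> g * trivial_character (inv g))"
    by (intro sum.cong) (auto simp: trivial_character_def)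
  then show ?thesis
    using character_orthogonality[OF trivial_character_Irr assms(1)] assms(2) by auto
qed

end

section \<open>Faithfulness of the irreducible representations on the group algebra\<close>

text \<open>The group algebra is the space of complex functions that vanish outside the group, with left
  translation as the action of \<open>G\<close>.\<close>

definition fscale :: "complex \<Rightarrow> ('x \<Rightarrow> complex) \<Rightarrow> 'x \<Rightarrow> complex" where
  "fscale c f = (\<lambda>x. c * f x)"

lemma fscale_apply [simp]: "fscale c f x = c * f x"
  by (simp add: fscale_def)

interpretation fun_space: vector_space "fscale :: complex \<Rightarrow> ('x \<Rightarrow> complex) \<Rightarrow> _"
  by unfold_locales (auto simp: fun_eq_iff algebra_simps)

lemma sum_fun_apply: "(\<Sum>i\<in>S. F i) x = (\<Sum>i\<in>S. F i x :: 'b :: comm_monoid_add)"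
  by (induction S rule: infinite_finite_induct) auto

context finite_group
begin

definition lshift :: "'a \<Rightarrow> ('a \<Rightarrow> complex) \<Rightarrow> 'a \<Rightarrow> complex" where
  "lshift h f = (\<lambda>x. if x \<in> carrier G then f (inv h \<otimes> x) else 0)"

definition supported :: "('a \<Rightarrow> complex) \<Rightarrow> bool" where
  "supported f \<longleftrightarrow> (\<forall>x. x \<notin> carrier G \<longrightarrow> f x = 0)"

definition shift_invariant :: "('a \<Rightarrow> complex) set \<Rightarrow> bool" where
  "shift_invariant W \<longleftrightarrow> (\<forall>h\<in>carrier G. \<forall>f\<in>W. lshift h f \<in> W)"

lemma lshift_sum: "lshift h (\<Sum>i\<in>S. F i) = (\<Sum>i\<in>S. lshift h (F i))"
  by (auto simp: lshift_def sum_fun_apply)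

lemma lshift_scale: "lshift h (fscale c f) = fscale c (lshift h f)"
  by (auto simp: lshift_def)

lemma lshift_mult:
  "g \<in> carrier G \<Longrightarrow> h \<in> carrier G \<Longrightarrow> lshift (g \<otimes> h) f = lshift g (lshift h f)"
  by (auto simp: lshift_def inv_mult_group m_assoc)

lemma lshift_one: "supported f \<Longrightarrow> lshift \<one> f = f"
  by (auto simp: lshift_def supported_def)

text \<open>A minimal left ideal affords an irreducible matrix representation: the matrix of a group element
consists of the coordinates of the translated basis functions.\<close>

lemma shift_representation:
  assumes fin: "finite B" and ind: "fun_space.independent B" and ne: "B \<noteq> {}"
    and supp: "\<And>f. f \<in> B \<Longrightarrow> supported f" and inv: "shift_invariant (fun_space.span B)"
    and simple: "\<And>W. fun_space.subspace W \<Longrightarrow> W \<subseteq> fun_space.span B \<Longrightarrow> shift_invariant W \<Longrightarrow>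
      W = {0} \<or> W = fun_space.span B"
  obtains b n \<sigma> where "bij_betw b {..<n} B" "irreducible_representation G n \<sigma>"
    "\<And>h j. h \<in> carrier G \<Longrightarrow> j < n \<Longrightarrow> lshift h (b j) = (\<Sum>i<n. fscale (\<sigma> h $$ (i, j)) (b i))"
proof -
  define n where "n = card B"
  obtain b where b: "bij_betw b {..<n} B"
    using ex_bij_betw_nat_finite[OF fin] by (auto simp: n_def lessThan_atLeast0)
  define R where "R = fun_space.representation B"
  define \<sigma> where "\<sigma> h = mat n n (\<lambda>(i, j). R (lshift h (b j)) (b i))" for h
  \<comment> \<open>\<open>\<Phi>\<close> identifies coordinate vectors with functions; it is injective and equivariant, so it carries
    invariant subspaces to translation invariant ones.\<close>
  define \<Phi> where "\<Phi> w = (\<Sum>i<n. fscale (w $ i) (b i))" for w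
  have n: "n > 0" using fin ne by (simp add: n_def card_gt_0_iff)
  have bB: "b i \<in> B" if "i < n" for i using b that by (auto simp: bij_betw_def)
  have bS: "b i \<in> fun_space.span B" if "i < n" for i using bB[OF that] by (rule fun_space.span_base)
  have b_inj: "b i = b j \<longleftrightarrow> i = j" if "i < n" "j < n" for i j
    using b that by (auto simp: bij_betw_def inj_on_def)
  have shS: "lshift h f \<in> fun_space.span B" if "h \<in> carrier G" "f \<in> fun_space.span B" for h f
    using inv that by (auto simp: shift_invariant_def)
  have expand: "f = (\<Sum>i<n. fscale (R f (b i)) (b i))" if f: "f \<in> fun_space.span B" for f
  proof -
    have "(\<Sum>v\<in>B. fscale (R f v) v) = f"
      unfolding R_def by (rule fun_space.sum_representation_eq[OF ind f fin]) simp
    then show ?thesis by (simp add: sum.reindex_bij_betw[OF b, where g = "\<lambda>v. fscale (R f v) v"])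
  qed
  have RS: "R (\<Sum>k<n. fscale (c k) (F k)) = (\<lambda>v. \<Sum>k<n. c k * R (F k) v)"
    if "\<And>k. k < n \<Longrightarrow> F k \<in> fun_space.span B" for c F
    unfolding R_def using that
    by (subst fun_space.representation_sum[OF ind])
      (auto simp: fun_space.representation_scale[OF ind] fun_space.span_scale intro!: ext sum.cong)
  have Rb: "R (b j) (b i) = (if i = j then 1 else 0)" if "i < n" "j < n" for i j
    using that unfolding R_def by (simp add: fun_space.representation_basis[OF ind bB] b_inj)
  have act: "lshift h (b j) = (\<Sum>i<n. fscale (\<sigma> h $$ (i, j)) (b i))"
    if "h \<in> carrier G" "j < n" for h j
    using expand[OF shS[OF that(1) bS[OF that(2)]]] that(2) by (simp add: \<sigma>_def)
  have \<sigma>c: "\<sigma> h \<in> carrier_mat n n" for h by (simp add: \<sigma>_def)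
  have \<sigma>1: "\<sigma> \<one> = 1\<^sub>m n"
    by (rule eq_matI) (auto simp: \<sigma>_def lshift_one[OF supp[OF bB]] Rb)
  have \<sigma>m: "\<sigma> (g \<otimes> h) = \<sigma> g * \<sigma> h" if gh: "g \<in> carrier G" "h \<in> carrier G" for g h
  proof (rule eq_matI)
    fix i j assume "i < dim_row (\<sigma> g * \<sigma> h)" "j < dim_col (\<sigma> g * \<sigma> h)"
    then have ij: "i < n" "j < n" by (auto simp: \<sigma>_def)
    have "lshift (g \<otimes> h) (b j) = (\<Sum>k<n. fscale (\<sigma> h $$ (k, j)) (lshift g (b k)))"
      using gh ij by (simp add: lshift_mult act[OF gh(2)] lshift_sum lshift_scale)
    then have "\<sigma> (g \<otimes> h) $$ (i, j) = (\<Sum>k<n. \<sigma> h $$ (k, j) * R (lshift g (b k)) (b i))"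
      using ij gh bS shS by (simp add: \<sigma>_def RS)
    also have "\<dots> = (\<Sum>k<n. \<sigma> g $$ (i, k) * \<sigma> h $$ (k, j))"
      using ij by (intro sum.cong) (auto simp: \<sigma>_def)
    also have "\<dots> = (\<sigma> g * \<sigma> h) $$ (i, j)"
      using ij \<sigma>c by (simp add: scalar_prod_def lessThan_atLeast0 carrier_matD[OF \<sigma>c])
    finally show "\<sigma> (g \<otimes> h) $$ (i, j) = (\<sigma> g * \<sigma> h) $$ (i, j)" .
  qed (auto simp: \<sigma>_def)
  have hom: "\<sigma> \<in> hom G (GL n)"
  proof (rule homI)
    fix h assume h: "h \<in> carrier G"
    show "\<sigma> h \<in> carrier (GL n)"
      by (rule GL_I[OF \<sigma>c \<sigma>c[of "inv h"]]) (use h in \<open>simp_all add: \<sigma>1 flip: \<sigma>m\<close>)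
  qed (simp add: \<sigma>m GL_simps)
  have R\<Phi>: "R (\<Phi> w) (b i) = w $ i" if "i < n" for w i
  proof -
    have "R (\<Phi> w) (b i) = (\<Sum>k<n. w $ k * R (b k) (b i))" unfolding \<Phi>_def by (subst RS) (auto simp: bS)
    also have "\<dots> = (\<Sum>k<n. if k = i then w $ i else 0)" using that by (intro sum.cong) (auto simp: Rb)
    finally show ?thesis using that by simp
  qed
  have \<Phi>_inj: "v = w" if "\<Phi> v = \<Phi> w" "v \<in> carrier_vec n" "w \<in> carrier_vec n" for v w
    using that R\<Phi>[of _ v] R\<Phi>[of _ w] by (intro eq_vecI) auto
  have \<Phi>_act: "lshift h (\<Phi> w) = \<Phi> (\<sigma> h *\<^sub>v w)" if "h \<in> carrier G" "w \<in> carrier_vec n" for h w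
  proof -
    have "lshift h (\<Phi> w) = (\<Sum>j<n. fscale (w $ j) (\<Sum>i<n. fscale (\<sigma> h $$ (i, j)) (b i)))"
      using that by (simp add: \<Phi>_def lshift_sum lshift_scale act)
    also have "\<dots> = (\<Sum>j<n. \<Sum>i<n. fscale (\<sigma> h $$ (i, j) * w $ j) (b i))"
      by (simp add: fun_space.scale_sum_right mult.commute)
    also have "\<dots> = (\<Sum>i<n. \<Sum>j<n. fscale (\<sigma> h $$ (i, j) * w $ j) (b i))"
      by (rule sum.swap)
    also have "\<dots> = (\<Sum>i<n. fscale ((\<sigma> h *\<^sub>v w) $ i) (b i))"
      using that carrier_matD[OF \<sigma>c]
      by (intro sum.cong) (auto simp: scalar_prod_def lessThan_atLeast0 fun_space.scale_sum_left)
    finally show ?thesis by (simp add: \<Phi>_def)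
  qed
  have "W = {0\<^sub>v n} \<or> W = carrier_vec n" if W: "invariant_subspace G n \<sigma> W" for W
  proof -
    have Wc: "W \<subseteq> carrier_vec n" and W0: "0\<^sub>v n \<in> W"
      and Wa: "\<And>v w. v \<in> W \<Longrightarrow> w \<in> W \<Longrightarrow> v + w \<in> W" and Ws: "\<And>c v. v \<in> W \<Longrightarrow> c \<cdot>\<^sub>v v \<in> W"
      and Wi: "\<And>h v. h \<in> carrier G \<Longrightarrow> v \<in> W \<Longrightarrow> \<sigma> h *\<^sub>v v \<in> W"
      using W by (auto simp: invariant_subspace_def subspace_module_vec_iff)
    have \<Phi>0: "\<Phi> (0\<^sub>v n) = 0" by (simp add: \<Phi>_def)
    have "fun_space.subspace (\<Phi> ` W)"
    proof (rule fun_space.subspaceI)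
      show "0 \<in> \<Phi> ` W" using W0 \<Phi>0 by (metis imageI)
    next
      fix x y assume "x \<in> \<Phi> ` W" "y \<in> \<Phi> ` W"
      then obtain v w where vw: "v \<in> W" "w \<in> W" "x = \<Phi> v" "y = \<Phi> w" by auto
      have "v \<in> carrier_vec n" "w \<in> carrier_vec n" using vw Wc by auto
      then have "x + y = \<Phi> (v + w)"
        by (simp add: vw \<Phi>_def fun_space.scale_left_distrib sum.distrib)
      then show "x + y \<in> \<Phi> ` W" using Wa vw by blast
    next
      fix c x assume "x \<in> \<Phi> ` W"
      then obtain v where v: "v \<in> W" "x = \<Phi> v" by auto
      have "v \<in> carrier_vec n" using v Wc by auto
      then have "fscale c x = \<Phi> (c \<cdot>\<^sub>v v)"
        by (simp add: v \<Phi>_def fun_space.scale_sum_right)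
      then show "fscale c x \<in> \<Phi> ` W" using Ws v by blast
    qed
    moreover have "\<Phi> ` W \<subseteq> fun_space.span B"
      by (auto simp: \<Phi>_def intro!: fun_space.span_sum fun_space.span_scale bS)
    moreover have "shift_invariant (\<Phi> ` W)"
      unfolding shift_invariant_def
    proof (intro ballI)
      fix h f assume h: "h \<in> carrier G" and "f \<in> \<Phi> ` W"
      then obtain w where w: "w \<in> W" "f = \<Phi> w" by blast
      then have "lshift h f = \<Phi> (\<sigma> h *\<^sub>v w)" using \<Phi>_act[OF h] Wc by blast
      then show "lshift h f \<in> \<Phi> ` W" using Wi[OF h w(1)] by blast
    qed
    ultimately consider "\<Phi> ` W = {0}" | "\<Phi> ` W = fun_space.span B" using simple by blast
    then show ?thesis
    proof cases
      case 1
      have "w = 0\<^sub>v n" if w: "w \<in> W" for w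
      proof -
        have "\<Phi> w \<in> {0}" unfolding 1[symmetric] using w by (rule imageI)
        then have "\<Phi> w = \<Phi> (0\<^sub>v n)" by (simp only: \<Phi>0 singleton_iff)
        then show ?thesis by (rule \<Phi>_inj) (use w Wc in \<open>simp_all add: subsetD\<close>)
      qed
      then have "W = {0\<^sub>v n}" using W0 by blast
      then show ?thesis ..
    next
      case 2
      have "v \<in> W" if v: "v \<in> carrier_vec n" for v
      proof -
        have "\<Phi> v \<in> fun_space.span B"
          by (auto simp: \<Phi>_def intro!: fun_space.span_sum fun_space.span_scale bS)
        then obtain w where "w \<in> W" "\<Phi> v = \<Phi> w" using 2 by (metis imageE)
        then show ?thesis using \<Phi>_inj[of v w] v Wc by auto
      qed
      then show ?thesis using Wc by auto
    qed
  qed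
  then have "irreducible_representation G n \<sigma>"
    using n hom by (simp add: irreducible_representation_def)
  from that[OF b this act] show thesis by simp
qed

definition annihilating :: "('a \<Rightarrow> complex) set" where
  "annihilating = {f. supported f \<and> (\<forall>n \<rho>. irreducible_representation G n \<rho> \<longrightarrow>
     mat_sum n n (\<lambda>g. f g \<cdot>\<^sub>m \<rho> g) (carrier G) = 0\<^sub>m n n)}"

lemma annihilatingD:
  "f \<in> annihilating \<Longrightarrow> irreducible_representation G n \<rho> \<Longrightarrow> i < n \<Longrightarrow> j < n \<Longrightarrow>
    (\<Sum>g\<in>carrier G. f g * \<rho> g $$ (i, j)) = 0"
proof -
  assume f: "f \<in> annihilating" and r: "irreducible_representation G n \<rho>" and ij: "i < n" "j < n"
  have "mat_sum n n (\<lambda>g. f g \<cdot>\<^sub>m \<rho> g) (carrier G) $$ (i, j) = 0"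
    using f r ij by (auto simp: annihilating_def)
  moreover have "(f g \<cdot>\<^sub>m \<rho> g) $$ (i, j) = f g * \<rho> g $$ (i, j)" if "g \<in> carrier G" for g
    using representation_simps(1)[OF irreducible_representationD(2)[OF r] that] ij by simp
  ultimately show ?thesis using ij by (simp add: mat_sum_def)
qed

lemma annihilatingI:
  assumes "supported f"
    and "\<And>n \<rho> i j. irreducible_representation G n \<rho> \<Longrightarrow> i < n \<Longrightarrow> j < n \<Longrightarrow>
      (\<Sum>g\<in>carrier G. f g * \<rho> g $$ (i, j)) = 0"
  shows "f \<in> annihilating"
proof -
  have "mat_sum n n (\<lambda>g. f g \<cdot>\<^sub>m \<rho> g) (carrier G) = 0\<^sub>m n n"
    if r: "irreducible_representation G n \<rho>" for n \<rho>
  proof (rule eq_matI)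
    fix i j assume "i < dim_row (0\<^sub>m n n :: complex mat)" "j < dim_col (0\<^sub>m n n :: complex mat)"
    then have ij: "i < n" "j < n" by auto
    have "(f g \<cdot>\<^sub>m \<rho> g) $$ (i, j) = f g * \<rho> g $$ (i, j)" if "g \<in> carrier G" for g
      using representation_simps(1)[OF irreducible_representationD(2)[OF r] that] ij by simp
    then show "mat_sum n n (\<lambda>g. f g \<cdot>\<^sub>m \<rho> g) (carrier G) $$ (i, j) = 0\<^sub>m n n $$ (i, j)"
      using ij assms(2)[OF r] by (simp add: mat_sum_def)
  qed (auto simp: mat_sum_def)
  then show ?thesis using assms(1) by (simp add: annihilating_def)
qed

lemma subspace_annihilating: "fun_space.subspace annihilating"
proof (rule fun_space.subspaceI)
  show "0 \<in> annihilating" by (rule annihilatingI) (auto simp: supported_def)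
next
  fix f f' assume "f \<in> annihilating" "f' \<in> annihilating"
  then show "f + f' \<in> annihilating"
    using annihilatingD by (intro annihilatingI) (auto simp: annihilating_def supported_def distrib_right sum.distrib)
next
  fix c f assume "f \<in> annihilating"
  then show "fscale c f \<in> annihilating"
    using annihilatingD
    by (intro annihilatingI) (auto simp: annihilating_def supported_def mult.assoc simp flip: sum_distrib_left)
qed

lemma shift_invariant_annihilating: "shift_invariant annihilating"
  unfolding shift_invariant_def
proof (intro ballI annihilatingI)
  fix h f n \<rho> i j
  assume h: "h \<in> carrier G" and f: "f \<in> annihilating" and r: "irreducible_representation G n \<rho>"
    and ij: "i < n" "j < n"
  note rs = representation_simps[OF irreducible_representationD(2)[OF r]]
  have "(\<Sum>g\<in>carrier G. lshift h f g * \<rho> g $$ (i, j)) =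
      (\<Sum>g\<in>carrier G. lshift h f (h \<otimes> g) * \<rho> (h \<otimes> g) $$ (i, j))"
    by (rule sum.reindex_bij_betw[OF lmult_bij_betw[OF h], symmetric])
  also have "\<dots> = (\<Sum>g\<in>carrier G. \<Sum>k<n. f g * (\<rho> h $$ (i, k) * \<rho> g $$ (k, j)))"
  proof (rule sum.cong[OF refl])
    fix g assume g: "g \<in> carrier G"
    have "\<rho> (h \<otimes> g) $$ (i, j) = (\<Sum>k<n. \<rho> h $$ (i, k) * \<rho> g $$ (k, j))"
      using g h ij rs(1)[OF h] rs(1)[OF g] by (simp add: rs(2) scalar_prod_def lessThan_atLeast0)
    moreover have "lshift h f (h \<otimes> g) = f g" using g h by (simp add: lshift_def flip: m_assoc)
    ultimately show "lshift h f (h \<otimes> g) * \<rho> (h \<otimes> g) $$ (i, j) =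
        (\<Sum>k<n. f g * (\<rho> h $$ (i, k) * \<rho> g $$ (k, j)))" by (simp add: sum_distrib_left)
  qed
  also have "\<dots> = (\<Sum>k<n. \<rho> h $$ (i, k) * (\<Sum>g\<in>carrier G. f g * \<rho> g $$ (k, j)))"
    unfolding sum_distrib_left by (subst sum.swap) (simp add: mult_ac)
  also have "\<dots> = 0" using annihilatingD[OF f r] ij by simp
  finally show "(\<Sum>g\<in>carrier G. lshift h f g * \<rho> g $$ (i, j)) = 0" .
qed (auto simp: supported_def lshift_def)

lemma supported_in_span:
  assumes "supported f"
  shows "f \<in> fun_space.span ((\<lambda>g x. if x = g then 1 else 0) ` carrier G)"
proof -
  have "f = (\<Sum>g\<in>carrier G. fscale (f g) (\<lambda>x. if x = g then 1 else 0))"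
  proof
    fix x
    have "(\<Sum>g\<in>carrier G. f g * (if x = g then 1 else 0)) = (if x \<in> carrier G then f x else 0)"
      by (simp add: if_distrib sum.delta' cong: if_cong)
    then show "f x = (\<Sum>g\<in>carrier G. fscale (f g) (\<lambda>x. if x = g then 1 else 0)) x"
      using assms by (auto simp: sum_fun_apply supported_def)
  qed
  then show ?thesis
    by (metis (no_types, lifting) fun_space.span_base fun_space.span_scale fun_space.span_sum image_eqI)
qed

lemma annihilating_supported: "f \<in> annihilating \<Longrightarrow> supported f"
  by (simp add: annihilating_def)

text \<open>Otherwise the left ideal of annihilating functions contains a minimal nonzero left ideal.  This
ideal affords an irreducible representation, in which its own elements act as zero, so any two
of its elements have convolution product zero.  But with \<open>u \<noteq> 0\<close> it contains
\<open>f = u\<^sup>* u\<close>, where \<open>u\<^sup>* x = cnj (u x\<^sup>-\<^sup>1)\<close>.  The value \<open>f \<one> = \<Sum>x. |u x|\<^sup>2\<close> is nonzero and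
\<open>f\<^sup>* = f\<close>, whence \<open>(f f) \<one> = \<Sum>x. |f x|\<^sup>2\<close> is nonzero as well, a contradiction.\<close>

lemma annihilating_trivial: "annihilating = {0}"
proof (rule ccontr)
  assume nontriv: "annihilating \<noteq> {0}"
  let ?ok = "\<lambda>B. fun_space.independent B \<and> B \<subseteq> annihilating \<and> B \<noteq> {} \<and>
    shift_invariant (fun_space.span B)"
  have span_eq: "fun_space.span C = W" if "fun_space.subspace W" "C \<subseteq> W" "W \<subseteq> fun_space.span C" for C W
    by (rule equalityI[OF fun_space.span_minimal[OF that(2,1)] that(3)])
  obtain B0 where B0: "B0 \<subseteq> annihilating" "fun_space.independent B0" "annihilating \<subseteq> fun_space.span B0"
    by (rule fun_space.maximal_independent_subset[of annihilating])
  have "fun_space.span B0 = annihilating" using span_eq[OF subspace_annihilating] B0 by blast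
  moreover have "B0 \<noteq> {}" using calculation nontriv fun_space.span_empty by metis
  ultimately have "?ok B0" using B0 shift_invariant_annihilating by auto
  \<comment> \<open>Minimality of the left ideal is expressed by the cardinality of a basis.\<close>
  then obtain B where B: "?ok B" and min: "\<And>C. ?ok C \<Longrightarrow> card B \<le> card C"
    using ex_has_least_nat[of ?ok B0 card] by blast
  have BJ: "fun_space.span B \<subseteq> annihilating"
    using B by (intro fun_space.span_minimal subspace_annihilating) auto
  have fin: "finite B"
  proof -
    have "B \<subseteq> fun_space.span ((\<lambda>g x. if x = g then 1 else 0) ` carrier G)"
      using B supported_in_span annihilating_supported by blast
    then show ?thesis using B fun_space.independent_span_bound by blast
  qed
  have simple: "W = {0} \<or> W = fun_space.span B"
    if W: "fun_space.subspace W" "W \<subseteq> fun_space.span B" "shift_invariant W" for W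
  proof (rule ccontr)
    assume "\<not> ?thesis"
    then have ne: "W \<noteq> {0}" "W \<noteq> fun_space.span B" by auto
    obtain C where C: "C \<subseteq> W" "fun_space.independent C" "W \<subseteq> fun_space.span C"
      by (rule fun_space.maximal_independent_subset[of W])
    have spC: "fun_space.span C = W" using span_eq[OF W(1)] C by blast
    have "C \<noteq> {}" using spC ne by auto
    then have "card B \<le> card C" using C W spC BJ by (intro min) auto
    obtain f where f: "f \<in> fun_space.span B" "f \<notin> W" using ne W by auto
    have 1: "fun_space.independent (insert f C)"
      using f C spC by (intro fun_space.independent_insertI) auto
    have 2: "insert f C \<subseteq> fun_space.span B" using f C W by auto
    have "finite (insert f C)" "card (insert f C) \<le> card B"
      using fun_space.independent_span_bound[OF fin 1 2] by auto
    moreover have "f \<notin> C" using f C by auto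
    ultimately show False using \<open>card B \<le> card C\<close> by simp
  qed
  have ind: "fun_space.independent B" and ne: "B \<noteq> {}" and sinv: "shift_invariant (fun_space.span B)"
    using B by auto
  have supp: "supported f" if "f \<in> B" for f using B that annihilating_supported by blast
  obtain b n \<sigma> where b: "bij_betw b {..<n} B" and \<sigma>: "irreducible_representation G n \<sigma>"
    and act: "\<And>h j. h \<in> carrier G \<Longrightarrow> j < n \<Longrightarrow> lshift h (b j) = (\<Sum>i<n. fscale (\<sigma> h $$ (i, j)) (b i))"
    by (rule shift_representation[OF fin ind ne supp sinv simple]; (assumption | (rule that; assumption)))
  \<comment> \<open>The left-hand side is the value at \<open>x\<close> of the convolution of \<open>f\<close> and \<open>v\<close>.\<close>
  have conv: "(\<Sum>h\<in>carrier G. f h * lshift h v x) = 0"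
    if f: "f \<in> annihilating" and v: "v \<in> fun_space.span B" for f v x
    using v
  proof (induction rule: fun_space.span_induct_alt)
    case base
    show ?case by (simp add: lshift_def)
  next
    case (step c u v)
    obtain j where j: "j < n" "u = b j" using step b by (auto simp: bij_betw_def)
    have "(\<Sum>h\<in>carrier G. f h * lshift h u x) = (\<Sum>h\<in>carrier G. \<Sum>i<n. f h * \<sigma> h $$ (i, j) * b i x)"
      using j by (intro sum.cong) (auto simp: act sum_fun_apply sum_distrib_left mult.assoc)
    also have "\<dots> = (\<Sum>i<n. (\<Sum>h\<in>carrier G. f h * \<sigma> h $$ (i, j)) * b i x)"
      unfolding sum_distrib_right by (rule sum.swap)
    also have "\<dots> = 0" using annihilatingD[OF f \<sigma>] j by simp
    finally have 0: "(\<Sum>h\<in>carrier G. f h * lshift h u x) = 0" .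
    have "(\<Sum>h\<in>carrier G. f h * lshift h (fscale c u + v) x) =
        (\<Sum>h\<in>carrier G. c * (f h * lshift h u x) + f h * lshift h v x)"
      by (intro sum.cong) (auto simp: lshift_def algebra_simps)
    also have "\<dots> = c * (\<Sum>h\<in>carrier G. f h * lshift h u x) + (\<Sum>h\<in>carrier G. f h * lshift h v x)"
      by (simp only: sum.distrib sum_distrib_left)
    finally show ?case by (simp only: 0 step(2) mult_zero_right add_0_left)
  qed
  obtain u where u: "u \<in> B" using B by auto
  then have u0: "u \<noteq> 0" using B fun_space.dependent_zero by metis
  have uS: "supported u" using u B annihilating_supported by auto
  \<comment> \<open>This is the convolution of \<open>u\<^sup>*\<close> and \<open>u\<close>.\<close>
  define f where "f = (\<Sum>h\<in>carrier G. fscale (cnj (u (inv h))) (lshift h u))"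
  have fS: "f \<in> fun_space.span B"
    unfolding f_def using sinv fun_space.span_base[OF u]
    by (intro fun_space.span_sum fun_space.span_scale) (auto simp: shift_invariant_def)
  have fx: "f x = (\<Sum>h\<in>carrier G. cnj (u (inv h)) * u (inv h \<otimes> x))" if "x \<in> carrier G" for x
    using that by (simp add: f_def sum_fun_apply lshift_def)
  have cnjf: "f (inv x) = cnj (f x)" if x: "x \<in> carrier G" for x
  proof -
    have "cnj (f x) = (\<Sum>h\<in>carrier G. u (inv h) * cnj (u (inv h \<otimes> x)))" by (simp add: fx[OF x])
    also have "\<dots> = (\<Sum>h\<in>carrier G. u (inv (x \<otimes> h)) * cnj (u (inv (x \<otimes> h) \<otimes> x)))"
      by (rule sum.reindex_bij_betw[OF lmult_bij_betw[OF x], symmetric])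
    also have "\<dots> = (\<Sum>h\<in>carrier G. cnj (u (inv h)) * u (inv h \<otimes> inv x))"
      using x by (intro sum.cong) (auto simp: inv_mult_group m_assoc)
    also have "\<dots> = f (inv x)" using x by (simp add: fx)
    finally show ?thesis by simp
  qed
  have "f \<in> annihilating" using fS BJ by auto
  from conv[OF this fS, of \<one>] have "(\<Sum>h\<in>carrier G. f h * f (inv h)) = 0"
    by (simp add: lshift_def)
  then have "(\<Sum>h\<in>carrier G. complex_of_real ((cmod (f h))\<^sup>2)) = 0"
    by (simp add: cnjf complex_mult_cnj cmod_power2)
  then have "(\<Sum>h\<in>carrier G. (cmod (f h))\<^sup>2) = 0" by (metis of_real_eq_0_iff of_real_sum)
  then have "f \<one> = 0" by (subst (asm) sum_nonneg_eq_0_iff) auto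
  moreover have "f \<one> = (\<Sum>h\<in>carrier G. complex_of_real ((cmod (u (inv h)))\<^sup>2))"
    by (simp add: fx mult.commute[of "cnj _"] complex_mult_cnj cmod_power2)
  ultimately have "(\<Sum>h\<in>carrier G. (cmod (u (inv h)))\<^sup>2) = 0" by (metis of_real_eq_0_iff of_real_sum)
  then have 0: "u (inv h) = 0" if "h \<in> carrier G" for h
    using that by (subst (asm) sum_nonneg_eq_0_iff) auto
  have "u x = 0" for x
    using 0[of "inv x"] uS by (cases "x \<in> carrier G") (auto simp: supported_def)
  then show False using u0 by auto
qed

theorem group_algebra_faithful:
  assumes "\<And>n \<rho>. irreducible_representation G n \<rho> \<Longrightarrow>
      mat_sum n n (\<lambda>g. f g \<cdot>\<^sub>m \<rho> g) (carrier G) = 0\<^sub>m n n"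
    and "g \<in> carrier G"
  shows "f g = 0"
proof -
  define f' where "f' x = (if x \<in> carrier G then f x else 0)" for x
  have "mat_sum n n (\<lambda>g. f' g \<cdot>\<^sub>m \<rho> g) (carrier G) = 0\<^sub>m n n"
    if "irreducible_representation G n \<rho>" for n \<rho>
    using assms(1)[OF that] by (subst mat_sum_cong[of _ _ "\<lambda>g. f g \<cdot>\<^sub>m \<rho> g"]) (auto simp: f'_def)
  then have "f' \<in> annihilating" by (auto simp: annihilating_def supported_def f'_def)
  then have "f' = 0" using annihilating_trivial by auto
  then show ?thesis using assms(2) by (metis f'_def zero_fun_def)
qed

section \<open>The regular character and the orthogonality of columns\<close>

lemma order_pos: "Coset.order G > 0"
  using order_gt_0_iff_finite by simp

lemma Irr_outside: "\<chi> \<in> Irr G \<Longrightarrow> x \<notin> carrier G \<Longrightarrow> \<chi> x = undefined"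
  by (auto simp: Irr_def character_of_def)

text \<open>By orthogonality, distinct irreducible characters are linearly independent in the space of
functions on the group, which is spanned by finitely many functions.\<close>

lemma finite_Irr: "finite (Irr G)"
proof (rule ccontr)
  assume "infinite (Irr G)"
  then obtain Q where Q: "Q \<subseteq> Irr G" "finite Q" "card Q = Suc (Coset.order G)"
    using infinite_arbitrarily_large by metis
  define e where "e \<chi> = (\<lambda>x. if x \<in> carrier G then \<chi> x else 0)" for \<chi> :: "'a \<Rightarrow> complex"
  have proj: "(\<Sum>g\<in>carrier G. (\<Sum>\<psi>\<in>Q. c \<psi> * e \<psi> g) * \<chi> (inv g)) = c \<chi> * of_nat (Coset.order G)"
    if "\<chi> \<in> Q" for \<chi> c
  proof -
    have "(\<Sum>g\<in>carrier G. (\<Sum>\<psi>\<in>Q. c \<psi> * e \<psi> g) * \<chi> (inv g)) =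
        (\<Sum>\<psi>\<in>Q. c \<psi> * (\<Sum>g\<in>carrier G. \<psi> g * \<chi> (inv g)))"
      unfolding sum_distrib_right sum_distrib_left
      by (subst sum.swap) (auto simp: e_def mult.assoc intro!: sum.cong)
    also have "\<dots> = (\<Sum>\<psi>\<in>Q. if \<chi> = \<psi> then c \<chi> * of_nat (Coset.order G) else 0)"
      using Q that by (intro sum.cong) (auto simp: character_orthogonality subset_iff)
    finally show ?thesis using that Q by simp
  qed
  have inj: "inj_on e Q"
  proof (rule inj_onI)
    fix \<chi> \<psi> assume *: "\<chi> \<in> Q" "\<psi> \<in> Q" "e \<chi> = e \<psi>"
    show "\<chi> = \<psi>"
    proof
      fix x
      have "\<chi> \<in> Irr G" "\<psi> \<in> Irr G" using * Q(1) by auto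
      moreover have "e \<chi> x = e \<psi> x" by (simp only: *(3))
      ultimately show "\<chi> x = \<psi> x"
        by (cases "x \<in> carrier G") (simp_all add: e_def Irr_outside)
    qed
  qed
  have "fun_space.independent (e ` Q)"
  proof (rule fun_space.independent_if_scalars_zero)
    fix c v assume 0: "(\<Sum>x\<in>e ` Q. fscale (c x) x) = 0" and v: "v \<in> e ` Q"
    then obtain \<chi> where \<chi>: "\<chi> \<in> Q" "v = e \<chi>" by auto
    have "(\<Sum>\<psi>\<in>Q. c (e \<psi>) * e \<psi> g) = 0" for g
      using fun_cong[OF 0, of g] by (simp add: sum_fun_apply sum.reindex[OF inj])
    then have "c (e \<chi>) * of_nat (Coset.order G) = 0"
      using proj[OF \<chi>(1), of "\<lambda>\<psi>. c (e \<psi>)"] by simp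
    then show "c v = 0" using \<chi> order_pos by simp
  qed (use Q in auto)
  moreover have "finite ((\<lambda>g x. if x = g then 1 else 0 :: complex) ` carrier G)" by simp
  moreover have "e ` Q \<subseteq> fun_space.span ((\<lambda>g x. if x = g then 1 else 0) ` carrier G)"
    using supported_in_span by (auto simp: e_def supported_def)
  ultimately have "card (e ` Q) \<le> card ((\<lambda>g x. if x = g then 1 else 0 :: complex) ` carrier G)"
    by (intro fun_space.independent_span_bound[THEN conjunct2])
  also have "\<dots> \<le> Coset.order G" by (simp add: Coset.order_def card_image_le)
  finally show False using Q by (simp add: card_image[OF inj])
qed

lemma conj_eq_iff:
  "a \<in> carrier G \<Longrightarrow> b \<in> carrier G \<Longrightarrow> x \<in> carrier G \<Longrightarrow>
    a \<otimes> (x \<otimes> inv b \<otimes> inv x) = \<one> \<longleftrightarrow> a = x \<otimes> b \<otimes> inv x"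
proof -
  assume *: "a \<in> carrier G" "b \<in> carrier G" "x \<in> carrier G"
  have "inv (x \<otimes> inv b \<otimes> inv x) = x \<otimes> b \<otimes> inv x"
    using * by (simp add: inv_mult_group m_assoc)
  then have "x \<otimes> inv b \<otimes> inv x = inv (x \<otimes> b \<otimes> inv x)"
    using * by (metis inv_closed inv_inv m_closed)
  then show ?thesis
    using * inv_solve_right[of \<one> a "x \<otimes> b \<otimes> inv x"] by auto
qed

lemma inv_conj:
  "g \<in> carrier G \<Longrightarrow> x \<in> carrier G \<Longrightarrow> inv (x \<otimes> g \<otimes> inv x) = x \<otimes> inv g \<otimes> inv x"
  by (simp add: inv_mult_group m_assoc)

lemma conj_one_iff: "g \<in> carrier G \<Longrightarrow> x \<in> carrier G \<Longrightarrow> x \<otimes> g \<otimes> inv x = \<one> \<longleftrightarrow> g = \<one>"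
  using conj_inv_cancel[of x g] by (auto simp: r_inv)

text \<open>Both sides, as functions of \<open>g\<^sup>-\<^sup>1\<close>, are class functions and thus act as scalars in every
irreducible representation.  Orthogonality shows that these scalars agree, and faithfulness of
the irreducible representations gives equality.\<close>

theorem regular_character:
  assumes g: "g \<in> carrier G"
  shows "(\<Sum>\<chi>\<in>Irr G. \<chi> \<one> * \<chi> g) = (if g = \<one> then of_nat (Coset.order G) else 0)"
proof -
  define f where "f g = (if g = \<one> then of_nat (Coset.order G) else 0) - (\<Sum>\<chi>\<in>Irr G. \<chi> \<one> * \<chi> (inv g))" for g
  have "mat_sum n n (\<lambda>g. f g \<cdot>\<^sub>m \<rho> g) (carrier G) = 0\<^sub>m n n"
    if r: "irreducible_representation G n \<rho>" for n \<rho>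
  proof -
    let ?\<psi> = "character_of G \<rho>"
    have \<psi>: "?\<psi> \<in> Irr G" using Irr_I[OF r] .
    have "(\<Sum>g\<in>carrier G. f g * mat_trace (\<rho> g)) = (\<Sum>g\<in>carrier G. f g * ?\<psi> g)"
      by (intro sum.cong) (auto simp: character_of_apply)
    also have "\<dots> = (\<Sum>g\<in>carrier G. (if g = \<one> then of_nat (Coset.order G) * ?\<psi> \<one> else 0)
        - (\<Sum>\<chi>\<in>Irr G. \<chi> \<one> * (?\<psi> g * \<chi> (inv g))))"
      by (intro sum.cong) (auto simp: f_def algebra_simps sum_distrib_right sum_distrib_left)
    also have "\<dots> = of_nat (Coset.order G) * ?\<psi> \<one>
        - (\<Sum>g\<in>carrier G. \<Sum>\<chi>\<in>Irr G. \<chi> \<one> * (?\<psi> g * \<chi> (inv g)))"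
      by (simp add: sum_subtractf)
    also have "(\<Sum>g\<in>carrier G. \<Sum>\<chi>\<in>Irr G. \<chi> \<one> * (?\<psi> g * \<chi> (inv g))) =
        (\<Sum>\<chi>\<in>Irr G. \<chi> \<one> * (\<Sum>g\<in>carrier G. ?\<psi> g * \<chi> (inv g)))"
      unfolding sum_distrib_left by (rule sum.swap)
    also have "\<dots> = (\<Sum>\<chi>\<in>Irr G. if \<chi> = ?\<psi> then ?\<psi> \<one> * of_nat (Coset.order G) else 0)"
      using \<psi> by (intro sum.cong) (auto simp: character_orthogonality)
    also have "\<dots> = of_nat (Coset.order G) * ?\<psi> \<one>" using finite_Irr \<psi> by simp
    finally have 0: "(\<Sum>g\<in>carrier G. f g * mat_trace (\<rho> g)) = 0" by simp
    have "f (x \<otimes> g \<otimes> inv x) = f g" if "x \<in> carrier G" "g \<in> carrier G" for x g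
      using that by (auto simp: f_def conj_one_iff inv_conj character_conj intro!: sum.cong)
    from class_function_scalar[OF r this] show ?thesis using 0 by (auto intro!: eq_matI)
  qed
  from group_algebra_faithful[OF this, of "inv g"] have "f (inv g) = 0" using g by blast
  then show ?thesis using g by (simp add: f_def inv_eq_1_iff)
qed

text \<open>The sum of the conjugates of \<open>g\<close> acts as the scalar \<open>|G| \<chi> g / \<chi>(1)\<close>; multiplication by the
matrix of \<open>a\<close> and taking traces gives the formula.\<close>

lemma character_product:
  assumes \<chi>: "\<chi> \<in> Irr G" and a: "a \<in> carrier G" and g: "g \<in> carrier G"
  shows "\<chi> \<one> * (\<Sum>x\<in>carrier G. \<chi> (a \<otimes> (x \<otimes> g \<otimes> inv x))) = of_nat (Coset.order G) * \<chi> a * \<chi> g"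
proof -
  obtain n \<rho> where r: "irreducible_representation G n \<rho>" "\<chi> = character_of G \<rho>"
    "\<chi> \<one> = of_nat n" "n > 0" "\<rho> \<in> hom G (GL n)"
    "\<And>g. g \<in> carrier G \<Longrightarrow> \<rho> g \<in> carrier_mat n n"
    "\<And>g. g \<in> carrier G \<Longrightarrow> \<chi> g = mat_trace (\<rho> g)" using IrrE[OF \<chi>] by metis
  note s = representation_simps[OF r(5)]
  define M where "M = mat_sum n n (\<lambda>x. \<rho> (x \<otimes> g \<otimes> inv x)) (carrier G)"
  have Mh: "M * \<rho> h = \<rho> h * M" if h: "h \<in> carrier G" for h
  proof -
    have "M * \<rho> h = mat_sum n n (\<lambda>x. \<rho> (x \<otimes> g \<otimes> inv x) * \<rho> h) (carrier G)"
      unfolding M_def using g h r(6) by (intro mat_sum_mult) auto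
    also have "\<dots> = mat_sum n n (\<lambda>x. \<rho> (h \<otimes> x \<otimes> g \<otimes> inv (h \<otimes> x)) * \<rho> h) (carrier G)"
      by (rule mat_sum_reindex_bij_betw[OF lmult_bij_betw[OF h], symmetric])
    also have "\<dots> = mat_sum n n (\<lambda>x. \<rho> h * \<rho> (x \<otimes> g \<otimes> inv x)) (carrier G)"
      using g h by (intro mat_sum_cong) (simp add: inv_mult_group m_assoc flip: s(2))
    also have "\<dots> = \<rho> h * M"
      unfolding M_def using g h r(6) by (intro mult_mat_sum[symmetric]) auto
    finally show ?thesis .
  qed
  have "M = (mat_trace M / of_nat n) \<cdot>\<^sub>m 1\<^sub>m n"
    by (rule schur_scalar[OF r(1) _ Mh]) (auto simp: M_def)
  moreover have "mat_trace M = of_nat (Coset.order G) * \<chi> g"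
  proof -
    have "mat_trace M = (\<Sum>x\<in>carrier G. mat_trace (\<rho> (x \<otimes> g \<otimes> inv x)))"
      unfolding M_def using g r(6) by (intro mat_trace_mat_sum) auto
    also have "\<dots> = (\<Sum>x\<in>carrier G. \<chi> g)"
      using g by (intro sum.cong) (auto simp: character_conj[OF \<chi>] simp flip: r(7))
    finally show ?thesis by (simp add: Coset.order_def)
  qed
  ultimately have M: "M = (of_nat (Coset.order G) * \<chi> g / of_nat n) \<cdot>\<^sub>m 1\<^sub>m n" by simp
  have "(\<Sum>x\<in>carrier G. \<chi> (a \<otimes> (x \<otimes> g \<otimes> inv x))) = (\<Sum>x\<in>carrier G. mat_trace (\<rho> a * \<rho> (x \<otimes> g \<otimes> inv x)))"
    using a g by (intro sum.cong) (auto simp: r(7) simp flip: s(2))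
  also have "\<dots> = mat_trace (mat_sum n n (\<lambda>x. \<rho> a * \<rho> (x \<otimes> g \<otimes> inv x)) (carrier G))"
    using a g r(6) by (intro mat_trace_mat_sum[symmetric] mult_carrier_mat[of _ n n]) auto
  also have "mat_sum n n (\<lambda>x. \<rho> a * \<rho> (x \<otimes> g \<otimes> inv x)) (carrier G) = \<rho> a * M"
    unfolding M_def using g a r(6) by (intro mult_mat_sum[symmetric]) auto
  also have "\<dots> = (of_nat (Coset.order G) * \<chi> g / of_nat n) \<cdot>\<^sub>m \<rho> a"
    unfolding M using r(6)[OF a] by (simp add: mult_smult_distrib[of _ n n _ n] right_mult_one_mat[of _ n n])
  also have "mat_trace \<dots> = of_nat (Coset.order G) * \<chi> g / of_nat n * \<chi> a"
    using r(6)[OF a] r(7)[OF a] by (simp add: mat_trace_def sum_distrib_left)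
  finally show ?thesis using r(3,4) by simp
qed

text \<open>Every product \<open>\<chi> a \<chi> b\<^sup>-\<^sup>1\<close> is a combination of values of \<open>\<chi>(1) \<chi>\<close> by \<open>character_product\<close>, and
these add up to the regular character, which counts the solutions of \<open>a x b\<^sup>-\<^sup>1 x\<^sup>-\<^sup>1 = \<one>\<close>.\<close>

theorem column_orthogonality:
  assumes a: "a \<in> carrier G" and b: "b \<in> carrier G"
  shows "(\<Sum>\<chi>\<in>Irr G. \<chi> a * \<chi> (inv b)) = of_nat (card {x \<in> carrier G. a = x \<otimes> b \<otimes> inv x})"
proof -
  let ?c = "of_nat (Coset.order G) :: complex"
  have "?c * (\<Sum>\<chi>\<in>Irr G. \<chi> a * \<chi> (inv b)) =
      (\<Sum>\<chi>\<in>Irr G. \<Sum>x\<in>carrier G. \<chi> \<one> * \<chi> (a \<otimes> (x \<otimes> inv b \<otimes> inv x)))"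
    unfolding sum_distrib_left
    using a b by (intro sum.cong refl) (simp add: character_product mult.assoc flip: sum_distrib_left)
  also have "\<dots> = (\<Sum>x\<in>carrier G. \<Sum>\<chi>\<in>Irr G. \<chi> \<one> * \<chi> (a \<otimes> (x \<otimes> inv b \<otimes> inv x)))"
    by (rule sum.swap)
  also have "\<dots> = (\<Sum>x\<in>carrier G. if a = x \<otimes> b \<otimes> inv x then ?c else 0)"
    using a b by (intro sum.cong refl) (simp add: regular_character conj_eq_iff)
  also have "\<dots> = ?c * of_nat (card {x \<in> carrier G. a = x \<otimes> b \<otimes> inv x})"
    by (simp add: sum.If_cases Int_def)
  finally show ?thesis using order_pos by simp
qed

section \<open>Sums over subgroups and over normal subsets\<close>

lemma subgroup_sum_square:
  assumes \<rho>: "\<rho> \<in> hom G (GL n)" and P: "subgroup P G"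
  defines "S \<equiv> mat_sum n n \<rho> P"
  shows "S * S = of_nat (card P) \<cdot>\<^sub>m S"
proof -
  note s = representation_simps[OF \<rho>]
  have PG: "x \<in> carrier G" if "x \<in> P" for x using P that by (rule subgroup.mem_carrier)
  have absorb: "\<rho> h * S = S" if h: "h \<in> P" for h
  proof -
    have bij: "bij_betw (\<lambda>x. h \<otimes> x) P P"
      using h P PG subgroup.m_closed[OF P] subgroup.m_inv_closed[OF P]
      by (intro bij_betw_byWitness[where f' = "\<lambda>x. inv h \<otimes> x"]) (auto simp flip: m_assoc)
    have "\<rho> h * S = mat_sum n n (\<lambda>x. \<rho> (h \<otimes> x)) P"
      unfolding S_def using h PG s by (subst mult_mat_sum[of _ n n]) (auto intro!: mat_sum_cong)
    also have "\<dots> = S" unfolding S_def by (rule mat_sum_reindex_bij_betw[OF bij])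
    finally show ?thesis .
  qed
  have S: "S \<in> carrier_mat n n" by (simp add: S_def)
  have "S * S = mat_sum n n (\<lambda>h. \<rho> h * S) P"
    unfolding S_def using PG s by (intro mat_sum_mult) auto
  also have "\<dots> = mat_sum n n (\<lambda>h. S) P" by (rule mat_sum_cong) (rule absorb)
  also have "\<dots> = of_nat (card P) \<cdot>\<^sub>m S"
    using S by (intro eq_matI) (auto simp: mat_sum_def)
  finally show ?thesis .
qed

text \<open>The number \<open>k\<close> is the multiplicity of the trivial character in the restriction of \<open>\<chi>\<close> to \<open>P\<close>,
which is the trace of the idempotent \<open>(1 / |P|) \<Sum>x\<in>P. \<rho> x\<close>.\<close>

lemma character_sum_subgroup:
  assumes \<chi>: "\<chi> \<in> Irr G" and P: "subgroup P G"
  shows "\<exists>k :: nat. (\<Sum>x\<in>P. \<chi> x) = of_nat (card P * k)"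
proof -
  obtain n \<rho> where r: "\<rho> \<in> hom G (GL n)" "\<And>g. g \<in> carrier G \<Longrightarrow> \<rho> g \<in> carrier_mat n n"
    "\<And>g. g \<in> carrier G \<Longrightarrow> \<chi> g = mat_trace (\<rho> g)" using IrrE[OF \<chi>] by metis
  have PG: "P \<subseteq> carrier G" using P by (rule subgroup.subset)
  have c: "card P > 0" using P PG finite_subset[OF PG] subgroup.one_closed[OF P] by (auto simp: card_gt_0_iff)
  define S where "S = mat_sum n n \<rho> P"
  define A where "A = (1 / of_nat (card P)) \<cdot>\<^sub>m S"
  have S: "S \<in> carrier_mat n n" by (simp add: S_def)
  have "A * A = (1 / of_nat (card P)) \<cdot>\<^sub>m ((1 / of_nat (card P)) \<cdot>\<^sub>m (S * S))"
    using S by (simp add: A_def mult_smult_distrib[of _ n n _ n] mult_smult_assoc_mat[of _ n n _ n])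
  also have "\<dots> = A"
    using subgroup_sum_square[OF r(1) P] c S unfolding S_def[symmetric] A_def by (intro eq_matI) auto
  finally obtain k :: nat where "mat_trace A = of_nat k"
    using idempotent_mat_trace_nat[of A n] S by (auto simp: A_def)
  moreover have "mat_trace A = (\<Sum>x\<in>P. \<chi> x) / of_nat (card P)"
  proof -
    have "mat_trace A = mat_trace S / of_nat (card P)"
      using S by (simp add: A_def mat_trace_def sum_divide_distrib)
    also have "mat_trace S = (\<Sum>x\<in>P. mat_trace (\<rho> x))"
      unfolding S_def using PG r(2) by (intro mat_trace_mat_sum) auto
    also have "\<dots> = (\<Sum>x\<in>P. \<chi> x)" using PG r(3) by (intro sum.cong) auto
    finally show ?thesis .
  qed
  ultimately have "(\<Sum>x\<in>P. \<chi> x) = of_nat (card P * k)" using c by (simp add: field_simps)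
  then show ?thesis by blast
qed

lemma normal_subset_scalar:
  assumes r: "irreducible_representation G n \<rho>" and N: "N \<subseteq> carrier G"
    and conj: "\<And>x g. x \<in> carrier G \<Longrightarrow> g \<in> N \<Longrightarrow> x \<otimes> g \<otimes> inv x \<in> N"
  shows "mat_sum n n \<rho> N = ((\<Sum>g\<in>N. character_of G \<rho> g) / of_nat n) \<cdot>\<^sub>m 1\<^sub>m n"
proof -
  note s = representation_simps[OF irreducible_representationD(2)[OF r]]
  let ?f = "\<lambda>g. if g \<in> N then 1 else (0 :: complex)"
  have iff: "x \<otimes> g \<otimes> inv x \<in> N \<longleftrightarrow> g \<in> N" if xg: "x \<in> carrier G" "g \<in> carrier G" for x g
  proof
    assume "x \<otimes> g \<otimes> inv x \<in> N"
    from conj[OF _ this, of "inv x"] xg show "g \<in> N" by (simp add: conj_inv_cancel)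
  qed (use xg conj in auto)
  have "mat_sum n n \<rho> N = mat_sum n n (\<lambda>g. ?f g \<cdot>\<^sub>m \<rho> g) (carrier G)"
  proof (rule eq_matI)
    fix i j assume "i < dim_row (mat_sum n n (\<lambda>g. ?f g \<cdot>\<^sub>m \<rho> g) (carrier G))"
      "j < dim_col (mat_sum n n (\<lambda>g. ?f g \<cdot>\<^sub>m \<rho> g) (carrier G))"
    then have ij: "i < n" "j < n" by (auto simp: mat_sum_def)
    have "(\<Sum>g\<in>carrier G. (?f g \<cdot>\<^sub>m \<rho> g) $$ (i, j)) = (\<Sum>g\<in>carrier G. if g \<in> N then \<rho> g $$ (i, j) else 0)"
      using ij s(1) by (intro sum.cong) (auto dest!: s(1))
    also have "\<dots> = (\<Sum>g\<in>N. \<rho> g $$ (i, j))" using N by (simp add: sum.inter_restrict[symmetric] Int_absorb1)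
    finally show "mat_sum n n \<rho> N $$ (i, j) = mat_sum n n (\<lambda>g. ?f g \<cdot>\<^sub>m \<rho> g) (carrier G) $$ (i, j)"
      using ij by (simp add: mat_sum_def)
  qed (auto simp: mat_sum_def)
  also have "\<dots> = ((\<Sum>g\<in>carrier G. ?f g * mat_trace (\<rho> g)) / of_nat n) \<cdot>\<^sub>m 1\<^sub>m n"
    by (rule class_function_scalar[OF r]) (auto simp: iff)
  also have "(\<Sum>g\<in>carrier G. ?f g * mat_trace (\<rho> g)) = (\<Sum>g\<in>carrier G. if g \<in> N then character_of G \<rho> g else 0)"
    by (intro sum.cong) (auto simp: character_of_apply)
  also have "\<dots> = (\<Sum>g\<in>N. character_of G \<rho> g)" using N by (simp add: sum.inter_restrict[symmetric] Int_absorb1)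
  finally show ?thesis .
qed

text \<open>The sum \<open>S\<close> of the matrices over \<open>N\<close> is a scalar, and \<open>S\<^sup>2 = |N| S\<close> leaves only the scalars
\<open>0\<close> and \<open>|N|\<close>.\<close>

lemma character_sum_normal_subgroup:
  assumes \<chi>: "\<chi> \<in> Irr G" and N: "subgroup N G"
    and conj: "\<And>x g. x \<in> carrier G \<Longrightarrow> g \<in> N \<Longrightarrow> x \<otimes> g \<otimes> inv x \<in> N"
  shows "(\<Sum>x\<in>N. \<chi> x) = 0 \<or> (\<Sum>x\<in>N. \<chi> x) = of_nat (card N) * \<chi> \<one>"
proof -
  obtain n \<rho> where r: "irreducible_representation G n \<rho>" "\<chi> = character_of G \<rho>"
    "\<chi> \<one> = of_nat n" "n > 0" "\<rho> \<in> hom G (GL n)" using IrrE[OF \<chi>] by metis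
  define l where "l = (\<Sum>g\<in>N. \<chi> g) / of_nat n"
  have S: "mat_sum n n \<rho> N = l \<cdot>\<^sub>m 1\<^sub>m n"
    using normal_subset_scalar[OF r(1) subgroup.subset[OF N] conj] by (simp add: l_def r(2))
  have "(l \<cdot>\<^sub>m 1\<^sub>m n) * (l \<cdot>\<^sub>m 1\<^sub>m n) = of_nat (card N) \<cdot>\<^sub>m (l \<cdot>\<^sub>m 1\<^sub>m n)"
    using subgroup_sum_square[OF r(5) N] unfolding S .
  then have "((l \<cdot>\<^sub>m 1\<^sub>m n) * (l \<cdot>\<^sub>m 1\<^sub>m n)) $$ (0, 0) = (of_nat (card N) \<cdot>\<^sub>m (l \<cdot>\<^sub>m 1\<^sub>m n)) $$ (0, 0)"
    by simp
  moreover have "(l \<cdot>\<^sub>m 1\<^sub>m n) * (l \<cdot>\<^sub>m 1\<^sub>m n) = l \<cdot>\<^sub>m (l \<cdot>\<^sub>m 1\<^sub>m n :: complex mat)"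
    by (simp add: mult_smult_assoc_mat[of _ n n _ n])
  ultimately have "l * l = of_nat (card N) * l" using r(4) by simp
  then have "l = 0 \<or> l = of_nat (card N)" by auto
  moreover have "(\<Sum>g\<in>N. \<chi> g) = l * \<chi> \<one>" using r by (simp add: l_def)
  ultimately show ?thesis by auto
qed

text \<open>The hypothesis on character sums says that the element \<open>s = \<Sum>x\<in>N. x\<close> of the group algebra
satisfies \<open>s\<^sup>2 = |N| s\<close> in every irreducible representation, hence in the group algebra itself.
The coefficient of \<open>x y\<close> in \<open>s\<^sup>2\<close> is positive, so \<open>x y\<close> occurs in \<open>s\<close>.  In this way a normal
subset is recognised as a subgroup without kernels of characters.\<close>

lemma normal_subset_mult_closed:
  assumes N: "N \<subseteq> carrier G" and conj: "\<And>x g. x \<in> carrier G \<Longrightarrow> g \<in> N \<Longrightarrow> x \<otimes> g \<otimes> inv x \<in> N"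
    and sums: "\<And>\<chi>. \<chi> \<in> Irr G \<Longrightarrow> (\<Sum>x\<in>N. \<chi> x) = 0 \<or> (\<Sum>x\<in>N. \<chi> x) = of_nat (card N) * \<chi> \<one>"
    and x: "x \<in> N" and y: "y \<in> N"
  shows "x \<otimes> y \<in> N"
proof -
  have finN: "finite N" using N finite_subset by auto
  define f where "f g = of_nat (card {p \<in> N \<times> N. fst p \<otimes> snd p = g})
      - (if g \<in> N then of_nat (card N) else (0 :: complex))" for g
  have "mat_sum n n (\<lambda>g. f g \<cdot>\<^sub>m \<rho> g) (carrier G) = 0\<^sub>m n n"
    if r: "irreducible_representation G n \<rho>" for n \<rho>
  proof -
    note s = representation_simps[OF irreducible_representationD(2)[OF r]]
    note n = irreducible_representationD(1)[OF r]
    define S where "S = mat_sum n n \<rho> N"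
    define l where "l = (\<Sum>g\<in>N. character_of G \<rho> g) / of_nat n"
    have Sl: "S = l \<cdot>\<^sub>m 1\<^sub>m n" unfolding S_def l_def by (rule normal_subset_scalar[OF r N conj])
    have "l = 0 \<or> l = of_nat (card N)"
      using sums[OF Irr_I[OF r]] n
      by (auto simp: l_def character_of_one[OF irreducible_representationD(2)[OF r]])
    then have SS: "S * S = of_nat (card N) \<cdot>\<^sub>m S"
      unfolding Sl by (auto simp: mult_smult_assoc_mat[of _ n n _ n] intro!: eq_matI)
    show ?thesis
    proof (rule eq_matI)
      fix i j assume "i < dim_row (0\<^sub>m n n :: complex mat)" "j < dim_col (0\<^sub>m n n :: complex mat)"
      then have ij: "i < n" "j < n" by auto
      have "(\<Sum>g\<in>carrier G. of_nat (card {p \<in> N \<times> N. fst p \<otimes> snd p = g}) * \<rho> g $$ (i, j)) =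
          (\<Sum>g\<in>carrier G. \<Sum>p\<in>{p \<in> N \<times> N. fst p \<otimes> snd p = g}. \<rho> (fst p \<otimes> snd p) $$ (i, j))"
        by (intro sum.cong refl) simp
      also have "\<dots> = (\<Sum>p\<in>N \<times> N. \<rho> (fst p \<otimes> snd p) $$ (i, j))"
        using finN N by (intro sum.group) (auto intro!: m_closed)
      also have "\<dots> = (\<Sum>x\<in>N. \<Sum>y\<in>N. \<rho> (x \<otimes> y) $$ (i, j))"
        by (simp add: sum.cartesian_product case_prod_unfold)
      also have "\<dots> = (\<Sum>x\<in>N. \<Sum>y\<in>N. \<Sum>k<n. \<rho> x $$ (i, k) * \<rho> y $$ (k, j))"
      proof (intro sum.cong refl)
        fix x y assume xy: "x \<in> N" "y \<in> N"
        then have c: "\<rho> x \<in> carrier_mat n n" "\<rho> y \<in> carrier_mat n n" using N s(1) by auto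
        have "\<rho> (x \<otimes> y) = \<rho> x * \<rho> y" using xy N s(2) by auto
        then show "\<rho> (x \<otimes> y) $$ (i, j) = (\<Sum>k<n. \<rho> x $$ (i, k) * \<rho> y $$ (k, j))"
          using c ij by (simp add: scalar_prod_def lessThan_atLeast0)
      qed
      also have "\<dots> = (\<Sum>x\<in>N. \<Sum>k<n. \<rho> x $$ (i, k) * (\<Sum>y\<in>N. \<rho> y $$ (k, j)))"
        unfolding sum_distrib_left by (intro sum.cong refl sum.swap)
      also have "\<dots> = (\<Sum>k<n. (\<Sum>x\<in>N. \<rho> x $$ (i, k)) * (\<Sum>y\<in>N. \<rho> y $$ (k, j)))"
        unfolding sum_distrib_right by (rule sum.swap)
      also have "\<dots> = (S * S) $$ (i, j)"
        using ij by (simp add: S_def mat_sum_def scalar_prod_def lessThan_atLeast0)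
      also have "\<dots> = of_nat (card N) * (\<Sum>g\<in>N. \<rho> g $$ (i, j))"
        unfolding SS using ij by (simp add: S_def mat_sum_def)
      also have "\<dots> = (\<Sum>g\<in>carrier G. (if g \<in> N then of_nat (card N) else 0) * \<rho> g $$ (i, j))"
        using N by (simp add: if_distrib[where f = "\<lambda>x. x * _"] sum.inter_restrict[symmetric] Int_absorb1
            sum_distrib_left cong: if_cong)
      finally have "(\<Sum>g\<in>carrier G. f g * \<rho> g $$ (i, j)) = 0"
        by (simp add: f_def left_diff_distrib sum_subtractf)
      moreover have "(f g \<cdot>\<^sub>m \<rho> g) $$ (i, j) = f g * \<rho> g $$ (i, j)" if "g \<in> carrier G" for g
        using s(1)[OF that] ij by simp
      ultimately show "mat_sum n n (\<lambda>g. f g \<cdot>\<^sub>m \<rho> g) (carrier G) $$ (i, j) = 0\<^sub>m n n $$ (i, j)"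
        using ij by (simp add: mat_sum_def)
    qed (auto simp: mat_sum_def)
  qed
  from group_algebra_faithful[OF this, of "x \<otimes> y"] have 0: "f (x \<otimes> y) = 0" using x y N by blast
  have "(x, y) \<in> {p \<in> N \<times> N. fst p \<otimes> snd p = x \<otimes> y}" using x y by simp
  then have "card {p \<in> N \<times> N. fst p \<otimes> snd p = x \<otimes> y} \<noteq> 0"
    using finN by (subst card_0_eq) auto
  then show ?thesis using 0 by (auto simp: f_def split: if_splits)
qed

section \<open>Groups with two columns differing in one entry\<close>

definition conj_class :: "'a \<Rightarrow> 'a set" where
  "conj_class b = (\<lambda>g. g \<otimes> b \<otimes> inv g) ` carrier G"

definition char_degree :: "('a \<Rightarrow> complex) \<Rightarrow> nat" where
  "char_degree \<chi> = (THE n. \<chi> \<one> = of_nat n)"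

lemma char_degree:
  assumes "\<chi> \<in> Irr G"
  shows "\<chi> \<one> = of_nat (char_degree \<chi>)" "char_degree \<chi> > 0"
proof -
  obtain n where n: "\<chi> \<one> = of_nat n" "n > 0" using IrrE[OF assms] by metis
  then have "char_degree \<chi> = n" by (simp add: char_degree_def)
  with n show "\<chi> \<one> = of_nat (char_degree \<chi>)" "char_degree \<chi> > 0" by simp_all
qed

lemma sum_degree_squares: "(\<Sum>\<chi>\<in>Irr G. (char_degree \<chi>)\<^sup>2) = Coset.order G"
proof -
  have "of_nat (\<Sum>\<chi>\<in>Irr G. (char_degree \<chi>)\<^sup>2) = (\<Sum>\<chi>\<in>Irr G. \<chi> \<one> * \<chi> \<one>)"
    by (simp add: char_degree(1) power2_eq_square)
  also have "\<dots> = of_nat (Coset.order G)" by (simp add: regular_character)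
  finally show ?thesis by (metis of_nat_eq_iff)
qed

lemma max_irr_degree_eqI:
  assumes "\<chi> \<in> Irr G" "char_degree \<chi> = d" "\<And>\<psi>. \<psi> \<in> Irr G \<Longrightarrow> char_degree \<psi> \<le> d"
  shows "max_irr_degree G = real d"
proof -
  have Re: "Re (\<psi> \<one>) = real (char_degree \<psi>)" if "\<psi> \<in> Irr G" for \<psi>
    using char_degree(1)[OF that] by simp
  show ?thesis unfolding max_irr_degree_def
  proof (rule Max_eqI)
    show "real d \<in> (\<lambda>\<chi>. Re (\<chi> \<one>)) ` Irr G"
      using assms Re[OF assms(1)] by (intro image_eqI[of _ _ \<chi>]) auto
  qed (use finite_Irr Re assms(3) in auto)
qed

lemma finite_conj_class [simp]: "finite (conj_class b)"
  by (simp add: conj_class_def)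

lemma conj_class_closed: "b \<in> carrier G \<Longrightarrow> conj_class b \<subseteq> carrier G"
  by (auto simp: conj_class_def)

lemma self_in_conj_class: "b \<in> carrier G \<Longrightarrow> b \<in> conj_class b"
  unfolding conj_class_def by (rule image_eqI[of _ _ \<one>]) auto

lemma one_notin_conj_class: "b \<in> carrier G \<Longrightarrow> b \<noteq> \<one> \<Longrightarrow> \<one> \<notin> conj_class b"
proof
  assume b: "b \<in> carrier G" "b \<noteq> \<one>" and "\<one> \<in> conj_class b"
  then obtain g where "g \<in> carrier G" "g \<otimes> b \<otimes> inv g = \<one>" unfolding conj_class_def by force
  then show False using conj_one_iff b by blast
qed

lemma conj_conj:
  "x \<in> carrier G \<Longrightarrow> g \<in> carrier G \<Longrightarrow> b \<in> carrier G \<Longrightarrow>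
    x \<otimes> (g \<otimes> b \<otimes> inv g) \<otimes> inv x = (x \<otimes> g) \<otimes> b \<otimes> inv (x \<otimes> g)"
  by (simp add: inv_mult_group m_assoc)

lemma conj_class_conj:
  assumes "b \<in> carrier G" "x \<in> carrier G" "y \<in> conj_class b"
  shows "x \<otimes> y \<otimes> inv x \<in> conj_class b"
proof -
  obtain g where g: "g \<in> carrier G" "y = g \<otimes> b \<otimes> inv g" using assms(3) by (auto simp: conj_class_def)
  show ?thesis unfolding g(2) conj_conj[OF assms(2) g(1) assms(1)] conj_class_def
    using assms g by (intro imageI) auto
qed

lemma conj_class_inv:
  assumes "b \<in> carrier G" "inv b \<in> conj_class b" "y \<in> conj_class b"
  shows "inv y \<in> conj_class b"
proof -
  obtain g where g: "g \<in> carrier G" "y = g \<otimes> b \<otimes> inv g" using assms(3) by (auto simp: conj_class_def)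
  have "inv y = g \<otimes> inv b \<otimes> inv g" using g assms(1) by (simp add: inv_conj)
  then show ?thesis using conj_class_conj[OF assms(1) g(1) assms(2)] by simp
qed

lemma conj_class_sym:
  assumes "b \<in> carrier G" "y \<in> conj_class b"
  shows "b \<in> conj_class y"
proof -
  obtain g where g: "g \<in> carrier G" "y = g \<otimes> b \<otimes> inv g" using assms(2) by (auto simp: conj_class_def)
  have "b = inv g \<otimes> y \<otimes> inv (inv g)" using g assms(1) by (simp add: conj_inv_cancel)
  then show ?thesis unfolding conj_class_def by (rule image_eqI) (use g in simp)
qed

lemma character_conj_class: "\<chi> \<in> Irr G \<Longrightarrow> b \<in> carrier G \<Longrightarrow> y \<in> conj_class b \<Longrightarrow> \<chi> y = \<chi> b"
  by (auto simp: conj_class_def character_conj)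

lemma column_orthogonality_nonconj:
  assumes "a \<in> carrier G" "b \<in> carrier G" "a \<notin> conj_class b"
  shows "(\<Sum>\<chi>\<in>Irr G. \<chi> a * \<chi> (inv b)) = 0"
proof -
  have "{x \<in> carrier G. a = x \<otimes> b \<otimes> inv x} = {}" using assms(3) by (auto simp: conj_class_def)
  then show ?thesis using column_orthogonality[OF assms(1,2)] by simp
qed

text \<open>Subtracting two columns leaves the row in which they differ.\<close>

lemma columns_differ_once:
  assumes \<chi>: "\<chi> \<in> Irr G" and eq: "\<And>\<psi>. \<psi> \<in> Irr G \<Longrightarrow> \<psi> \<noteq> \<chi> \<Longrightarrow> \<psi> a = \<psi> b"
  shows "(\<chi> a - \<chi> b) * \<chi> g = (\<Sum>\<psi>\<in>Irr G. \<psi> a * \<psi> g) - (\<Sum>\<psi>\<in>Irr G. \<psi> b * \<psi> g)"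
proof -
  have "(\<Sum>\<psi>\<in>Irr G. \<psi> a * \<psi> g) - (\<Sum>\<psi>\<in>Irr G. \<psi> b * \<psi> g) = (\<Sum>\<psi>\<in>Irr G. (\<psi> a - \<psi> b) * \<psi> g)"
    by (simp add: left_diff_distrib sum_subtractf)
  also have "\<dots> = (\<Sum>\<psi>\<in>Irr G. if \<psi> = \<chi> then (\<chi> a - \<chi> b) * \<chi> g else 0)"
    by (intro sum.cong) (auto simp: eq)
  also have "\<dots> = (\<chi> a - \<chi> b) * \<chi> g" using finite_Irr \<chi> by simp
  finally show ?thesis by simp
qed

text \<open>If neither element were \<open>\<one>\<close>, both columns would be orthogonal to the column of \<open>\<one>\<close>, and their
difference would give \<open>(\<chi> a - \<chi> b) \<chi>(1) = 0\<close>.\<close>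

lemma CD1_identity_column:
  assumes "CD1_group G"
  obtains b \<chi> where "b \<in> carrier G" "b \<noteq> \<one>" "\<chi> \<in> Irr G" "\<chi> \<one> \<noteq> \<chi> b"
    "\<And>\<psi>. \<psi> \<in> Irr G \<Longrightarrow> \<psi> \<noteq> \<chi> \<Longrightarrow> \<psi> \<one> = \<psi> b"
proof -
  obtain a b \<chi> where ab: "a \<in> carrier G" "b \<in> carrier G" and \<chi>: "\<chi> \<in> Irr G" "\<chi> a \<noteq> \<chi> b"
    and eq: "\<And>\<psi>. \<psi> \<in> Irr G \<Longrightarrow> \<psi> \<noteq> \<chi> \<Longrightarrow> \<psi> a = \<psi> b"
    using assms unfolding CD1_group_def by blast
  have "a = \<one> \<or> b = \<one>"
  proof (rule ccontr)
    assume ne: "\<not> ?thesis"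
    have "(\<Sum>\<psi>\<in>Irr G. \<psi> g * \<psi> \<one>) = 0" if "g \<in> carrier G" "g \<noteq> \<one>" for g
      using regular_character[OF that(1)] that(2) by (simp add: mult.commute)
    then have "(\<chi> a - \<chi> b) * \<chi> \<one> = 0" 
      using columns_differ_once[of \<chi> a b \<one>, OF \<chi>(1) eq] ab ne by simp
    then show False using \<chi> char_degree[OF \<chi>(1)] by simp
  qed
  then show thesis
  proof
    assume "a = \<one>"
    then show thesis using that[of b \<chi>] ab \<chi> eq by auto
  next
    assume "b = \<one>"
    then show thesis using that[of a \<chi>] ab \<chi> eq by (metis (no_types))
  qed
qed

text \<open>Write \<open>c\<close> for the size of the class of \<open>b\<close> and \<open>A\<close> for the sum of the squares of the degrees of the
characters other than \<open>\<chi>\<close>.  The columns of \<open>\<one>\<close> and \<open>b\<close> give \<open>A + d\<^sup>2 = |G|\<close> and \<open>A + d \<chi> b = 0\<close>,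
and \<open>\<chi>\<close> is orthogonal to the trivial character, so \<open>d + c \<chi> b = 0\<close>.  Together, \<open>A c = d\<^sup>2\<close>.
This determines \<open>|G|\<close>, bounds the other degrees by \<open>d\<close>, and, through the orthogonality of the
column of \<open>b\<close> with itself, gives the order of the centraliser.\<close>

theorem CD1_structure:
  assumes "CD1_group G"
  obtains b N \<chi> d where
    "b \<in> carrier G" "b \<noteq> \<one>" "N = insert \<one> (conj_class b)" "subgroup N G"
    "\<chi> \<in> Irr G" "\<chi> \<one> = of_nat d" "\<And>x. x \<in> carrier G \<Longrightarrow> x \<notin> N \<Longrightarrow> \<chi> x = 0"
    "d\<^sup>2 * card N = Coset.order G * card (conj_class b)" "max_irr_degree G = real d"
    "card {x \<in> carrier G. b = x \<otimes> b \<otimes> inv x} * card (conj_class b) = Coset.order G"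
proof -
  obtain b \<chi> where b: "b \<in> carrier G" "b \<noteq> \<one>" and \<chi>: "\<chi> \<in> Irr G" "\<chi> \<one> \<noteq> \<chi> b"
    and eq: "\<And>\<psi>. \<psi> \<in> Irr G \<Longrightarrow> \<psi> \<noteq> \<chi> \<Longrightarrow> \<psi> \<one> = \<psi> b"
    using CD1_identity_column[OF assms] by metis
  define d where "d = char_degree \<chi>"
  define c where "c = card (conj_class b)"
  define N where "N = insert \<one> (conj_class b)"
  define A where "A = (\<Sum>\<psi>\<in>Irr G - {\<chi>}. (char_degree \<psi>)\<^sup>2)"
  have d: "\<chi> \<one> = of_nat d" "d > 0" using char_degree[OF \<chi>(1)] by (auto simp: d_def)
  have c: "c > 0" using self_in_conj_class[OF b(1)] by (auto simp: c_def card_gt_0_iff)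
  have cardN: "card N = Suc c" using one_notin_conj_class[OF b] by (simp add: N_def c_def)
  have NG: "N \<subseteq> carrier G" using conj_class_closed[OF b(1)] by (auto simp: N_def)
  have nontriv: "\<chi> \<noteq> trivial_character" using \<chi>(2) b by (auto simp: trivial_character_def)
  have Apos: "A > 0"
  proof -
    have "(char_degree trivial_character)\<^sup>2 \<le> A"
      unfolding A_def using finite_Irr trivial_character_Irr nontriv by (intro member_le_sum) auto
    then show ?thesis using char_degree(2)[OF trivial_character_Irr] by (metis gr0I not_less power_eq_0_iff zero_less_power le_zero_eq)
  qed
  have AG: "A + d\<^sup>2 = Coset.order G"
    using sum_degree_squares finite_Irr \<chi>(1) by (simp add: A_def d_def sum.remove)
  have A\<chi>: "of_nat A + of_nat d * \<chi> b = 0"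
  proof -
    have "(\<Sum>\<psi>\<in>Irr G - {\<chi>}. \<psi> \<one> * \<psi> b) = of_nat A"
      unfolding A_def of_nat_sum
    proof (rule sum.cong[OF refl])
      fix \<psi> assume "\<psi> \<in> Irr G - {\<chi>}"
      then show "\<psi> \<one> * \<psi> b = of_nat ((char_degree \<psi>)\<^sup>2)"
        using eq[of \<psi>] char_degree(1)[of \<psi>] by (simp add: power2_eq_square)
    qed
    moreover have "(\<Sum>\<psi>\<in>Irr G. \<psi> \<one> * \<psi> b) = \<chi> \<one> * \<chi> b + (\<Sum>\<psi>\<in>Irr G - {\<chi>}. \<psi> \<one> * \<psi> b)"
      using finite_Irr \<chi>(1) by (rule sum.remove)
    ultimately show ?thesis using regular_character[OF b(1)] b(2) d by (simp add: add.commute)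
  qed
  have \<chi>b: "\<chi> b \<noteq> 0" using A\<chi> Apos by auto
  have vanish: "\<chi> x = 0" if x: "x \<in> carrier G" "x \<noteq> \<one>" "inv x \<notin> conj_class b" for x
  proof -
    have "\<one> \<notin> conj_class (inv x)" using x one_notin_conj_class[of "inv x"] by (auto simp: inv_eq_1_iff)
    moreover have "b \<notin> conj_class (inv x)" using x conj_class_sym[of "inv x" b] by auto
    ultimately have "(\<chi> \<one> - \<chi> b) * \<chi> x = 0"
      using columns_differ_once[of \<chi> \<one> b x, OF \<chi>(1) eq] column_orthogonality_nonconj[of \<one> "inv x"]
        column_orthogonality_nonconj[of b "inv x"] x b by simp
    then show ?thesis using \<chi>(2) by simp
  qed
  \<comment> \<open>Here the class of \<open>b\<close> is seen to be closed under inverses: otherwise \<open>\<chi> b = 0\<close>, against \<open>A > 0\<close>.\<close>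
  have inv_b: "inv b \<in> conj_class b" using vanish[of b] b \<chi>b by auto
  have zero: "\<chi> x = 0" if x: "x \<in> carrier G" "x \<notin> N" for x
  proof (rule vanish)
    show "inv x \<notin> conj_class b"
      using conj_class_inv[OF b(1) inv_b, of "inv x"] x by (auto simp: N_def)
  qed (use x in \<open>auto simp: N_def\<close>)
  have sumN: "(\<Sum>x\<in>N. \<psi> x) = \<psi> \<one> + of_nat c * \<psi> b" if \<psi>: "\<psi> \<in> Irr G" for \<psi>
    using one_notin_conj_class[OF b] character_conj_class[OF \<psi> b(1)] by (simp add: N_def c_def)
  have sum\<chi>: "(\<Sum>x\<in>N. \<chi> x) = 0"
  proof -
    have "(\<Sum>x\<in>N. \<chi> x) = (\<Sum>x\<in>carrier G. \<chi> x)"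
      using NG zero by (intro sum.mono_neutral_left) auto
    then show ?thesis using sum_character_eq_0[OF \<chi>(1) nontriv] by simp
  qed
  have conjN: "x \<otimes> g \<otimes> inv x \<in> N" if "x \<in> carrier G" "g \<in> N" for x g
    using that conj_class_conj[OF b(1)] by (auto simp: N_def)
  have multN: "x \<otimes> y \<in> N" if xy: "x \<in> N" "y \<in> N" for x y
  proof (rule normal_subset_mult_closed[OF NG conjN _ xy])
    fix \<psi> assume \<psi>: "\<psi> \<in> Irr G"
    show "(\<Sum>x\<in>N. \<psi> x) = 0 \<or> (\<Sum>x\<in>N. \<psi> x) = of_nat (card N) * \<psi> \<one>"
    proof (cases "\<psi> = \<chi>")
      case True
      then show ?thesis using sum\<chi> by simp
    next
      case False
      then show ?thesis using sumN[OF \<psi>] eq[OF \<psi>] by (simp add: cardN algebra_simps)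
    qed
  qed
  have subN: "subgroup N G"
    using NG multN conj_class_inv[OF b(1) inv_b] by (intro subgroupI) (auto simp: N_def)
  have \<chi>bc: "of_nat d + of_nat c * \<chi> b = 0" using sumN[OF \<chi>(1)] sum\<chi> d by simp
  have "(of_nat A * of_nat c + of_nat d * (of_nat c * \<chi> b) :: complex) = of_nat c * (of_nat A + of_nat d * \<chi> b)"
    by (simp add: algebra_simps)
  then have "of_nat A * of_nat c = (of_nat d * of_nat d :: complex)"
    using A\<chi> \<chi>bc by (simp add: add_eq_0_iff2)
  then have Ac: "A * c = d\<^sup>2" by (metis of_nat_eq_iff of_nat_mult power2_eq_square)
  have deg: "char_degree \<psi> \<le> d" if \<psi>: "\<psi> \<in> Irr G" for \<psi>
  proof (cases "\<psi> = \<chi>")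
    case False
    then have "(char_degree \<psi>)\<^sup>2 \<le> A" unfolding A_def using finite_Irr \<psi> by (intro member_le_sum) auto
    also have "A \<le> A * c" using c by simp
    finally have "(char_degree \<psi>)\<^sup>2 \<le> d\<^sup>2" using Ac by simp
    then show ?thesis by (rule power2_le_imp_le) simp
  qed (simp add: d_def)
  have "d\<^sup>2 * Suc c = Coset.order G * c"
    by (simp flip: AG add: Ac algebra_simps)
  moreover have "card {x \<in> carrier G. b = x \<otimes> b \<otimes> inv x} * c = Coset.order G"
  proof -
    let ?k = "card {x \<in> carrier G. b = x \<otimes> b \<otimes> inv x}"
    have "of_nat ?k = (\<Sum>\<psi>\<in>Irr G. \<psi> b * \<psi> b)"
      unfolding column_orthogonality[OF b(1) b(1), symmetric]
      using character_conj_class[OF _ b(1) inv_b] by (intro sum.cong) auto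
    also have "\<dots> = \<chi> b * \<chi> b + (\<Sum>\<psi>\<in>Irr G - {\<chi>}. \<psi> b * \<psi> b)"
      using finite_Irr \<chi>(1) by (rule sum.remove)
    also have "(\<Sum>\<psi>\<in>Irr G - {\<chi>}. \<psi> b * \<psi> b) = of_nat A"
      unfolding A_def of_nat_sum
    proof (rule sum.cong[OF refl])
      fix \<psi> assume "\<psi> \<in> Irr G - {\<chi>}"
      then show "\<psi> b * \<psi> b = of_nat ((char_degree \<psi>)\<^sup>2)"
        using eq[of \<psi>] char_degree(1)[of \<psi>] by (simp add: power2_eq_square)
    qed
    finally have k: "of_nat ?k = \<chi> b * \<chi> b + of_nat A" .
    have \<chi>bc': "of_nat c * \<chi> b = - of_nat d" using \<chi>bc by (simp add: add_eq_0_iff)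
    have "of_nat (?k * c) = of_nat c * \<chi> b * \<chi> b + of_nat (A * c)"
      by (simp add: k algebra_simps)
    also have "\<dots> = of_nat A + of_nat (d\<^sup>2)" using A\<chi> unfolding \<chi>bc' Ac by (simp add: add_eq_0_iff2)
    also have "\<dots> = of_nat (Coset.order G)" unfolding AG[symmetric] by simp
    finally show ?thesis by (metis of_nat_eq_iff)
  qed
  moreover have "max_irr_degree G = real d"
    by (rule max_irr_degree_eqI[OF \<chi>(1) _ deg]) (simp_all add: d_def)
  ultimately show thesis
    using b N_def subN \<chi>(1) d zero cardN unfolding c_def
    by (intro that[of b N \<chi> d]) auto
qed

section \<open>A criterion for two columns to differ in one entry\<close>

text \<open>Such a character sums to zero over the normal subgroup \<open>{\<one>} \<union> conj_class b\<close> and is constant on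
its nontrivial elements.\<close>

lemma character_value_off_kernel:
  assumes b: "b \<in> carrier G" "b \<noteq> \<one>" and N: "subgroup (insert \<one> (conj_class b)) G"
    and \<chi>: "\<chi> \<in> Irr G" "\<chi> b \<noteq> \<chi> \<one>"
  shows "of_nat (card (conj_class b)) * \<chi> b = - \<chi> \<one>"
proof -
  let ?N = "insert \<one> (conj_class b)" and ?c = "card (conj_class b)"
  have "card ?N = Suc ?c" using one_notin_conj_class[OF b] by simp
  have "x \<otimes> g \<otimes> inv x \<in> ?N" if "x \<in> carrier G" "g \<in> ?N" for x g
    using that conj_class_conj[OF b(1)] by auto
  from character_sum_normal_subgroup[OF \<chi>(1) N this]
  have "(\<Sum>x\<in>?N. \<chi> x) = 0 \<or> (\<Sum>x\<in>?N. \<chi> x) = of_nat (Suc ?c) * \<chi> \<one>"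
    unfolding \<open>card ?N = Suc ?c\<close> .
  moreover have "(\<Sum>x\<in>?N. \<chi> x) = \<chi> \<one> + of_nat ?c * \<chi> b"
    using one_notin_conj_class[OF b] character_conj_class[OF \<chi>(1) b(1)] by simp
  moreover have "?c \<noteq> 0" using self_in_conj_class[OF b(1)] by auto
  ultimately show ?thesis using \<chi>(2) by (auto simp: algebra_simps add_eq_0_iff)
qed

text \<open>Orthogonality of the columns of \<open>\<one>\<close> and \<open>b\<close>, together with the value of the characters that
distinguish \<open>b\<close> from \<open>\<one>\<close>, determines the sum of the squares of the degrees of these
characters; it is \<open>r\<^sup>2\<close>.  There is room for exactly one character of degree at least \<open>r\<close>.\<close>

theorem CD1_criterion:
  assumes b: "b \<in> carrier G" "b \<noteq> \<one>" and N: "subgroup (insert \<one> (conj_class b)) G"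
    and r: "r > 1" and ord: "Coset.order G * card (conj_class b) = r\<^sup>2 * Suc (card (conj_class b))"
    and bad: "\<And>\<chi>. \<chi> \<in> Irr G \<Longrightarrow> \<chi> b \<noteq> \<chi> \<one> \<Longrightarrow> r \<le> char_degree \<chi>"
  shows "CD1_group G" "max_irr_degree G = real r"
proof -
  define c where "c = card (conj_class b)"
  define U where "U = {\<chi> \<in> Irr G. \<chi> b \<noteq> \<chi> \<one>}"
  define A where "A = (\<Sum>\<psi>\<in>Irr G - U. (char_degree \<psi>)\<^sup>2)"
  define S where "S = (\<Sum>\<psi>\<in>U. (char_degree \<psi>)\<^sup>2)"
  have U: "U \<subseteq> Irr G" "finite U" using finite_Irr by (auto simp: U_def)
  have c: "c > 0" using self_in_conj_class[OF b(1)] by (auto simp: c_def card_gt_0_iff)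
  have AS: "A + S = Coset.order G"
    using sum_degree_squares sum.subset_diff[OF U(1) finite_Irr, of "\<lambda>\<psi>. (char_degree \<psi>)\<^sup>2"]
    by (simp add: A_def S_def)
  have "(\<Sum>\<psi>\<in>Irr G. of_nat c * (\<psi> \<one> * \<psi> b)) = of_nat c * of_nat A - (of_nat S :: complex)"
  proof -
    have "(\<Sum>\<psi>\<in>Irr G - U. of_nat c * (\<psi> \<one> * \<psi> b)) = of_nat c * of_nat A"
      unfolding A_def of_nat_sum sum_distrib_left
    proof (rule sum.cong[OF refl])
      fix \<psi> assume "\<psi> \<in> Irr G - U"
      then have "\<psi> \<in> Irr G" "\<psi> b = \<psi> \<one>" by (auto simp: U_def)
      then show "of_nat c * (\<psi> \<one> * \<psi> b) = of_nat c * of_nat ((char_degree \<psi>)\<^sup>2)"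
        using char_degree(1)[of \<psi>] by (simp add: power2_eq_square)
    qed
    moreover have "(\<Sum>\<psi>\<in>U. of_nat c * (\<psi> \<one> * \<psi> b)) = - of_nat S"
      unfolding S_def of_nat_sum sum_negf[symmetric]
    proof (rule sum.cong[OF refl])
      fix \<psi> assume "\<psi> \<in> U"
      then have \<psi>: "\<psi> \<in> Irr G" "\<psi> b \<noteq> \<psi> \<one>" by (auto simp: U_def)
      have "of_nat c * (\<psi> \<one> * \<psi> b) = \<psi> \<one> * (of_nat c * \<psi> b)" by simp
      also have "\<dots> = - (\<psi> \<one> * \<psi> \<one>)"
        using character_value_off_kernel[OF b N \<psi>] by (simp add: c_def)
      finally show "of_nat c * (\<psi> \<one> * \<psi> b) = - of_nat ((char_degree \<psi>)\<^sup>2)"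
        using char_degree(1)[OF \<psi>(1)] by (simp add: power2_eq_square)
    qed
    ultimately show ?thesis
      using sum.subset_diff[OF U(1) finite_Irr, of "\<lambda>\<psi>. of_nat c * (\<psi> \<one> * \<psi> b)"] by simp
  qed
  moreover have "(\<Sum>\<psi>\<in>Irr G. of_nat c * (\<psi> \<one> * \<psi> b)) = 0"
    using regular_character[OF b(1)] b(2) by (simp flip: sum_distrib_left)
  ultimately have cA: "c * A = S" by (metis eq_iff_diff_eq_0 of_nat_eq_iff of_nat_mult)
  have "S * Suc c = c * (A + S)" using cA by (simp add: algebra_simps)
  also have "\<dots> = r\<^sup>2 * Suc c" using ord by (simp add: AS c_def mult.commute)
  finally have S: "S = r\<^sup>2" by (simp only: mult_cancel2) simp
  have "U \<noteq> {}" using S r by (auto simp: S_def)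
  then obtain \<chi> where \<chi>: "\<chi> \<in> U" by blast
  have rest: "S = (char_degree \<chi>)\<^sup>2 + (\<Sum>\<psi>\<in>U - {\<chi>}. (char_degree \<psi>)\<^sup>2)"
    unfolding S_def using U(2) \<chi> by (rule sum.remove)
  have "r \<le> char_degree \<chi>" using bad \<chi> by (auto simp: U_def)
  then have ge: "r\<^sup>2 \<le> (char_degree \<chi>)\<^sup>2" by (rule power_mono) simp
  have "(char_degree \<chi>)\<^sup>2 = r\<^sup>2" "(\<Sum>\<psi>\<in>U - {\<chi>}. (char_degree \<psi>)\<^sup>2) = 0"
    using rest S ge by linarith+
  then have deg\<chi>: "char_degree \<chi> = r" and others: "\<And>\<psi>. \<psi> \<in> U - {\<chi>} \<Longrightarrow> char_degree \<psi> = 0"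
    using U(2) by (auto simp: power2_eq_iff_nonneg)
  have uniq: "\<psi> b = \<psi> \<one>" if "\<psi> \<in> Irr G" "\<psi> \<noteq> \<chi>" for \<psi>
  proof (rule ccontr)
    assume "\<psi> b \<noteq> \<psi> \<one>"
    then have "char_degree \<psi> = 0" using that others by (auto simp: U_def)
    then show False using char_degree(2)[OF that(1)] by simp
  qed
  have "r\<^sup>2 > 2"
  proof -
    have "(2::nat)\<^sup>2 \<le> r\<^sup>2" using r by (intro power_mono) auto
    then show ?thesis by simp
  qed
  then have "Coset.order G > 2" using AS S by simp
  moreover have "\<not> conjugate_in G \<one> b"
    using b by (auto simp: conjugate_in_def)
  moreover have "\<chi> \<in> Irr G" "\<chi> \<one> \<noteq> \<chi> b" using \<chi> by (auto simp: U_def)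
  moreover have "\<forall>\<psi>\<in>Irr G. \<psi> \<noteq> \<chi> \<longrightarrow> \<psi> \<one> = \<psi> b"
    by (intro ballI impI) (rule uniq[symmetric])
  ultimately show "CD1_group G"
    unfolding CD1_group_def using b(1) one_closed by blast
  have "char_degree \<psi> \<le> r" if \<psi>: "\<psi> \<in> Irr G" for \<psi>
  proof (cases "\<psi> = \<chi>")
    case False
    then have "\<psi> \<in> Irr G - U" using uniq \<psi> by (auto simp: U_def)
    then have "(char_degree \<psi>)\<^sup>2 \<le> A" unfolding A_def using finite_Irr by (intro member_le_sum) auto
    also have "A \<le> c * A" using c by simp
    finally have "(char_degree \<psi>)\<^sup>2 \<le> r\<^sup>2" using cA S by simp
    then show ?thesis by (rule power2_le_imp_le) simp
  qed (simp add: deg\<chi>)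
  then show "max_irr_degree G = real r"
    using \<chi> deg\<chi> by (intro max_irr_degree_eqI[of \<chi>]) (auto simp: U_def)
qed

lemma linear_character_mult:
  assumes \<chi>: "\<chi> \<in> Irr G" and one: "char_degree \<chi> = 1" and xy: "x \<in> carrier G" "y \<in> carrier G"
  shows "\<chi> (x \<otimes> y) = \<chi> x * \<chi> y"
proof -
  obtain n \<rho> where r: "\<chi> \<one> = of_nat n" "\<rho> \<in> hom G (GL n)"
    "\<And>g. g \<in> carrier G \<Longrightarrow> \<rho> g \<in> carrier_mat n n"
    "\<And>g. g \<in> carrier G \<Longrightarrow> \<chi> g = mat_trace (\<rho> g)" using IrrE[OF \<chi>] by metis
  have n: "n = 1" using r(1) char_degree(1)[OF \<chi>] one by simp
  have tr: "\<chi> g = \<rho> g $$ (0, 0)" if "g \<in> carrier G" for g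
    using r(3,4)[OF that] n by (simp add: mat_trace_def)
  show ?thesis
    using tr[of "x \<otimes> y"] xy r(3)[of x] r(3)[of y] n
    by (simp add: tr representation_simps(2)[OF r(2)] scalar_prod_def)
qed

text \<open>A linear character is trivial on commutators, and \<open>b\<close> is the commutator of \<open>x\<close> and
  \<open>y\<close> here.\<close>

lemma degree_ge_2_if_commutator:
  assumes "\<chi> \<in> Irr G" "x \<in> carrier G" "y \<in> carrier G" "b \<in> carrier G"
    and comm: "x \<otimes> y = b \<otimes> (y \<otimes> x)" and ne: "\<chi> b \<noteq> \<chi> \<one>"
  shows "2 \<le> char_degree \<chi>"
proof (rule ccontr)
  assume "\<not> ?thesis"
  then have one: "char_degree \<chi> = 1" using char_degree(2)[OF assms(1)] by simp
  note m = linear_character_mult[OF assms(1) one]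
  have nz: "\<chi> g \<noteq> 0" if "g \<in> carrier G" for g
    using m[of g "inv g"] that char_degree[OF assms(1)] by auto
  have "\<chi> x * \<chi> y = \<chi> b * (\<chi> y * \<chi> x)" using assms comm by (simp flip: m)
  then have "\<chi> b = 1" using nz assms by simp
  moreover have "\<chi> \<one> = 1" using char_degree(1)[OF assms(1)] one by simp
  ultimately show False using ne by simp
qed

lemma subgroup_involution:
  assumes "b \<in> carrier G" "b \<otimes> b = \<one>"
  shows "subgroup {\<one>, b} G"
  using assms by (intro subgroupI) (auto simp: inv_equality)

text \<open>The value of a character at an involution is an integer, because \<open>\<chi> \<one> + \<chi> b\<close> is twice a
multiplicity.  Since \<open>|conj_class b| \<chi> b = - \<chi> \<one>\<close>, the class size divides the degree.\<close>

lemma degree_ge_if_involution: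
  assumes b: "b \<in> carrier G" "b \<noteq> \<one>" "b \<otimes> b = \<one>" and N: "subgroup (insert \<one> (conj_class b)) G"
    and \<chi>: "\<chi> \<in> Irr G" "\<chi> b \<noteq> \<chi> \<one>"
  shows "card (conj_class b) \<le> char_degree \<chi>"
proof -
  let ?c = "card (conj_class b)" and ?d = "char_degree \<chi>"
  obtain k :: nat where "(\<Sum>x\<in>{\<one>, b}. \<chi> x) = of_nat (card {\<one>, b} * k)"
    using character_sum_subgroup[OF \<chi>(1) subgroup_involution[OF b(1,3)]] by blast
  then have \<chi>b: "\<chi> b = of_int (2 * int k - int ?d)"
    using b(2) char_degree(1)[OF \<chi>(1)] by (auto simp: algebra_simps)
  have "of_int (int ?c * (2 * int k - int ?d)) = (of_int (- int ?d) :: complex)"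
    using character_value_off_kernel[OF b(1,2) N \<chi>] char_degree(1)[OF \<chi>(1)] by (simp add: \<chi>b)
  then have "int ?c * (2 * int k - int ?d) = - int ?d" by (simp only: of_int_eq_iff)
  then have "int ?c dvd int ?d" by (metis dvd_minus_iff dvd_triv_left)
  then show ?thesis using char_degree(2)[OF \<chi>(1)] by (simp add: dvd_imp_le)
qed

end

section \<open>The groups of order 6 and 8\<close>

text \<open>The groups of order \<open>2 n\<close> generated by a rotation \<open>x\<close> of order \<open>n\<close> and an element \<open>y\<close> that inverts
it, with \<open>y\<^sup>2 = x\<^sup>e\<close>.  For \<open>e = 0\<close> this is the dihedral group; \<open>n = 4\<close>, \<open>e = 2\<close> is the quaternion
group, and \<open>n = 3\<close>, \<open>e = 0\<close> is \<open>S\<^sub>3\<close>.\<close>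

definition dihedral_like :: "('a, 'b) monoid_scheme \<Rightarrow> nat \<Rightarrow> nat \<Rightarrow> 'a \<Rightarrow> 'a \<Rightarrow> bool" where
  "dihedral_like G n e x y \<longleftrightarrow>
     x \<in> carrier G \<and> y \<in> carrier G \<and> n > 0 \<and> Coset.order G = 2 * n \<and>
     x [^]\<^bsub>G\<^esub> n = \<one>\<^bsub>G\<^esub> \<and> (\<forall>k. 0 < k \<and> k < n \<longrightarrow> x [^]\<^bsub>G\<^esub> k \<noteq> \<one>\<^bsub>G\<^esub>) \<and>
     (\<forall>k<n. y \<noteq> x [^]\<^bsub>G\<^esub> k) \<and> y \<otimes>\<^bsub>G\<^esub> y = x [^]\<^bsub>G\<^esub> e \<and>
     y \<otimes>\<^bsub>G\<^esub> x = inv\<^bsub>G\<^esub> x \<otimes>\<^bsub>G\<^esub> y"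

definition dihedral_word :: "('a, 'b) monoid_scheme \<Rightarrow> 'a \<Rightarrow> 'a \<Rightarrow> nat \<times> bool \<Rightarrow> 'a" where
  "dihedral_word G x y p = x [^]\<^bsub>G\<^esub> fst p \<otimes>\<^bsub>G\<^esub> (if snd p then y else \<one>\<^bsub>G\<^esub>)"

text \<open>Multiplication of the normal forms \<open>x\<^sup>a y\<^sup>s\<close> with \<open>a < n\<close>; the exponent \<open>-b\<close> produced by moving
\<open>y\<close> past \<open>x\<^sup>b\<close> is represented by \<open>n - b\<close>.\<close>

definition dihedral_index_mult :: "nat \<Rightarrow> nat \<Rightarrow> nat \<times> bool \<Rightarrow> nat \<times> bool \<Rightarrow> nat \<times> bool" where
  "dihedral_index_mult n e p q =
     ((fst p + (if snd p then n - fst q else fst q) + (if snd p \<and> snd q then e else 0)) mod n,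
      snd p \<noteq> snd q)"

context finite_group
begin

lemma pow_mod_period:
  assumes "x \<in> carrier G" "x [^] (n :: nat) = \<one>"
  shows "x [^] (k mod n) = x [^] (k :: nat)"
proof -
  have "x [^] k = x [^] (n * (k div n) + k mod n)" by simp
  also have "\<dots> = x [^] (k mod n)"
    using assms by (simp only: nat_pow_mult[symmetric] nat_pow_pow[symmetric]) simp
  finally show ?thesis by simp
qed

lemma pow_inj_below:
  assumes x: "x \<in> carrier G" and ne: "\<And>k. 0 < k \<Longrightarrow> k < n \<Longrightarrow> x [^] k \<noteq> \<one>"
  shows "inj_on (\<lambda>k. x [^] k) {..<n :: nat}"
proof -
  have aux: False if "i < j" "j < n" "x [^] i = x [^] j" for i j :: nat
  proof -
    have "x [^] (j - i) \<otimes> x [^] i = \<one> \<otimes> x [^] i"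
      unfolding nat_pow_mult[OF x] using that x by simp
    then have "x [^] (j - i) = \<one>" using x by (subst (asm) r_cancel) auto
    then show False using ne[of "j - i"] that by simp
  qed
  show ?thesis
  proof (rule inj_onI)
    fix i j assume "i \<in> {..<n}" "j \<in> {..<n}" "x [^] i = x [^] j"
    then show "i = j" using aux[of i j] aux[of j i] by (metis lessThan_iff linorder_neqE_nat)
  qed
qed

context
  fixes n e :: nat and x y :: 'a
  assumes dl: "dihedral_like G n e x y"
begin

lemma dihedral_likeD:
  "x \<in> carrier G" "y \<in> carrier G" "n > 0" "Coset.order G = 2 * n" "x [^] n = \<one>"
  "\<And>k. 0 < k \<Longrightarrow> k < n \<Longrightarrow> x [^] k \<noteq> \<one>" "\<And>k. k < n \<Longrightarrow> y \<noteq> x [^] k"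
  "y \<otimes> y = x [^] e" "y \<otimes> x = inv x \<otimes> y"
  using dl by (auto simp: dihedral_like_def)

lemmas rotation_pow_mod = pow_mod_period[OF dihedral_likeD(1,5)]

lemma rotation_pow_diff: "k \<le> n \<Longrightarrow> x [^] (n - k) = inv (x [^] k)"
proof -
  assume "k \<le> n"
  then have "x [^] (n - k) \<otimes> x [^] k = \<one>" using dihedral_likeD(1,5) by (simp add: nat_pow_mult)
  then show ?thesis using dihedral_likeD(1) by (simp add: inv_equality)
qed

lemma reflection_times_pow: "y \<otimes> x [^] (k :: nat) = inv (x [^] k) \<otimes> y"
proof (induction k)
  case (Suc k)
  have "y \<otimes> x [^] Suc k = (y \<otimes> x [^] k) \<otimes> x" using dihedral_likeD by (simp add: m_assoc)
  also have "\<dots> = inv (x [^] k) \<otimes> (y \<otimes> x)" unfolding Suc using dihedral_likeD(1,2) by (simp add: m_assoc)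
  also have "\<dots> = (inv (x [^] k) \<otimes> inv x) \<otimes> y" using dihedral_likeD(1,2,9) by (simp add: m_assoc)
  also have "inv (x [^] k) \<otimes> inv x = inv (x [^] Suc k)"
    using dihedral_likeD(1) by (simp only: nat_pow_Suc2 inv_mult_group nat_pow_closed)
  finally show ?case .
qed (use dihedral_likeD in simp)

lemma dihedral_word_closed: "dihedral_word G x y p \<in> carrier G"
  using dihedral_likeD by (simp add: dihedral_word_def)

lemma dihedral_word_hom:
  assumes "p \<in> {..<n} \<times> UNIV" "q \<in> {..<n} \<times> UNIV"
  shows "dihedral_word G x y p \<otimes> dihedral_word G x y q =
    dihedral_word G x y (dihedral_index_mult n e p q)"
proof -
  obtain a s b t where pq: "p = (a, s)" "q = (b, t)" by (metis surj_pair)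
  then have ab: "a < n" "b < n" using assms by auto
  note d = dihedral_likeD(1,2)
  let ?v = "if t then y else \<one>"
  have v: "?v \<in> carrier G" using d by simp
  show ?thesis
  proof (cases s)
    case False
    have "x [^] a \<otimes> \<one> \<otimes> (x [^] b \<otimes> ?v) = x [^] (a + b) \<otimes> ?v"
      using d v by (simp add: m_assoc nat_pow_mult[symmetric])
    then show ?thesis using False
      by (simp add: dihedral_word_def dihedral_index_mult_def pq rotation_pow_mod)
  next
    case True
    define m where "m = n - b"
    have m: "inv (x [^] b) = x [^] m" using ab by (simp add: m_def rotation_pow_diff)
    have "x [^] a \<otimes> y \<otimes> (x [^] b \<otimes> ?v) = x [^] a \<otimes> (y \<otimes> x [^] b) \<otimes> ?v"
      using d v by (simp add: m_assoc)
    also have "\<dots> = x [^] (a + m) \<otimes> (y \<otimes> ?v)"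
      using d v by (simp only: reflection_times_pow m) (simp add: m_assoc nat_pow_mult[symmetric])
    also have "y \<otimes> ?v = x [^] (if t then e else 0) \<otimes> (if t then \<one> else y)"
      using d dihedral_likeD(8) by simp
    also have "x [^] (a + m) \<otimes> \<dots> = x [^] (a + m + (if t then e else 0)) \<otimes> (if t then \<one> else y)"
      using d by (simp add: m_assoc nat_pow_mult[symmetric])
    finally show ?thesis using True
      by (auto simp: dihedral_word_def dihedral_index_mult_def pq rotation_pow_mod m_def)
  qed
qed

lemma dihedral_word_bij: "bij_betw (dihedral_word G x y) ({..<n} \<times> UNIV) (carrier G)"
proof -
  note d = dihedral_likeD(1,2)
  have cancel: "i = j" if "i < n" "j < n" "x [^] i = x [^] j" for i j
    using inj_onD[OF pow_inj_below[OF d(1) dihedral_likeD(6)] that(3)] that(1,2) by simp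
  have ypow: False if "x [^] i \<otimes> y = x [^] j" for i j :: nat
  proof -
    let ?i = "i mod n"
    have "x [^] ?i \<otimes> y = x [^] j" using that by (simp add: rotation_pow_mod)
    then have "y = inv (x [^] ?i) \<otimes> x [^] j" using d by (simp add: inv_solve_left)
    also have "inv (x [^] ?i) = x [^] (n - ?i)" using dihedral_likeD(3) by (simp add: rotation_pow_diff less_imp_le)
    also have "x [^] (n - ?i) \<otimes> x [^] j = x [^] ((n - ?i + j) mod n)"
      unfolding rotation_pow_mod using d by (simp only: nat_pow_mult)
    finally show False using dihedral_likeD(7)[of "(n - ?i + j) mod n"] dihedral_likeD(3) by simp
  qed
  have inj: "inj_on (dihedral_word G x y) ({..<n} \<times> UNIV)"
  proof (rule inj_onI)
    fix p q assume p: "p \<in> {..<n} \<times> (UNIV :: bool set)" and q: "q \<in> {..<n} \<times> (UNIV :: bool set)"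
      and eq: "dihedral_word G x y p = dihedral_word G x y q"
    obtain a s b t where pq: "p = (a, s)" "q = (b, t)" by (metis surj_pair)
    have ab: "a < n" "b < n" using p q pq by auto
    have st: "s = t"
    proof (rule ccontr)
      assume "s \<noteq> t"
      then show False
        using eq ypow[of a b] ypow[of b a] d by (cases s) (auto simp: dihedral_word_def pq)
    qed
    have "x [^] a = x [^] b"
      using eq d unfolding dihedral_word_def pq st by (subst (asm) r_cancel) (auto split: if_splits)
    then show "p = q" using cancel ab st pq by simp
  qed
  moreover have "dihedral_word G x y ` ({..<n} \<times> UNIV) = carrier G"
  proof (rule card_subset_eq)
    show "card (dihedral_word G x y ` ({..<n} \<times> UNIV)) = card (carrier G)"
      using dihedral_likeD(4) by (simp add: card_image[OF inj] card_cartesian_product Coset.order_def)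
  qed (use dihedral_word_closed in auto)
  ultimately show ?thesis by (simp add: bij_betw_def)
qed

end

end

text \<open>The multiplication of normal forms depends on \<open>n\<close> and \<open>e\<close> only.\<close>

lemma dihedral_like_unique:
  assumes "finite_group G" "finite_group H" "dihedral_like G n e x y" "dihedral_like H n e u v"
  shows "G \<cong> H"
proof -
  interpret G: finite_group G by fact
  interpret H: finite_group H by fact
  let ?S = "{..<n} \<times> (UNIV :: bool set)"
  let ?f = "dihedral_word G x y" and ?h = "dihedral_word H u v"
  let ?i = "inv_into ?S ?f"
  have f: "bij_betw ?f ?S (carrier G)" by (rule G.dihedral_word_bij[OF assms(3)])
  have h: "bij_betw ?h ?S (carrier H)" by (rule H.dihedral_word_bij[OF assms(4)])
  have i: "bij_betw ?i (carrier G) ?S" by (rule bij_betw_inv_into[OF f])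
  have n: "n > 0" using assms(3) by (simp add: dihedral_like_def)
  have "?h \<circ> ?i \<in> Group.iso G H"
  proof (rule isoI)
    show "bij_betw (?h \<circ> ?i) (carrier G) (carrier H)" using i h by (rule bij_betw_trans)
    show "?h \<circ> ?i \<in> hom G H"
    proof (rule homI)
      fix g assume "g \<in> carrier G"
      then show "(?h \<circ> ?i) g \<in> carrier H" using H.dihedral_word_closed[OF assms(4)] by simp
    next
      fix g g' assume g: "g \<in> carrier G" "g' \<in> carrier G"
      have ig: "?i g \<in> ?S" "?i g' \<in> ?S" using i g by (auto simp: bij_betw_def)
      have m: "dihedral_index_mult n e (?i g) (?i g') \<in> ?S"
        using n by (simp add: dihedral_index_mult_def)
      have "g \<otimes>\<^bsub>G\<^esub> g' = ?f (?i g) \<otimes>\<^bsub>G\<^esub> ?f (?i g')"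
        using g f by (simp add: bij_betw_inv_into_right)
      also have "\<dots> = ?f (dihedral_index_mult n e (?i g) (?i g'))"
        by (rule G.dihedral_word_hom[OF assms(3) ig])
      finally have "?i (g \<otimes>\<^bsub>G\<^esub> g') = dihedral_index_mult n e (?i g) (?i g')"
        using f m by (simp add: bij_betw_inv_into_left)
      then show "(?h \<circ> ?i) (g \<otimes>\<^bsub>G\<^esub> g') = (?h \<circ> ?i) g \<otimes>\<^bsub>H\<^esub> (?h \<circ> ?i) g'"
        using H.dihedral_word_hom[OF assms(4) ig] by simp
    qed
  qed
  then show ?thesis by (rule is_isoI)
qed

lemma dihedral_like_transfer:
  assumes "finite_group G" "finite_group H" "G \<cong> H" "dihedral_like H n e u v"
  shows "\<exists>x y. dihedral_like G n e x y"
proof -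
  interpret G: finite_group G by fact
  interpret H: finite_group H by fact
  obtain f where f: "f \<in> Group.iso H G" using H.iso_sym G.iso_sym[OF assms(3)] by (auto simp: is_iso_def)
  then interpret f: group_hom H G f
    by unfold_locales (auto simp: iso_def)
  have bij: "bij_betw f (carrier H) (carrier G)" using f by (simp add: iso_def)
  note d = H.dihedral_likeD[OF assms(4)]
  have inj: "f a = f b \<longleftrightarrow> a = b" if "a \<in> carrier H" "b \<in> carrier H" for a b
    using bij that by (auto simp: bij_betw_def inj_on_def)
  have pow: "f u [^]\<^bsub>G\<^esub> k = f (u [^]\<^bsub>H\<^esub> k)" for k :: nat
    using d(1) by (simp add: f.hom_nat_pow)
  have one: "\<one>\<^bsub>G\<^esub> = f \<one>\<^bsub>H\<^esub>" by simp
  have "dihedral_like G n e (f u) (f v)"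
    unfolding dihedral_like_def
  proof (intro conjI allI impI)
    show "f u \<in> carrier G" "f v \<in> carrier G" "n > 0" using d by simp_all
    show "Coset.order G = 2 * n" using bij_betw_same_card[OF bij] d(4) by (simp add: Coset.order_def)
    show "f u [^]\<^bsub>G\<^esub> n = \<one>\<^bsub>G\<^esub>" using d(5) by (simp add: pow)
    show "f u [^]\<^bsub>G\<^esub> k \<noteq> \<one>\<^bsub>G\<^esub>" if "0 < k \<and> k < n" for k
      unfolding pow one using d(1) d(6)[of k] that by (subst inj) auto
    show "f v \<noteq> f u [^]\<^bsub>G\<^esub> k" if "k < n" for k
      unfolding pow using d(1,2) d(7)[OF that] by (subst inj) auto
    show "f v \<otimes>\<^bsub>G\<^esub> f v = f u [^]\<^bsub>G\<^esub> e"
      unfolding pow using d(2,8) by (simp flip: f.hom_mult)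
    show "f v \<otimes>\<^bsub>G\<^esub> f u = inv\<^bsub>G\<^esub> (f u) \<otimes>\<^bsub>G\<^esub> f v"
      using d(1,2,9) by (simp flip: f.hom_mult f.hom_inv)
  qed
  then show ?thesis by blast
qed

lemma nat_pow_2_3_4:
  assumes "group G" "x \<in> carrier G"
  shows "x [^]\<^bsub>G\<^esub> (2::nat) = x \<otimes>\<^bsub>G\<^esub> x" "x [^]\<^bsub>G\<^esub> (3::nat) = x \<otimes>\<^bsub>G\<^esub> x \<otimes>\<^bsub>G\<^esub> x"
    "x [^]\<^bsub>G\<^esub> (4::nat) = x \<otimes>\<^bsub>G\<^esub> x \<otimes>\<^bsub>G\<^esub> x \<otimes>\<^bsub>G\<^esub> x"
proof -
  interpret group G by fact
  show "x [^]\<^bsub>G\<^esub> (2::nat) = x \<otimes>\<^bsub>G\<^esub> x" "x [^]\<^bsub>G\<^esub> (3::nat) = x \<otimes>\<^bsub>G\<^esub> x \<otimes>\<^bsub>G\<^esub> x"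
    "x [^]\<^bsub>G\<^esub> (4::nat) = x \<otimes>\<^bsub>G\<^esub> x \<otimes>\<^bsub>G\<^esub> x \<otimes>\<^bsub>G\<^esub> x"
    using assms(2) by (simp_all add: numeral_eq_Suc)
qed

lemma less_3_4_cases: "k < 3 \<longleftrightarrow> k = 0 \<or> k = 1 \<or> k = (2::nat)"
  "k < 4 \<longleftrightarrow> k = 0 \<or> k = 1 \<or> k = 2 \<or> k = (3::nat)"
  by auto

lemma dihedral_like_dihedral_group: "dihedral_like (dihedral_group 4) 4 0 (1, False) (0, True)"
proof -
  have g: "group (dihedral_group 4)" by (rule group_dihedral_group) simp
  have x: "(1, False) \<in> carrier (dihedral_group 4)" by (simp add: dihedral_group_def)
  have y: "(0, True) \<in> carrier (dihedral_group 4)" by (simp add: dihedral_group_def)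
  have "inv\<^bsub>dihedral_group 4\<^esub> (1, False) = (3, False)"
    by (rule group.inv_equality[OF g]) (auto simp: dihedral_group_def)
  then show ?thesis
    unfolding dihedral_like_def less_3_4_cases
    using x y by (auto simp: nat_pow_2_3_4[OF g x] order_dihedral_group monoid.nat_pow_eone group.is_monoid[OF g])
      (auto simp: dihedral_group_def)
qed

lemma dihedral_like_quaternion_group: "dihedral_like quaternion_group 4 2 (0, 1, 0, 0) (0, 0, 1, 0)"
proof -
  note g = group_quaternion_group
  have x: "(0, 1, 0, 0) \<in> carrier quaternion_group" by (simp add: quaternion_group_def)
  have y: "(0, 0, 1, 0) \<in> carrier quaternion_group" by (simp add: quaternion_group_def)
  have i: "inv\<^bsub>quaternion_group\<^esub> (0, 1, 0, 0) = (0, -1, 0, 0)"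
    by (rule group.inv_equality[OF g]) (auto simp: quaternion_group_def)
  have one: "\<one>\<^bsub>quaternion_group\<^esub> = (1, 0, 0, 0)"
    and mult: "p \<otimes>\<^bsub>quaternion_group\<^esub> q = hamilton_product p q" for p q
    by (simp_all add: quaternion_group_def)
  note pw = nat_pow_2_3_4[OF g x] monoid.nat_pow_eone[OF group.is_monoid[OF g] x] monoid.nat_pow_0[OF group.is_monoid[OF g]]
  show ?thesis
    unfolding dihedral_like_def less_3_4_cases
  proof (intro conjI allI impI)
    show "(0, 1, 0, 0) [^]\<^bsub>quaternion_group\<^esub> k \<noteq> \<one>\<^bsub>quaternion_group\<^esub>"
      if "0 < k \<and> (k = 0 \<or> k = 1 \<or> k = 2 \<or> k = 3)" for k :: nat
      using that by (elim conjE disjE; simp only: pw mult one; simp)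
    show "(0, 0, 1, 0) \<noteq> (0, 1, 0, 0) [^]\<^bsub>quaternion_group\<^esub> k"
      if "k = 0 \<or> k = 1 \<or> k = 2 \<or> k = 3" for k :: nat
      using that by (elim disjE; simp only: pw mult one; simp)
  qed (use x y in \<open>simp_all add: pw mult one i order_quaternion_group\<close>)
qed

lemma dihedral_like_sym_group: "\<exists>u v. dihedral_like (sym_group 3) 3 0 u v"
proof -
  define u where "u = transpose 1 2 \<circ> transpose 2 (3 :: nat)"
  define v where "v = transpose 1 (2 :: nat)"
  have g: "group (sym_group 3)" by (rule sym_group_is_group)
  have t: "transpose 1 2 permutes {1..3::nat}" "transpose 2 3 permutes {1..3::nat}"
    by (auto intro!: permutes_swap_id)
  have u: "u \<in> carrier (sym_group 3)" using t by (simp add: sym_group_def permutes_compose u_def)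
  have v: "v \<in> carrier (sym_group 3)" using t by (simp add: sym_group_def v_def)
  have uu: "u \<circ> u \<in> carrier (sym_group 3)" using u by (simp add: sym_group_def permutes_compose)
  have uval: "u 1 = 2" "u 2 = 3" "u 3 = 1" "\<And>k. k \<notin> {1, 2, 3} \<Longrightarrow> u k = k"
    by (auto simp: u_def transpose_def)
  have vval: "v 1 = 2" "v 2 = 1" "v 3 = 3" "\<And>k. k \<notin> {1, 2, 3} \<Longrightarrow> v k = k"
    by (auto simp: v_def transpose_def)
  have ext3: "f = h" if "f 1 = h 1" "f 2 = h 2" "f 3 = h 3" "\<And>k. k \<notin> {1, 2, 3} \<Longrightarrow> f k = h k"
    for f h :: "nat \<Rightarrow> nat"
  proof
    fix k show "f k = h k" using that by (cases "k \<in> {1, 2, 3}") blast+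
  qed
  have u3: "u \<circ> u \<circ> u = id" by (rule ext3) (auto simp: uval simp del: One_nat_def)
  have vv: "v \<circ> v = id" by (rule ext3) (auto simp: vval simp del: One_nat_def)
  have vu: "v \<circ> u = (u \<circ> u) \<circ> v" by (rule ext3) (auto simp: uval vval simp del: One_nat_def)
  have iu: "inv\<^bsub>sym_group 3\<^esub> u = u \<circ> u"
    by (rule group.inv_equality[OF g]) (use u uu u3 in \<open>auto simp: sym_group_mult sym_group_one\<close>)
  note pw = nat_pow_2_3_4[OF g u] monoid.nat_pow_eone[OF group.is_monoid[OF g] u]
  have ne: "f \<noteq> h" if "f k \<noteq> h k" for f h :: "nat \<Rightarrow> nat" and k using that by auto
  have "u \<noteq> id" "u \<circ> u \<noteq> id" "v \<noteq> id" "v \<noteq> u \<circ> u"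
    by (rule ne[of _ 1]; simp add: uval vval del: One_nat_def)+
  moreover have "v \<noteq> u" by (rule ne[of _ 3]) (simp add: uval vval)
  moreover have "Coset.order (sym_group 3) = 6"
    by (simp add: Coset.order_def sym_group_def card_permutations fact_numeral)
  ultimately have "dihedral_like (sym_group 3) 3 0 u v"
    unfolding dihedral_like_def less_3_4_cases
    using u v u3 vv vu by (auto simp: pw iu sym_group_mult sym_group_one simp del: One_nat_def)
  then show ?thesis by blast
qed

context finite_group
begin

lemma involutions_commute:
  assumes "\<And>z. z \<in> carrier G \<Longrightarrow> z \<otimes> z = \<one>" "u \<in> carrier G" "v \<in> carrier G"
  shows "u \<otimes> v = v \<otimes> u"
proof -
  have i: "inv z = z" if "z \<in> carrier G" for z using assms(1)[OF that] that by (simp add: inv_equality)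
  have "u \<otimes> v = inv (u \<otimes> v)" using assms(2,3) i by simp
  also have "\<dots> = inv v \<otimes> inv u" using assms(2,3) by (rule inv_mult_group)
  also have "\<dots> = v \<otimes> u" using assms(2,3) by (simp only: i)
  finally show ?thesis .
qed

text \<open>Not all squares are trivial, and an element of order \<open>8\<close> would generate the group, so there is
an \<open>x\<close> of order \<open>4\<close>.  An element \<open>y\<close> outside the subgroup generated by \<open>x\<close> conjugates \<open>x\<close> to a
power of order \<open>4\<close> other than \<open>x\<close>, which is \<open>x\<^sup>-\<^sup>1\<close>.  Finally \<open>y\<^sup>2\<close> is a power of \<open>x\<close> that commutes
with \<open>y\<close>, so it is \<open>\<one>\<close> or \<open>x\<^sup>2\<close>.\<close>

lemma dihedral_like_if_nonabelian_order_8: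
  assumes ord: "Coset.order G = 8" and uv: "u \<in> carrier G" "v \<in> carrier G" "u \<otimes> v \<noteq> v \<otimes> u"
  shows "\<exists>x y. dihedral_like G 4 0 x y \<or> dihedral_like G 4 2 x y"
proof -
  obtain x where x: "x \<in> carrier G" "x \<otimes> x \<noteq> \<one>" using involutions_commute uv by blast
  have x2: "x [^] (2::nat) \<noteq> \<one>" using x by (simp add: nat_pow_2_3_4[OF is_group x(1)])
  have o8: "ord x dvd 2 ^ 3" using ord_dvd_group_order[OF x(1)] ord by simp
  have x4: "x [^] (4::nat) = \<one>"
  proof (rule ccontr)
    assume x4: "x [^] (4::nat) \<noteq> \<one>"
    have "ord x = 8"
    proof -
      obtain i where i: "i \<le> 3" "ord x = 2 ^ i" using o8 divides_primepow_nat[of 2 "ord x" 3] by auto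
      have "i = 0 \<or> i = 1 \<or> i = 2 \<or> i = 3" using i by auto
      moreover have "\<not> ord x dvd 4" using x4 x(1) pow_eq_id by blast
      ultimately show ?thesis using i by auto
    qed
    then have inj: "inj_on (\<lambda>k. x [^] k) {0..7::nat}" using ord_inj[OF x(1)] by simp
    have im: "(\<lambda>k. x [^] k) ` {0..7::nat} = carrier G"
    proof (rule card_subset_eq)
      show "card ((\<lambda>k. x [^] k) ` {0..7::nat}) = card (carrier G)"
        using card_image[OF inj] ord by (simp add: Coset.order_def)
    qed (use x in auto)
    obtain i where i: "u = x [^] (i::nat)" using uv(1) im by (metis imageE)
    obtain j where j: "v = x [^] (j::nat)" using uv(2) im by (metis imageE)
    show False using uv(3) x(1) by (simp add: i j nat_pow_mult add.commute)
  qed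
  have xpow: "x [^] k \<noteq> \<one>" if "0 < k" "k < 4" for k :: nat
  proof
    assume k: "x [^] k = \<one>"
    have "k = 1 \<or> k = 2 \<or> k = 3" using that by auto
    then show False
    proof (elim disjE)
      assume "k = 1"
      then show False using k x by simp
    next
      assume "k = 3"
      then have x3: "x [^] (3::nat) = \<one>" using k by simp
      have "x [^] (4::nat) = x [^] (3::nat) \<otimes> x" by (simp add: nat_pow_2_3_4[OF is_group x(1)])
      then have "x = \<one>" unfolding x3 x4 using x(1) by simp
      then show False using x(2) by simp
    qed (use k x2 in simp)
  qed
  define H where "H = (\<lambda>k. x [^] k) ` {..<4::nat}"
  have HG: "H \<subseteq> carrier G" using x by (auto simp: H_def)
  have pmod: "x [^] k = x [^] (k mod 4)" for k :: nat
    using pow_mod_period[OF x(1) x4] by simp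
  have powH: "x [^] k \<in> H" for k :: nat
    unfolding H_def by (rule image_eqI[of _ _ "k mod 4"], rule pmod, simp)
  have ix: "inv x = x [^] (3::nat)"
    using x(1) x4 by (intro inv_equality) (simp_all add: nat_pow_2_3_4[OF is_group x(1)])
  have injH: "inj_on (\<lambda>k. x [^] k) {..<4::nat}" by (rule pow_inj_below[OF x(1) xpow])
  have cH: "card H = 4" using card_image[OF injH] by (simp add: H_def)
  have "H \<noteq> carrier G" using cH ord by (auto simp: Coset.order_def)
  then obtain y where y: "y \<in> carrier G" "y \<notin> H" using HG by blast
  have divH: "inv (x [^] i) \<otimes> x [^] j \<in> H" for i j :: nat
  proof -
    have "inv (x [^] i) = x [^] (3 * i)" using x(1) by (simp add: nat_pow_inv[symmetric] ix nat_pow_pow)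
    then show ?thesis using x(1) powH by (simp add: nat_pow_mult)
  qed
  have split: "\<exists>k<4::nat. g = x [^] k \<otimes> y" if g: "g \<in> carrier G" "g \<notin> H" for g
  proof -
    let ?Hy = "(\<lambda>h. h \<otimes> y) ` H"
    have injy: "inj_on (\<lambda>h. h \<otimes> y) H" using HG y by (auto intro!: inj_onI simp: subset_iff)
    have "H \<inter> ?Hy = {}"
    proof (rule ccontr)
      assume "H \<inter> ?Hy \<noteq> {}"
      then obtain i j :: nat where "x [^] j = x [^] i \<otimes> y" by (auto simp: H_def)
      then have "y = inv (x [^] i) \<otimes> x [^] j" using x y by (simp add: inv_solve_left)
      then show False using divH y by simp
    qed
    then have "card (H \<union> ?Hy) = 8"
      using card_image[OF injy] cH by (subst card_Un_disjoint) (auto simp: H_def)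
    then have "H \<union> ?Hy = carrier G"
      using HG y ord by (intro card_subset_eq) (auto simp: Coset.order_def)
    then have "g \<in> ?Hy" using g by blast
    then show ?thesis by (auto simp: H_def)
  qed
  \<comment> \<open>As \<open>x\<close> and \<open>y\<close> generate the group, which is nonabelian, they cannot commute.\<close>
  have comm_all: "z \<otimes> g = g \<otimes> z"
    if z: "z \<in> carrier G" "z \<otimes> x = x \<otimes> z" "z \<otimes> y = y \<otimes> z" and g: "g \<in> carrier G" for z g
  proof -
    have p: "z \<otimes> x [^] k = x [^] k \<otimes> z" for k :: nat
      using group_commutes_pow[of x z k] z x(1) by simp
    show ?thesis
    proof (cases "g \<in> H")
      case True
      then show ?thesis using p by (auto simp: H_def)
    next
      case False
      then obtain k :: nat where k: "g = x [^] k \<otimes> y" using split[OF g] by blast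
      have "z \<otimes> g = (z \<otimes> x [^] k) \<otimes> y" using z x y by (simp add: k m_assoc)
      also have "\<dots> = x [^] k \<otimes> (z \<otimes> y)" unfolding p using z x y by (simp add: m_assoc)
      also have "\<dots> = g \<otimes> z" unfolding z(3) using z x y by (simp add: k m_assoc)
      finally show ?thesis .
    qed
  qed
  have nc: "y \<otimes> x \<noteq> x \<otimes> y"
  proof
    assume c: "y \<otimes> x = x \<otimes> y"
    have "x \<otimes> u = u \<otimes> x" "y \<otimes> u = u \<otimes> y" using comm_all[of x u] comm_all[of y u] c x y uv by auto
    then have "u \<otimes> v = v \<otimes> u" using comm_all[of u v] uv by simp
    with uv show False by simp
  qed
  have "y \<otimes> x \<notin> H"
  proof
    assume "y \<otimes> x \<in> H"
    then obtain j :: nat where "y \<otimes> x = x [^] j" by (auto simp: H_def)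
    then have "y = x [^] j \<otimes> inv x" using x y by (simp add: inv_solve_right)
    then have "y = x [^] (j + 3)" using x(1) by (simp only: ix nat_pow_mult)
    then show False using powH y by simp
  qed
  then obtain i :: nat where i: "i < 4" "y \<otimes> x = x [^] i \<otimes> y" using split[of "y \<otimes> x"] x y by auto
  have i3: "i = 3"
  proof -
    have "i \<noteq> 0"
    proof
      assume "i = 0"
      then have "y \<otimes> x = y \<otimes> \<one>" using i y by simp
      then have "x = \<one>" using x y by (subst (asm) l_cancel) auto
      then show False using x by simp
    qed
    moreover have "i \<noteq> 1" using i nc x by auto
    moreover have "i \<noteq> 2"
    proof
      assume "i = 2"
      then have yx: "y \<otimes> x = x \<otimes> x \<otimes> y" using i x by (simp add: nat_pow_2_3_4[OF is_group x(1)])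
      have "y \<otimes> (x \<otimes> x) = (y \<otimes> x) \<otimes> x" using x y by (simp add: m_assoc)
      also have "\<dots> = x \<otimes> x \<otimes> (y \<otimes> x)" unfolding yx using x y yx by (simp add: m_assoc)
      also have "\<dots> = x [^] (4::nat) \<otimes> y"
        unfolding yx nat_pow_2_3_4[OF is_group x(1)] using x y by (simp add: m_assoc)
      also have "\<dots> = y \<otimes> \<one>" using x4 y by simp
      finally have "x \<otimes> x = \<one>" using x y by (subst (asm) l_cancel) auto
      then show False using x by simp
    qed
    ultimately show ?thesis using i by simp
  qed
  have yx: "y \<otimes> x = inv x \<otimes> y" using i by (simp add: i3 ix)
  have "y \<otimes> y \<in> H"
  proof (rule ccontr)
    assume "y \<otimes> y \<notin> H"
    then obtain k :: nat where "y \<otimes> y = x [^] k \<otimes> y" using split[of "y \<otimes> y"] y by auto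
    then have "y = x [^] k" using x y by (subst (asm) r_cancel) auto
    then show False using powH y by simp
  qed
  then obtain j :: nat where j: "j < 4" "y \<otimes> y = x [^] j" by (auto simp: H_def)
  have yj: "y \<otimes> x [^] j = x [^] j \<otimes> y" unfolding j(2)[symmetric] using y by (simp add: m_assoc)
  have "j \<noteq> 1" using yj nc x by auto
  moreover have "j \<noteq> 3"
  proof
    assume "j = 3"
    then have "y \<otimes> inv x = inv x \<otimes> y" using yj by (simp add: ix)
    then have "y \<otimes> inv x = y \<otimes> x" using yx by simp
    then have "inv x = x" using x y by (subst (asm) l_cancel) auto
    then have "x \<otimes> x = \<one>" using x by (metis r_inv)
    then show False using x by simp
  qed
  ultimately have "j = 0 \<or> j = 2" using j by auto
  moreover have "dihedral_like G 4 j x y"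
    unfolding dihedral_like_def using x y ord x4 xpow powH j yx by auto
  ultimately show ?thesis by blast
qed

lemma pow_card_subgroup:
  assumes "subgroup P G" "g \<in> P"
  shows "g [^] card P = \<one>"
proof -
  interpret P: group "G\<lparr>carrier := P\<rparr>" using assms(1) by (rule subgroup_imp_group)
  have "g [^]\<^bsub>G\<lparr>carrier := P\<rparr>\<^esub> Coset.order (G\<lparr>carrier := P\<rparr>) = \<one>\<^bsub>G\<lparr>carrier := P\<rparr>\<^esub>"
    using assms by (intro P.pow_order_eq_1) simp
  then show ?thesis by (simp add: Coset.order_def nat_pow_consistent[symmetric])
qed

lemma prime_order_subgroup:
  assumes "Factorial_Ring.prime p" "p dvd Coset.order G"
  obtains P where "subgroup P G" "card P = p"
proof -
  obtain m where m: "Coset.order G = p ^ 1 * m" using assms(2) by auto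
  have "\<exists>H. subgroup H G \<and> card H = p ^ 1"
    using assms(1) by (intro sylow_thm[OF _ is_group m]) auto
  then show thesis using that by auto
qed

lemma involution_exists:
  assumes "even (Coset.order G)"
  obtains y where "y \<in> carrier G" "y \<noteq> \<one>" "y \<otimes> y = \<one>"
proof -
  obtain P where P: "subgroup P G" "card P = 2"
    using prime_order_subgroup[of 2] assms two_is_prime_nat by metis
  then obtain y where y: "y \<in> P" "y \<noteq> \<one>" by (metis card_2_iff')
  then have "y \<in> carrier G" using subgroup.mem_carrier[OF P(1)] by simp
  moreover have "y \<otimes> y = \<one>"
    using pow_card_subgroup[OF P(1) y(1)] calculation by (simp add: P(2) nat_pow_2_3_4[OF is_group])
  ultimately show thesis using that y by blast
qed

text \<open>The subgroup \<open>{\<one>} \<union> conj_class b\<close> has order \<open>3\<close> and is the centraliser of \<open>b\<close>.  An involution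
lies outside it, so it moves \<open>b\<close> to the only other element of the class, \<open>b\<^sup>-\<^sup>1\<close>.\<close>

lemma dihedral_like_order_6:
  assumes ord: "Coset.order G = 6" and b: "b \<in> carrier G" "b \<noteq> \<one>"
    and N: "subgroup (insert \<one> (conj_class b)) G" and c: "card (conj_class b) = 2"
    and cent: "card {x \<in> carrier G. b = x \<otimes> b \<otimes> inv x} = 3"
  shows "\<exists>x y. dihedral_like G 3 0 x y"
proof -
  let ?N = "insert \<one> (conj_class b)"
  have cN: "card ?N = 3" using c one_notin_conj_class[OF b] by simp
  have bN: "b \<in> ?N" using self_in_conj_class[OF b(1)] by simp
  have p3: "g [^] (3::nat) = \<one>" if "g \<in> ?N" for g using pow_card_subgroup[OF N that] cN by simp
  have b3: "b \<otimes> b \<otimes> b = \<one>" using p3[OF bN] b by (simp add: nat_pow_2_3_4[OF is_group])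
  have ib: "inv b = b \<otimes> b" using b b3 by (simp add: inv_equality)
  have bb1: "b \<otimes> b \<noteq> \<one>" using b b3 by auto
  have bb: "b \<otimes> b \<noteq> b" using b by (metis l_cancel_one r_cancel_one)
  have "inv b \<in> ?N" using subgroup.m_inv_closed[OF N bN] .
  then have ibc: "inv b \<in> conj_class b" using b by (auto simp: inv_eq_1_iff)
  have cls: "conj_class b = {b, inv b}"
    using self_in_conj_class[OF b(1)] ibc c bb ib
    by (intro card_subset_eq[symmetric]) auto
  obtain y where y: "y \<in> carrier G" "y \<noteq> \<one>" "y \<otimes> y = \<one>"
    using involution_exists ord by auto
  have yN: "y \<notin> ?N"
  proof
    assume "y \<in> ?N"
    then show False using p3[of y] y by (simp add: nat_pow_2_3_4[OF is_group])
  qed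
  \<comment> \<open>Otherwise the centraliser of \<open>b\<close> would contain the four elements \<open>y\<close>, \<open>\<one>\<close>, \<open>b\<close> and \<open>b\<^sup>-\<^sup>1\<close>.\<close>
  have "y \<otimes> b \<otimes> inv y \<noteq> b"
  proof
    let ?C = "{x \<in> carrier G. b = x \<otimes> b \<otimes> inv x}"
    assume "y \<otimes> b \<otimes> inv y = b"
    then have "y \<in> ?C" using y by simp
    moreover have "\<one> \<in> ?C" "b \<in> ?C" using b by (auto simp: m_assoc)
    moreover have "inv b \<in> ?C" using b by (auto simp: m_assoc)
    ultimately have "{y, \<one>, b, inv b} \<subseteq> ?C" by blast
    then have "card {y, \<one>, b, inv b} \<le> card ?C" by (intro card_mono) auto
    moreover have "card {y, \<one>, b, inv b} = 4"
      using yN b bb bb1 unfolding cls ib by auto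
    ultimately show False using cent by simp
  qed
  moreover have "y \<otimes> b \<otimes> inv y \<in> conj_class b" using y by (auto simp: conj_class_def)
  ultimately have "y \<otimes> b \<otimes> inv y = inv b" using cls by auto
  then have yb: "y \<otimes> b = inv b \<otimes> y" using y b by (metis inv_closed inv_solve_right' m_closed)
  have "dihedral_like G 3 0 b y"
    unfolding dihedral_like_def less_3_4_cases
  proof (intro conjI allI impI)
    show "b [^] k \<noteq> \<one>" if k: "0 < k \<and> (k = 0 \<or> k = 1 \<or> k = 2)" for k :: nat
      using k b bb1 by (auto simp: nat_pow_2_3_4[OF is_group])
    show "y \<noteq> b [^] k" if k: "k = 0 \<or> k = 1 \<or> k = 2" for k :: nat
      using k b yN by (auto simp: nat_pow_2_3_4[OF is_group] cls ib)
  qed (use b y ord yb b3 in \<open>auto simp: nat_pow_2_3_4[OF is_group]\<close>)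
  then show ?thesis by blast
qed

lemma dihedral_like_conj:
  assumes dl: "dihedral_like G n e x y" and b: "b \<in> carrier G"
    and bx: "x \<otimes> b = b \<otimes> x" and yb: "y \<otimes> b = b' \<otimes> y" and b': "b' \<in> carrier G" "x \<otimes> b' = b' \<otimes> x"
  shows "conj_class b = {b, b'}"
proof -
  note d = dihedral_likeD[OF dl]
  have p: "x [^] k \<otimes> z \<otimes> inv (x [^] k) = z" if "z \<in> carrier G" "x \<otimes> z = z \<otimes> x" for z and k :: nat
    using group_commutes_pow[of x z k] that d(1) by (simp add: m_assoc)
  have y1: "y \<otimes> b \<otimes> inv y = b'" using d(2) b b'(1) by (simp add: yb m_assoc)
  have "g \<otimes> b \<otimes> inv g \<in> {b, b'}" if g: "g \<in> carrier G" for g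
  proof -
    have "g \<in> dihedral_word G x y ` ({..<n} \<times> UNIV)"
      using dihedral_word_bij[OF dl] g by (simp add: bij_betw_def)
    then obtain a s where as: "g = dihedral_word G x y (a, s)" by auto
    show ?thesis
    proof (cases s)
      case True
      have "g \<otimes> b \<otimes> inv g = x [^] a \<otimes> (y \<otimes> b \<otimes> inv y) \<otimes> inv (x [^] a)"
        using True b d(1,2) by (simp add: as dihedral_word_def conj_conj)
      also have "\<dots> = b'" unfolding y1 using p[OF b'] by simp
      finally show ?thesis by simp
    next
      case False
      then show ?thesis using p[OF b bx] d(1) by (simp add: as dihedral_word_def)
    qed
  qed
  moreover have "b' \<in> conj_class b" unfolding conj_class_def using d(2) y1 by (intro image_eqI[of _ _ y]) auto
  ultimately show ?thesis using self_in_conj_class[OF b] by (auto simp: conj_class_def)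
qed

text \<open>The rotation \<open>x\<close> is the commutator \<open>y x y\<^sup>-\<^sup>1 x\<^sup>-\<^sup>1 = x\<^sup>-\<^sup>2\<close>, and its class consists of \<open>x\<close> and \<open>x\<^sup>-\<^sup>1\<close>.\<close>

lemma CD1_dihedral_like_3:
  assumes dl: "dihedral_like G 3 0 x y"
  shows "CD1_group G" "max_irr_degree G = 2"
proof -
  note d = dihedral_likeD[OF dl]
  have x3: "x \<otimes> x \<otimes> x = \<one>" using d(1,5) by (simp add: nat_pow_2_3_4[OF is_group])
  have ix: "inv x = x \<otimes> x" using d(1) x3 by (simp add: inv_equality)
  have x1: "x \<noteq> \<one>" using d(1) d(6)[of 1] by simp
  have xx: "x \<otimes> x \<noteq> x" using d(1) x1 by (metis l_cancel_one r_cancel_one)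
  have cls: "conj_class x = {x, inv x}"
    by (rule dihedral_like_conj[OF dl]) (use d in auto)
  have card: "card (conj_class x) = 2" unfolding cls ix using xx by simp
  have sub: "subgroup (insert \<one> (conj_class x)) G"
    unfolding cls using d(1) x3 ix inv_inv[OF d(1)] by (intro subgroupI) (auto simp: m_assoc[symmetric])
  have "y \<otimes> x = x \<otimes> (x \<otimes> y)" using d(1,2,9) by (simp add: ix m_assoc)
  then have "2 \<le> char_degree \<chi>" if "\<chi> \<in> Irr G" "\<chi> x \<noteq> \<chi> \<one>" for \<chi>
    using degree_ge_2_if_commutator[OF that(1) d(2,1,1) _ that(2)] by simp
  from CD1_criterion[OF d(1) x1 sub _ _ this] show "CD1_group G" "max_irr_degree G = 2"
    using d(4) by (simp_all add: card)
qed

text \<open>The central involution \<open>x\<^sup>2\<close> is the commutator \<open>y x y\<^sup>-\<^sup>1 x\<^sup>-\<^sup>1 = x\<^sup>-\<^sup>2\<close>.\<close>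

lemma CD1_dihedral_like_4:
  assumes dl: "dihedral_like G 4 e x y"
  shows "CD1_group G" "max_irr_degree G = 2"
proof -
  note d = dihedral_likeD[OF dl]
  define b where "b = x \<otimes> x"
  have b: "b \<in> carrier G" using d(1) by (simp add: b_def)
  have b1: "b \<noteq> \<one>" using d(1) d(6)[of 2] by (simp add: b_def nat_pow_2_3_4[OF is_group])
  have bb: "b \<otimes> b = \<one>" using d(1,5) by (simp add: b_def nat_pow_2_3_4[OF is_group] m_assoc)
  have ib: "inv b = b" using b bb by (simp add: inv_equality)
  have yb: "y \<otimes> b = b \<otimes> y"
    using reflection_times_pow[OF dl, of 2] d(1) ib by (simp add: b_def nat_pow_2_3_4[OF is_group])
  have "conj_class b = {b, b}"
    by (rule dihedral_like_conj[OF dl]) (use d(1) b yb in \<open>auto simp: b_def m_assoc\<close>)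
  then have cls: "conj_class b = {b}" by simp
  have sub: "subgroup (insert \<one> (conj_class b)) G"
    unfolding cls by (rule subgroup_involution[OF b bb])
  have "y \<otimes> x = b \<otimes> (x \<otimes> y)"
  proof -
    have "inv x = b \<otimes> x"
      using d(1) bb by (intro inv_equality) (auto simp: b_def m_assoc)
    then show ?thesis using d(1,2,9) b by (simp add: m_assoc)
  qed
  then have "2 \<le> char_degree \<chi>" if "\<chi> \<in> Irr G" "\<chi> b \<noteq> \<chi> \<one>" for \<chi>
    using degree_ge_2_if_commutator[OF that(1) d(2,1) b _ that(2)] by simp
  from CD1_criterion[OF b b1 sub _ _ this] show "CD1_group G" "max_irr_degree G = 2"
    using d(4) by (simp_all add: cls)
qed

end

section \<open>Doubly transitive Frobenius groups\<close>

lemma power_of_two_if_only_prime_divisor: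
  "(m :: nat) > 0 \<Longrightarrow> (\<And>q. Factorial_Ring.prime q \<Longrightarrow> q dvd m \<Longrightarrow> q = 2) \<Longrightarrow> \<exists>n. m = 2 ^ n"
proof (induction m rule: less_induct)
  case (less m)
  show ?case
  proof (cases "m = 1")
    case True
    then have "m = 2 ^ 0" by simp
    then show ?thesis by blast
  next
    case False
    then obtain q where q: "Factorial_Ring.prime q" "q dvd m" using prime_factor_nat by blast
    then obtain k where k: "m = 2 * k" using less.prems(2)[OF q] by auto
    have "\<exists>n. k = 2 ^ n"
    proof (rule less.IH)
      show "q = 2" if "Factorial_Ring.prime q" "q dvd k" for q
        using that by (intro less.prems(2)) (auto simp: k)
    qed (use k less.prems in auto)
    then show ?thesis using k by (metis power_Suc)
  qed
qed

context finite_group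
begin

lemma conj_pow:
  assumes "g \<in> carrier G" "k \<in> carrier G"
  shows "(g \<otimes> k \<otimes> inv g) [^] (m :: nat) = g \<otimes> k [^] m \<otimes> inv g"
proof (induction m)
  case (Suc m)
  have "(g \<otimes> k \<otimes> inv g) [^] Suc m = (g \<otimes> k [^] m \<otimes> inv g) \<otimes> (g \<otimes> k \<otimes> inv g)"
    using Suc by simp
  also have "\<dots> = g \<otimes> k [^] m \<otimes> ((inv g \<otimes> g) \<otimes> (k \<otimes> inv g))"
    using assms by (simp only: m_assoc m_closed inv_closed nat_pow_closed)
  also have "\<dots> = g \<otimes> k [^] Suc m \<otimes> inv g"
    using assms by (simp add: m_assoc)
  finally show ?case .
qed (use assms in simp)

lemma cancel_inv_left:
  "g \<in> carrier G \<Longrightarrow> z \<in> carrier G \<Longrightarrow> inv g \<otimes> (g \<otimes> z) = z"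
  "g \<in> carrier G \<Longrightarrow> z \<in> carrier G \<Longrightarrow> g \<otimes> (inv g \<otimes> z) = z"
  by (simp_all flip: m_assoc)

lemma pow_coprime_eq_one:
  assumes "x \<in> carrier G" "x [^] (m :: nat) = \<one>" "x [^] (k :: nat) = \<one>" "coprime m k"
  shows "x = \<one>"
proof -
  have "ord x dvd m" "ord x dvd k" using assms(1-3) pow_eq_id by blast+
  then have "ord x = 1" using assms(4) by (metis coprime_common_divisor_nat)
  then show ?thesis using pow_ord_eq_1[OF assms(1)] assms(1) by simp
qed

lemma mem_conjugate_subset_iff:
  "y \<in> conjugate_subset G g H \<longleftrightarrow> (\<exists>k\<in>H. y = g \<otimes> k \<otimes> inv g)"
  by (auto simp: conjugate_subset_def)

lemma conj_move:
  assumes "g \<in> carrier G" "k \<in> carrier G" "y \<in> carrier G"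
  shows "y = g \<otimes> k \<otimes> inv g \<longleftrightarrow> k = inv g \<otimes> y \<otimes> g"
proof
  assume "y = g \<otimes> k \<otimes> inv g"
  then show "k = inv g \<otimes> y \<otimes> g" using conj_inv_cancel[OF assms(1,2)] by simp
next
  assume "k = inv g \<otimes> y \<otimes> g"
  then show "y = g \<otimes> k \<otimes> inv g" using conj_inv_cancel[of "inv g" y] assms by simp
qed

text \<open>The subgroup contains an involution, and all its nontrivial elements are conjugate in \<open>G\<close>.\<close>

lemma elementary_abelian_2_if_conj_class:
  assumes b: "b \<in> carrier G" "b \<noteq> \<one>" and N: "subgroup (insert \<one> (conj_class b)) G"
    and even: "even (card (insert \<one> (conj_class b)))" and z: "z \<in> insert \<one> (conj_class b)"
  shows "z \<otimes> z = \<one>"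
proof -
  let ?N = "insert \<one> (conj_class b)"
  interpret N: group "G\<lparr>carrier := ?N\<rparr>" using N by (rule subgroup_imp_group)
  interpret N: finite_group "G\<lparr>carrier := ?N\<rparr>" by unfold_locales simp
  obtain y where y: "y \<in> ?N" "y \<noteq> \<one>" "y \<otimes> y = \<one>"
    using N.involution_exists even by (auto simp: Coset.order_def)
  have yG: "y \<in> carrier G" using y(1) conj_class_closed[OF b(1)] by auto
  have "b \<in> conj_class y" using y conj_class_sym[OF b(1)] by auto
  then obtain g where g: "g \<in> carrier G" "b = g \<otimes> y \<otimes> inv g" by (auto simp: conj_class_def)
  have sq: "w [^] (2::nat) = w \<otimes> w" if "w \<in> carrier G" for w
    using that by (simp add: nat_pow_2_3_4[OF is_group])
  have bb: "b [^] (2::nat) = \<one>" using conj_pow[OF g(1) yG, of 2] y(3) yG g by (simp add: sq)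
  show ?thesis
  proof (cases "z = \<one>")
    case False
    then obtain h where h: "h \<in> carrier G" "z = h \<otimes> b \<otimes> inv h" using z by (auto simp: conj_class_def)
    then have "z [^] (2::nat) = \<one>" using conj_pow[OF h(1) b(1), of 2] bb h by simp
    then show ?thesis using sq h b by simp
  qed simp
qed

text \<open>An odd prime divisor of the order would give an element of odd prime order.\<close>

lemma power_of_two_order_if_exponent_2:
  assumes N: "subgroup N G" and sq: "\<And>z. z \<in> N \<Longrightarrow> z \<otimes> z = \<one>"
  shows "\<exists>n. card N = 2 ^ n"
proof (rule power_of_two_if_only_prime_divisor)
  have NG: "N \<subseteq> carrier G" using N by (rule subgroup.subset)
  then have finN: "finite N" using finite_subset by auto
  then show "card N > 0" using subgroup.one_closed[OF N] by (auto simp: card_gt_0_iff)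
  interpret N: group "G\<lparr>carrier := N\<rparr>" using N by (rule subgroup_imp_group)
  interpret N: finite_group "G\<lparr>carrier := N\<rparr>" by unfold_locales (simp add: finN)
  fix q :: nat assume q: "Factorial_Ring.prime q" "q dvd card N"
  obtain P where P: "subgroup P (G\<lparr>carrier := N\<rparr>)" "card P = q"
    using N.prime_order_subgroup[of q] q by (auto simp: Coset.order_def)
  have PG: "subgroup P G" by (rule incl_subgroup[OF N P(1)])
  have "P \<noteq> {\<one>}" using P(2) q(1) by (auto simp: prime_nat_iff)
  then obtain z where z: "z \<in> P" "z \<noteq> \<one>" using subgroup.one_closed[OF PG] by blast
  have zN: "z \<in> N" using z(1) subgroup.subset[OF P(1)] by auto
  have zG: "z \<in> carrier G" using zN NG by auto
  have "z [^] q = \<one>" using pow_card_subgroup[OF PG z(1)] P(2) by simp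
  moreover have "z [^] (2::nat) = \<one>" using sq[OF zN] zG by (simp add: nat_pow_2_3_4[OF is_group])
  ultimately have "\<not> coprime q 2" using pow_coprime_eq_one[OF zG] z(2) by blast
  then show "q = 2" using q(1) primes_coprime[OF q(1) two_is_prime_nat] by auto
qed

text \<open>Let \<open>K\<close> be the subgroup \<open>{\<one>} \<union> conj_class b\<close> and \<open>H\<close> a subgroup of order \<open>r\<close>.  As \<open>K\<close> is abelian
and its order is that of the centraliser of \<open>b\<close>, it equals this centraliser, and no nontrivial
element of \<open>H\<close> commutes with a nontrivial element of \<open>K\<close>.  If \<open>h = n k n\<^sup>-\<^sup>1\<close> with \<open>h\<close>, \<open>k\<close> in \<open>H\<close> and
\<open>n\<close> in \<open>K\<close>, then \<open>h k\<^sup>-\<^sup>1\<close> lies in \<open>H \<inter> K = {\<one>}\<close>, so \<open>h = k\<close> commutes with \<open>n\<close> and one of \<open>n\<close>, \<open>k\<close>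
is \<open>\<one>\<close>.  Since \<open>G = K H\<close>, this makes \<open>H\<close> a Frobenius complement.  It also makes the
\<open>(r + 1) (r - 1)\<close> elements \<open>n h n\<^sup>-\<^sup>1\<close> with \<open>h \<noteq> \<one>\<close> distinct, so the kernel has at most \<open>r + 1\<close>
elements; it contains \<open>K\<close>.\<close>

theorem doubly_transitive_frobenius_if_one_class:
  assumes r: "Factorial_Ring.prime r" "odd r"
    and b: "b \<in> carrier G" "b \<noteq> \<one>" and N: "subgroup (insert \<one> (conj_class b)) G"
    and c: "card (conj_class b) = r" and ord: "Coset.order G = r * Suc r"
    and cent: "card {x \<in> carrier G. b = x \<otimes> b \<otimes> inv x} = Suc r"
  shows "doubly_transitive_frobenius_group G" "\<exists>n. Suc r = 2 ^ n"
proof -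
  define K where "K = insert \<one> (conj_class b)"
  have K: "subgroup K G" using N by (simp add: K_def)
  note Km = subgroup.m_closed[OF K] and Ki = subgroup.m_inv_closed[OF K]
  have KG: "z \<in> carrier G" if "z \<in> K" for z using subgroup.mem_carrier[OF K that] .
  have finK: "finite K" by (simp add: K_def)
  have cK: "card K = Suc r" using one_notin_conj_class[OF b] c by (simp add: K_def)
  have r1: "r > 1" using r(1) by (simp add: prime_nat_iff)
  have sq: "z \<otimes> z = \<one>" if "z \<in> K" for z
    using elementary_abelian_2_if_conj_class[OF b N] that r(2) cK by (simp add: K_def)
  show "\<exists>n. Suc r = 2 ^ n" using power_of_two_order_if_exponent_2[OF K sq] cK by simp
  have Kconj: "g \<otimes> z \<otimes> inv g \<in> K" if "g \<in> carrier G" "z \<in> K" for g z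
    using that conj_class_conj[OF b(1)] by (auto simp: K_def)
  have Kconj': "inv g \<otimes> z \<otimes> g \<in> K" if "g \<in> carrier G" "z \<in> K" for g z
    using Kconj[of "inv g" z] that by simp
  have Kcomm: "z \<otimes> w = w \<otimes> z" if "z \<in> K" "w \<in> K" for z w
  proof -
    have i: "inv u = u" if "u \<in> K" for u using sq[OF that] KG[OF that] by (simp add: inv_equality)
    have "z \<otimes> w = inv (z \<otimes> w)" using i[OF Km[OF that]] by simp
    also have "\<dots> = inv w \<otimes> inv z" using that KG by (intro inv_mult_group) auto
    also have "\<dots> = w \<otimes> z" using that by (simp only: i)
    finally show ?thesis .
  qed
  have bK: "b \<in> K" using self_in_conj_class[OF b(1)] by (simp add: K_def)
  have centK: "{x \<in> carrier G. b = x \<otimes> b \<otimes> inv x} = K"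
  proof (rule card_subset_eq[symmetric])
    show "K \<subseteq> {x \<in> carrier G. b = x \<otimes> b \<otimes> inv x}"
    proof
      fix z assume z: "z \<in> K"
      have "z \<otimes> b \<otimes> inv z = b \<otimes> (z \<otimes> inv z)"
        using Kcomm[OF z bK] KG[OF z] b by (simp add: m_assoc)
      then show "z \<in> {x \<in> carrier G. b = x \<otimes> b \<otimes> inv x}" using KG[OF z] b by simp
    qed
  qed (use cent cK in auto)
  obtain H where H: "subgroup H G" "card H = r"
    using prime_order_subgroup[OF r(1)] ord by auto
  note Hm = subgroup.m_closed[OF H(1)] and Hi = subgroup.m_inv_closed[OF H(1)]
  have HG: "z \<in> carrier G" if "z \<in> H" for z using subgroup.mem_carrier[OF H(1) that] .
  have finH: "finite H" using H r1 by (metis card.infinite not_one_less_zero)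
  have HK: "z = \<one>" if "z \<in> H" "z \<in> K" for z
  proof (rule pow_coprime_eq_one)
    show "z [^] r = \<one>" using pow_card_subgroup[OF H(1) that(1)] H(2) by simp
    show "z [^] Suc r = \<one>" using pow_card_subgroup[OF K that(2)] cK by simp
  qed (use that HG in auto)
  have nocomm: "k = \<one>" if km: "k \<in> H" "m \<in> K" "m \<noteq> \<one>" "k \<otimes> m = m \<otimes> k" for k m
  proof -
    obtain g where g: "g \<in> carrier G" "m = g \<otimes> b \<otimes> inv g"
      using km by (auto simp: K_def conj_class_def)
    let ?k = "inv g \<otimes> k \<otimes> g"
    have kG: "k \<in> carrier G" using km HG by auto
    have bm: "b = inv g \<otimes> m \<otimes> g" using conj_inv_cancel[OF g(1) b(1)] by (simp add: g(2))
    have mG: "m \<in> carrier G" using km KG by auto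
    have "?k \<otimes> b \<otimes> inv ?k = inv g \<otimes> (k \<otimes> m \<otimes> inv k) \<otimes> g"
      unfolding bm using g(1) kG mG by (simp add: inv_mult_group m_assoc cancel_inv_left)
    also have "k \<otimes> m \<otimes> inv k = m" using km kG mG by (simp add: m_assoc)
    also have "inv g \<otimes> m \<otimes> g = b" by (rule bm[symmetric])
    finally have "?k \<otimes> b \<otimes> inv ?k = b" .
    then have "?k \<in> {x \<in> carrier G. b = x \<otimes> b \<otimes> inv x}" using g(1) kG by simp
    then have "?k \<in> K" unfolding centK .
    then have "g \<otimes> ?k \<otimes> inv g \<in> K" by (rule Kconj[OF g(1)])
    then have "k \<in> K" using conj_inv_cancel[of "inv g" k] g kG by simp
    then show ?thesis using HK km by simp
  qed
  have key: "h = k \<and> (n = \<one> \<or> k = \<one>)" if n: "n \<in> K" and hk: "h \<in> H" "k \<in> H" and eq: "h = n \<otimes> k \<otimes> inv n" for n h k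
  proof -
    note G = KG[OF n] HG[OF hk(1)] HG[OF hk(2)]
    have "h \<otimes> inv k = n \<otimes> (k \<otimes> inv n \<otimes> inv k)" using G by (simp add: eq m_assoc)
    then have "h \<otimes> inv k \<in> K" using Km[OF n Kconj[OF G(3) Ki[OF n]]] by simp
    then have "h \<otimes> inv k = \<one>" using HK Hm[OF hk(1) Hi[OF hk(2)]] by blast
    then have hk': "h = k" using G by (metis inv_closed inv_equality inv_inv)
    then have "k \<otimes> n = n \<otimes> k" using eq G by (metis inv_solve_right' m_closed)
    then show ?thesis using nocomm[OF hk(2) n] hk' by blast
  qed
  have factor: "\<exists>n\<in>K. \<exists>h\<in>H. g = n \<otimes> h" if g: "g \<in> carrier G" for g
  proof -
    let ?f = "\<lambda>(n, h). n \<otimes> h"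
    have inj: "inj_on ?f (K \<times> H)"
    proof (rule inj_onI, clarify)
      fix n h n' h' assume *: "n \<in> K" "h \<in> H" "n' \<in> K" "h' \<in> H" "n \<otimes> h = n' \<otimes> h'"
      note G = KG[OF *(1)] HG[OF *(2)] KG[OF *(3)] HG[OF *(4)]
      have "inv n' \<otimes> n = h' \<otimes> inv h"
      proof -
        have "n = n' \<otimes> h' \<otimes> inv h" using * G by (metis inv_solve_right m_closed)
        then show ?thesis using G by (simp add: m_assoc inv_solve_left')
      qed
      moreover have "inv n' \<otimes> n \<in> K" "h' \<otimes> inv h \<in> H" using * Km Ki Hm Hi by auto
      ultimately have 1: "inv n' \<otimes> n = \<one>" "h' \<otimes> inv h = \<one>" using HK by auto
      then have "n = n'" using G by (metis inv_closed inv_equality inv_inv inv_comm)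
      moreover have "h = h'" using 1 G by (metis inv_closed inv_equality inv_inv)
      ultimately show "n = n' \<and> h = h'" by simp
    qed
    have "?f ` (K \<times> H) = carrier G"
    proof (rule card_subset_eq)
      show "card (?f ` (K \<times> H)) = card (carrier G)"
        using ord by (simp add: card_image[OF inj] card_cartesian_product cK H(2) Coset.order_def mult.commute)
    qed (use KG HG in auto)
    then show ?thesis using g by force
  qed
  have one_conj: "\<one> \<in> conjugate_subset G g H" if "g \<in> carrier G" for g
    unfolding mem_conjugate_subset_iff using that subgroup.one_closed[OF H(1)] by (intro bexI[of _ \<one>]) auto
  have comp: "frobenius_complement G H"
    unfolding frobenius_complement_def
  proof (intro conjI ballI)
    show "subgroup H G" by (rule H)
    show "H \<noteq> {\<one>}" using H(2) r1 by auto
    show "H \<noteq> carrier G" using H(2) ord r1 by (auto simp: Coset.order_def)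
    fix g assume g: "g \<in> carrier G - H"
    have "h = \<one>" if h: "h \<in> H" "h \<in> conjugate_subset G g H" for h
    proof -
      obtain k where k: "k \<in> H" "h = g \<otimes> k \<otimes> inv g" using h(2) by (auto simp: mem_conjugate_subset_iff)
      obtain n h1 where nh: "n \<in> K" "h1 \<in> H" "g = n \<otimes> h1" using factor g by blast
      have "h = n \<otimes> (h1 \<otimes> k \<otimes> inv h1) \<otimes> inv n"
        unfolding k(2) nh(3) using KG[OF nh(1)] HG[OF nh(2)] HG[OF k(1)] by (rule conj_conj[symmetric])
      from key[OF nh(1) h(1) _ this]
      have "n = \<one> \<or> h1 \<otimes> k \<otimes> inv h1 = \<one>" "h = h1 \<otimes> k \<otimes> inv h1"
        using Hm[OF Hm[OF nh(2) k(1)] Hi[OF nh(2)]] by auto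
      moreover have "n \<noteq> \<one>" using g nh HG by auto
      ultimately show ?thesis by blast
    qed
    then show "H \<inter> conjugate_subset G g H = {\<one>}"
      using one_conj g subgroup.one_closed[OF H(1)] by blast
  qed
  have "card (frobenius_kernel G H) = Suc r"
  proof (rule antisym)
    let ?Z = "frobenius_kernel G H" and ?f = "\<lambda>(n, h). n \<otimes> h \<otimes> inv n"
    have finZ: "finite ?Z" by (simp add: frobenius_kernel_def)
    have "K \<subseteq> ?Z"
    proof
      fix z assume z: "z \<in> K"
      have "z = \<one>" if gz: "g \<in> carrier G" "z \<in> conjugate_subset G g H" for g
      proof -
        obtain k where k: "k \<in> H" "z = g \<otimes> k \<otimes> inv g" using gz(2) unfolding mem_conjugate_subset_iff by blast
        then have "k = inv g \<otimes> z \<otimes> g" using conj_move[OF gz(1) HG[OF k(1)] KG[OF z]] by simp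
        then have "k \<in> K" using Kconj'[OF gz(1) z] by simp
        then have "k = \<one>" using HK k(1) by simp
        then show ?thesis using k(2) gz(1) by simp
      qed
      then show "z \<in> ?Z" using KG[OF z] by (auto simp: frobenius_kernel_def)
    qed
    then show "Suc r \<le> card ?Z" using card_mono[OF finZ] cK by metis
    have inj: "inj_on ?f (K \<times> (H - {\<one>}))"
    proof (rule inj_onI)
      fix p q assume pq: "p \<in> K \<times> (H - {\<one>})" "q \<in> K \<times> (H - {\<one>})" "?f p = ?f q"
      obtain n h where p: "p = (n, h)" "n \<in> K" "h \<in> H" "h \<noteq> \<one>" using pq(1) by auto
      obtain n' h' where q: "q = (n', h')" "n' \<in> K" "h' \<in> H" using pq(2) by auto
      have eq: "n \<otimes> h \<otimes> inv n = n' \<otimes> h' \<otimes> inv n'" using pq(3) p q by simp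
      note * = p(2-4) q(2,3)
      note G = KG[OF *(1)] HG[OF *(2)] KG[OF *(4)] HG[OF *(5)]
      have "h' = inv n' \<otimes> (n \<otimes> h \<otimes> inv n) \<otimes> inv (inv n')"
        unfolding eq using conj_inv_cancel[OF G(3,4)] G by simp
      also have "\<dots> = (inv n' \<otimes> n) \<otimes> h \<otimes> inv (inv n' \<otimes> n)" using G by (intro conj_conj) auto
      finally have "h' = h" "inv n' \<otimes> n = \<one>" using key[of "inv n' \<otimes> n" h' h] * Km Ki by auto
      moreover have "n = n'" using calculation(2) G by (metis inv_closed inv_equality inv_inv inv_comm)
      ultimately show "p = q" using p q by simp
    qed
    let ?I = "?f ` (K \<times> (H - {\<one>}))"
    have cI: "card ?I = Suc r * (r - 1)"
      using subgroup.one_closed[OF H(1)] finH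
      by (simp add: card_image[OF inj] card_cartesian_product cK H(2))
    have IG: "?I \<subseteq> carrier G" using KG HG by auto
    have "?Z \<subseteq> carrier G - ?I"
    proof
      fix z assume z: "z \<in> ?Z"
      have "z \<notin> ?I"
      proof
        assume "z \<in> ?I"
        then obtain n h where nh: "n \<in> K" "h \<in> H" "h \<noteq> \<one>" "z = n \<otimes> h \<otimes> inv n" by auto
        then have "z \<in> conjugate_subset G n H" by (auto simp: mem_conjugate_subset_iff)
        then have "z = \<one>" using z KG[OF nh(1)] by (auto simp: frobenius_kernel_def)
        then show False using nh KG HG conj_one_iff by metis
      qed
      then show "z \<in> carrier G - ?I" using z by (auto simp: frobenius_kernel_def)
    qed
    then have "card ?Z \<le> card (carrier G - ?I)" by (intro card_mono) auto
    also have "\<dots> = r * Suc r - Suc r * (r - 1)"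
      using card_Diff_subset[of ?I "carrier G"] IG cI ord finK finH by (simp add: Coset.order_def)
    also have "\<dots> = Suc r" using r1 by (cases r) auto
    finally show "card ?Z \<le> Suc r" .
  qed
  then show "doubly_transitive_frobenius_group G"
    unfolding doubly_transitive_frobenius_group_def using comp H(2) by auto
qed

text \<open>The map \<open>(g, k) \<mapsto> g k g\<^sup>-\<^sup>1\<close>, defined for \<open>k \<noteq> \<one>\<close> in \<open>H\<close>, hits exactly the elements outside the
kernel.  Its fibres are \<open>{(g t, t\<^sup>-\<^sup>1 k t) | t \<in> H}\<close> by the complement property, so
they have \<open>|H|\<close> elements, and \<open>|H| (|G| - |kernel|) = |G| (|H| - 1)\<close>.\<close>

lemma frobenius_kernel_count:
  assumes comp: "frobenius_complement G H"
  shows "card H * card (frobenius_kernel G H) = Coset.order G"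
proof -
  have H: "subgroup H G" and disj: "\<And>g. g \<in> carrier G - H \<Longrightarrow> H \<inter> conjugate_subset G g H = {\<one>}"
    using comp by (auto simp: frobenius_complement_def)
  note Hm = subgroup.m_closed[OF H] and Hi = subgroup.m_inv_closed[OF H]
  have HG: "z \<in> carrier G" if "z \<in> H" for z using subgroup.mem_carrier[OF H that] .
  have finH: "finite H" using finite_subset[OF subgroup.subset[OF H]] by simp
  define U where "U = (\<Union>g\<in>carrier G. conjugate_subset G g H) - {\<one>}"
  have UG: "U \<subseteq> carrier G" using HG by (auto simp: U_def mem_conjugate_subset_iff)
  let ?A = "carrier G \<times> (H - {\<one>})" and ?f = "\<lambda>(g, k). g \<otimes> k \<otimes> inv g"
  have fib: "card {p \<in> ?A. ?f p = y} = card H" if y: "y \<in> U" for y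
  proof -
    obtain g k where gk: "g \<in> carrier G" "k \<in> H" "y = g \<otimes> k \<otimes> inv g" "y \<noteq> \<one>"
      using y by (auto simp: U_def mem_conjugate_subset_iff)
    have k1: "k \<noteq> \<one>" using gk by auto
    let ?h = "\<lambda>t. (g \<otimes> t, inv t \<otimes> k \<otimes> t)"
    have "{p \<in> ?A. ?f p = y} = ?h ` H"
    proof (rule equalityI; rule subsetI)
      fix p assume "p \<in> {p \<in> ?A. ?f p = y}"
      then obtain g' k' where p: "p = (g', k')" "g' \<in> carrier G" "k' \<in> H" "k' \<noteq> \<one>"
        "g' \<otimes> k' \<otimes> inv g' = y" by auto
      define t where "t = inv g \<otimes> g'"
      have t: "t \<in> carrier G" using gk p by (simp add: t_def)
      have g': "g' = g \<otimes> t" using gk(1) p(2) by (simp add: t_def flip: m_assoc)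
      have "k = inv g \<otimes> y \<otimes> inv (inv g)" using conj_inv_cancel[OF gk(1) HG[OF gk(2)]] gk by simp
      also have "\<dots> = t \<otimes> k' \<otimes> inv t"
        unfolding p(5)[symmetric] t_def using gk(1) p(2) HG[OF p(3)] by (intro conj_conj) auto
      finally have kt: "k = t \<otimes> k' \<otimes> inv t" .
      then have "k \<in> conjugate_subset G t H" using p(3) by (auto simp: mem_conjugate_subset_iff)
      then have tH: "t \<in> H" using disj[of t] t gk(2) k1 by blast
      have "k' = inv t \<otimes> k \<otimes> t" using kt conj_move[OF t HG[OF p(3)] HG[OF gk(2)]] by simp
      then show "p \<in> ?h ` H" using tH p(1) g' by blast
    next
      fix p assume "p \<in> ?h ` H"
      then obtain t where t: "t \<in> H" "p = (g \<otimes> t, inv t \<otimes> k \<otimes> t)" by blast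
      let ?k = "inv t \<otimes> k \<otimes> t"
      have kH: "?k \<in> H" using t gk Hm Hi by blast
      have kt: "k = t \<otimes> ?k \<otimes> inv t"
        using conj_move[OF HG[OF t(1)] HG[OF kH] HG[OF gk(2)]] by simp
      have "y = (g \<otimes> t) \<otimes> ?k \<otimes> inv (g \<otimes> t)"
        using conj_conj[OF gk(1) HG[OF t(1)] HG[OF kH]] kt gk(3) by simp
      moreover have "?k \<noteq> \<one>" using kt k1 HG[OF t(1)] by auto
      ultimately show "p \<in> {p \<in> ?A. ?f p = y}" using kH t gk HG by auto
    qed
    moreover have "inj_on ?h H" using gk(1) HG by (auto intro!: inj_onI)
    ultimately show ?thesis by (simp add: card_image)
  qed
  have "(\<Sum>y\<in>U. \<Sum>p\<in>{p \<in> ?A. ?f p = y}. 1) = (\<Sum>p\<in>?A. (1::nat))"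
  proof (rule sum.group)
    show "?f ` ?A \<subseteq> U"
    proof
      fix y assume "y \<in> ?f ` ?A"
      then obtain g k where gk: "g \<in> carrier G" "k \<in> H" "k \<noteq> \<one>" "y = g \<otimes> k \<otimes> inv g" by auto
      then have "y \<noteq> \<one>" using conj_one_iff[OF HG[OF gk(2)] gk(1)] by simp
      then show "y \<in> U" using gk by (auto simp: U_def mem_conjugate_subset_iff)
    qed
  qed (use finH UG finite_subset in auto)
  then have cU: "card U * card H = Coset.order G * (card H - 1)"
    using fib subgroup.one_closed[OF H] finH
    by (simp add: card_cartesian_product Coset.order_def)
  have "frobenius_kernel G H = carrier G - U"
    by (auto simp: frobenius_kernel_def U_def)
  then have "card (frobenius_kernel G H) = Coset.order G - card U"
    using UG by (simp add: card_Diff_subset finite_subset Coset.order_def)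
  moreover have "card H > 0" using subgroup.one_closed[OF H] finH by (auto simp: card_gt_0_iff)
  ultimately show ?thesis
    using cU by (simp add: diff_mult_distrib2 mult.commute)
qed

text \<open>Counting the kernel \<open>K\<close> gives \<open>|H| = r\<close> and \<open>|K| = r + 1\<close>.  The elements outside \<open>K\<close> have order
\<open>r\<close>, so \<open>K\<close> contains a Sylow \<open>2\<close>-subgroup and coincides with it; this makes \<open>K\<close> a normal subgroup
without an appeal to Frobenius' theorem.  Distinct elements of \<open>H\<close> move an involution \<open>b\<close> of \<open>K\<close>
to distinct elements, so the nontrivial elements of \<open>K\<close> form the class of \<open>b\<close>.\<close>

theorem CD1_if_doubly_transitive_frobenius:
  assumes dt: "doubly_transitive_frobenius_group G"
    and r: "Factorial_Ring.prime r" "Suc r = 2 ^ n" and ord: "Coset.order G = r * Suc r"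
  shows "CD1_group G" "max_irr_degree G = real r"
proof -
  obtain H where comp: "frobenius_complement G H" and cH': "card H = card (frobenius_kernel G H) - 1"
    using dt by (auto simp: doubly_transitive_frobenius_group_def)
  have H: "subgroup H G" and disj: "\<And>g. g \<in> carrier G - H \<Longrightarrow> H \<inter> conjugate_subset G g H = {\<one>}"
    using comp by (auto simp: frobenius_complement_def)
  note Hm = subgroup.m_closed[OF H] and Hi = subgroup.m_inv_closed[OF H]
  have HG: "z \<in> carrier G" if "z \<in> H" for z using subgroup.mem_carrier[OF H that] .
  define K where "K = frobenius_kernel G H"
  define U where "U = (\<Union>g\<in>carrier G. conjugate_subset G g H) - {\<one>}"
  have KU: "K = carrier G - U" by (auto simp: K_def frobenius_kernel_def U_def)
  have r1: "r > 1" using r(1) by (simp add: prime_nat_iff)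
  have n: "n > 0" using r(2) r1 by (cases n) auto
  then have "even (Suc r)" using r(2) by simp
  then have odd: "odd r" by simp
  have cHK: "card H * card K = r * Suc r" using frobenius_kernel_count[OF comp] ord by (simp add: K_def)
  then have "card H * Suc (card H) = r * Suc r"
    using cH' r1 unfolding K_def[symmetric] by (cases "card K") auto
  then have cH: "card H = r"
  proof -
    assume eq: "card H * Suc (card H) = r * Suc r"
    have "x * Suc x < y * Suc y" if "x < y" for x y :: nat using that by (intro mult_strict_mono) auto
    then show ?thesis using eq by (metis linorder_neqE_nat less_irrefl)
  qed
  have cK: "card K = Suc r" using cHK cH r1 by (simp only: mult_cancel1) auto
  have U_pow: "z [^] r = \<one>" if "z \<in> U" for z
  proof -
    obtain g k where gk: "g \<in> carrier G" "k \<in> H" "z = g \<otimes> k \<otimes> inv g"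
      using \<open>z \<in> U\<close> by (auto simp: U_def mem_conjugate_subset_iff)
    have "k [^] r = \<one>" using pow_card_subgroup[OF H gk(2)] cH by simp
    then show ?thesis using conj_pow[OF gk(1) HG[OF gk(2)]] gk by simp
  qed
  have U_coprime: "z \<in> K" if "z \<in> carrier G" "z [^] m = \<one>" "coprime r m" for z and m :: nat
  proof (rule ccontr)
    assume "z \<notin> K"
    then have "z \<in> U" using that KU by auto
    then have "z = \<one>" using pow_coprime_eq_one[OF that(1) U_pow that(2,3)] by simp
    then show False using \<open>z \<in> U\<close> by (simp add: U_def)
  qed
  have "Coset.order G = 2 ^ n * r" using ord r(2) by (simp add: mult.commute)
  then obtain P where P: "subgroup P G" "card P = 2 ^ n"
    using sylow_thm[OF two_is_prime_nat is_group _ finite_carrier] by blast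
  have PG: "z \<in> carrier G" if "z \<in> P" for z using subgroup.mem_carrier[OF P(1) that] .
  have "P \<subseteq> K"
  proof
    fix z assume z: "z \<in> P"
    show "z \<in> K"
    proof (rule U_coprime)
      show "z [^] Suc r = \<one>" using pow_card_subgroup[OF P(1) z] P(2) r(2) by simp
    qed (use PG z in auto)
  qed
  then have PK: "P = K" using P(2) cK r(2) KU by (intro card_subset_eq) auto
  have Kconj: "g \<otimes> z \<otimes> inv g \<in> K" if gz: "g \<in> carrier G" "z \<in> K" for g z
  proof -
    have zG: "z \<in> carrier G" using gz KU by simp
    have "z [^] Suc r = \<one>" using pow_card_subgroup[OF P(1), of z] P(2) r(2) gz PK by simp
    then have "(g \<otimes> z \<otimes> inv g) [^] Suc r = \<one>" unfolding conj_pow[OF gz(1) zG] using gz(1) by simp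
    then show ?thesis using gz zG by (intro U_coprime[of _ "Suc r"]) auto
  qed
  have "even (Coset.order G)" using ord \<open>even (Suc r)\<close> by simp
  then obtain b where b: "b \<in> carrier G" "b \<noteq> \<one>" "b \<otimes> b = \<one>" by (rule involution_exists)
  have bK: "b \<in> K"
  proof (rule U_coprime[OF b(1)])
    show "b [^] (2::nat) = \<one>" using b by (simp add: nat_pow_2_3_4[OF is_group])
  qed (use odd in auto)
  have bH: "b \<notin> H"
  proof
    assume "b \<in> H"
    then have "b \<in> conjugate_subset G \<one> H"
      unfolding mem_conjugate_subset_iff using b(1) by (intro bexI[of _ b]) simp_all
    then have "b \<in> U" using b by (auto simp: U_def)
    then show False using bK KU by simp
  qed
  have clsK: "conj_class b \<subseteq> K - {\<one>}"
  proof -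
    have "conj_class b \<subseteq> K" using Kconj[OF _ bK] by (auto simp: conj_class_def)
    then show ?thesis using one_notin_conj_class[OF b(1,2)] by blast
  qed
  have finK: "finite K" using cK by (metis card.infinite nat.distinct(1))
  have oneK: "\<one> \<in> K" using subgroup.one_closed[OF P(1)] PK by simp
  have cK1: "card (K - {\<one>}) = r" using cK oneK finK by simp
  have inj: "inj_on (\<lambda>t. t \<otimes> b \<otimes> inv t) H"
  proof (rule inj_onI)
    fix t t' assume t: "t \<in> H" "t' \<in> H" and eq: "t \<otimes> b \<otimes> inv t = t' \<otimes> b \<otimes> inv t'"
    note G = HG[OF t(1)] HG[OF t(2)]
    define s where "s = inv t' \<otimes> t"
    have s: "s \<in> H" "s \<in> carrier G" using t Hm Hi G by (auto simp: s_def)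
    have "b = inv t' \<otimes> (t \<otimes> b \<otimes> inv t) \<otimes> inv (inv t')"
      unfolding eq using conj_inv_cancel[OF G(2) b(1)] G by simp
    also have "\<dots> = s \<otimes> b \<otimes> inv s" unfolding s_def using G b(1) by (intro conj_conj) auto
    finally have "b \<otimes> s = s \<otimes> b" using s b(1) by (metis inv_solve_right m_closed)
    then have "s = b \<otimes> s \<otimes> inv b" using s b(1) by (metis inv_solve_right m_closed)
    then have "s \<in> conjugate_subset G b H" using s by (auto simp: mem_conjugate_subset_iff)
    then have "s = \<one>" using disj[of b] b(1) bH s by blast
    then show "t = t'" using G unfolding s_def by (metis inv_closed inv_equality inv_inv inv_comm)
  qed
  have "(\<lambda>t. t \<otimes> b \<otimes> inv t) ` H \<subseteq> conj_class b" using HG by (auto simp: conj_class_def)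
  then have "r \<le> card (conj_class b)" using card_mono[OF finite_conj_class] card_image[OF inj] cH by metis
  moreover have "card (conj_class b) \<le> r"
    using card_mono[OF _ clsK] finK cK1 by simp
  ultimately have "card (conj_class b) = card (K - {\<one>})" using cK1 by simp
  then have cls: "conj_class b = K - {\<one>}"
    using clsK finK by (intro card_subset_eq) simp_all
  have ins: "insert \<one> (conj_class b) = P" using cls oneK PK by auto
  have N: "subgroup (insert \<one> (conj_class b)) G" unfolding ins by (rule P)
  have c: "card (conj_class b) = r" unfolding cls by (rule cK1)
  have eqn: "Coset.order G * card (conj_class b) = r\<^sup>2 * Suc (card (conj_class b))"
    unfolding c ord by (simp add: power2_eq_square algebra_simps)
  have "r \<le> char_degree \<chi>" if "\<chi> \<in> Irr G" "\<chi> b \<noteq> \<chi> \<one>" for \<chi>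
    using degree_ge_if_involution[OF b N that] c by simp
  from CD1_criterion[OF b(1,2) N r1 eqn this]
  show "CD1_group G" "max_irr_degree G = real r" by simp_all
qed

section \<open>Groups of largest irreducible degree a prime\<close>

text \<open>For central \<open>u\<close>, the product formula reads \<open>\<chi>(1) \<chi> (a u) = \<chi> a \<chi> u\<close>; the choice \<open>a = u\<^sup>-\<^sup>1\<close> shows
that \<open>\<chi> u\<close> is not zero.\<close>

lemma character_central_nonzero:
  assumes \<chi>: "\<chi> \<in> Irr G" and u: "u \<in> carrier G" and central: "\<And>v. v \<in> carrier G \<Longrightarrow> u \<otimes> v = v \<otimes> u"
  shows "\<chi> u \<noteq> 0"
proof
  assume 0: "\<chi> u = 0"
  have "x \<otimes> u \<otimes> inv x = u" if "x \<in> carrier G" for x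
    using that u central[OF that] by (metis inv_solve_right' m_closed)
  then have "(\<Sum>x\<in>carrier G. \<chi> (inv u \<otimes> (x \<otimes> u \<otimes> inv x))) = of_nat (Coset.order G) * \<chi> \<one>"
    using u by (simp add: Coset.order_def)
  then have "\<chi> \<one> * \<chi> \<one> = 0"
    using character_product[OF \<chi> _ u, of "inv u"] u 0 order_pos by simp
  then show False using char_degree[OF \<chi>] by simp
qed

text \<open>With \<open>c = |N| - 1\<close> and \<open>q = |G / N|\<close> the degree formula becomes \<open>q c = r\<^sup>2\<close>, which leaves three
values of \<open>c\<close>.\<close>

theorem prime_degree_CD1_cases:
  assumes cd: "CD1_group G" and r: "Factorial_Ring.prime r" and max: "max_irr_degree G = real r"
  shows "(r = 2 \<and> ((\<exists>x y. dihedral_like G 3 0 x y) \<or> (\<exists>x y. dihedral_like G 4 0 x y \<or> dihedral_like G 4 2 x y))) \<or>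
    (\<exists>n. Suc r = 2 ^ n \<and> doubly_transitive_frobenius_group G \<and> Coset.order G = r * Suc r)"
proof -
  obtain b N \<chi> d where b: "b \<in> carrier G" "b \<noteq> \<one>" and N_def: "N = insert \<one> (conj_class b)"
    and N: "subgroup N G" and \<chi>: "\<chi> \<in> Irr G" "\<chi> \<one> = of_nat d"
    and vanish: "\<And>x. x \<in> carrier G \<Longrightarrow> x \<notin> N \<Longrightarrow> \<chi> x = 0"
    and eqn: "d\<^sup>2 * card N = Coset.order G * card (conj_class b)" and d: "max_irr_degree G = real d"
    and cent: "card {x \<in> carrier G. b = x \<otimes> b \<otimes> inv x} * card (conj_class b) = Coset.order G"
    by (rule CD1_structure[OF cd]) (rule that; assumption)
  define c where "c = card (conj_class b)"
  define q where "q = card (rcosets N)"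
  have dr: "d = r" using d max by simp
  have cN: "card N = Suc c" using one_notin_conj_class[OF b] by (simp add: N_def c_def)
  have q: "q * Suc c = Coset.order G" using lagrange[OF N] by (simp add: q_def cN)
  have "r\<^sup>2 * Suc c = (q * c) * Suc c" using eqn unfolding dr cN q[symmetric] c_def[symmetric] by (simp add: algebra_simps)
  then have qc: "q * c = r\<^sup>2" by (simp only: mult_cancel2) simp
  have r1: "r > 1" using r by (simp add: prime_nat_iff)
  have "c dvd r ^ 2" using qc by (metis dvd_triv_right)
  then obtain i where i: "i \<le> 2" "c = r ^ i" using divides_primepow_nat[OF r] by blast
  then have "i = 0 \<or> i = 1 \<or> i = 2" by auto
  then consider "c = 1" | "c = r" | "c = r\<^sup>2" using i by auto
  then show ?thesis
  proof cases
    case 1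
    then have q': "q = r\<^sup>2" and ord: "Coset.order G = r\<^sup>2 * 2" using qc q by auto
    show ?thesis
    proof (cases "r = 2")
      case True
      have "N \<noteq> carrier G" using cN 1 ord True by (auto simp: Coset.order_def)
      then obtain u where u: "u \<in> carrier G" "u \<notin> N" using subgroup.subset[OF N] by blast
      then obtain v where "v \<in> carrier G" "u \<otimes> v \<noteq> v \<otimes> u"
        using character_central_nonzero[OF \<chi>(1) u(1)] vanish[OF u] by blast
      then show ?thesis using dihedral_like_if_nonabelian_order_8[OF _ u(1)] ord True by auto
    next
      case False
      then have odd: "odd r" using r primes_dvd_imp_eq two_is_prime_nat by blast
      obtain P where P: "subgroup P G" "card P = r\<^sup>2"
        using sylow_thm[OF r is_group ord finite_carrier] by blast
      have PN: "x = \<one>" if "x \<in> P" "x \<in> N" for x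
      proof (rule pow_coprime_eq_one)
        show "x \<in> carrier G" using subgroup.mem_carrier[OF N that(2)] .
        show "x [^] (r\<^sup>2) = \<one>" using pow_card_subgroup[OF P(1) that(1)] P(2) by simp
        show "x [^] (2::nat) = \<one>" using pow_card_subgroup[OF N that(2)] cN 1 by (simp add: numeral_2_eq_2)
      qed (use odd in simp)
      \<comment> \<open>\<open>\<chi>\<close> vanishes on \<open>P\<close> except at \<open>\<one>\<close>, so its sum over \<open>P\<close> is \<open>r\<close>, which is not a multiple of \<open>|P|\<close>.\<close>
      have "(\<Sum>x\<in>P. \<chi> x) = (\<Sum>x\<in>{\<one>}. \<chi> x)"
      proof (rule sum.mono_neutral_right)
        show "finite P" using finite_subset[OF subgroup.subset[OF P(1)]] by simp
        show "\<forall>x\<in>P - {\<one>}. \<chi> x = 0"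
          using PN vanish subgroup.mem_carrier[OF P(1)] by blast
      qed (use subgroup.one_closed[OF P(1)] in simp)
      then have s: "(\<Sum>x\<in>P. \<chi> x) = of_nat r" using \<chi>(2) dr by simp
      obtain k :: nat where "(\<Sum>x\<in>P. \<chi> x) = of_nat (r\<^sup>2 * k)"
        using character_sum_subgroup[OF \<chi>(1) P(1)] P(2) by auto
      then have "r = r\<^sup>2 * k" unfolding s by (simp only: of_nat_eq_iff)
      then have "r * 1 = r * (r * k)" by (simp add: power2_eq_square)
      then have "r * k = 1" using r1 by (simp only: mult_cancel1) auto
      then show ?thesis using r1 by simp
    qed
  next
    case 2
    then have "q * r = r * r" using qc by (simp add: power2_eq_square)
    then have "q = r" using r1 by simp
    then have ord: "Coset.order G = r * Suc r" using q 2 by simp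
    have "card {x \<in> carrier G. b = x \<otimes> b \<otimes> inv x} * r = Suc r * r"
      using cent 2 ord by (simp add: c_def mult.commute)
    then have centr: "card {x \<in> carrier G. b = x \<otimes> b \<otimes> inv x} = Suc r" using r1 by (simp only: mult_cancel2) simp
    show ?thesis
    proof (cases "r = 2")
      case True
      then have "\<exists>x y. dihedral_like G 3 0 x y"
        using N ord centr 2 by (intro dihedral_like_order_6[OF _ b]) (simp_all add: N_def c_def)
      then show ?thesis using True by blast
    next
      case False
      then have odd: "odd r" using r primes_dvd_imp_eq two_is_prime_nat by blast
      then show ?thesis
        using doubly_transitive_frobenius_if_one_class[OF r odd b N[unfolded N_def] _ ord centr] ord 2
        by (auto simp: c_def)
    qed
  next
    case 3
    then have "q * r\<^sup>2 = 1 * r\<^sup>2" using qc by simp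
    then have "q = 1" using r1 by (simp only: mult_cancel2) simp
    then have "Coset.order G = Suc (r\<^sup>2)" using q 3 by simp
    then have "r\<^sup>2 dvd Suc (r\<^sup>2)" using cent 3 unfolding c_def by (metis dvd_triv_right)
    then have "r\<^sup>2 dvd 1" by (metis Suc_eq_plus1 dvd_add_right_iff dvd_refl)
    then show ?thesis using r1 by simp
  qed
qed

end

theorem corollary5p1:
  fixes G :: "('a, 'b) monoid_scheme" and r :: nat
  assumes "group G"
    and "finite (carrier G)"
    and "Factorial_Ring.prime r"
  shows "(CD1_group G \<and> max_irr_degree G = real r) \<longleftrightarrow>
      (r = 2 \<and> (G \<cong> sym_group 3 \<or> G \<cong> dihedral_group 4 \<or> G \<cong> quaternion_group)) \<or>
      (\<exists>n::nat. r = 2 ^ n - 1 \<and> doubly_transitive_frobenius_group G \<and>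
         Coset.order G = (2 ^ n - 1) * 2 ^ n)"
    (is "?L \<longleftrightarrow> ?S \<or> ?F")
proof -
  interpret finite_group G using assms(1,2) by (simp add: finite_group_def finite_group_axioms_def)
  have S3: "finite_group (sym_group 3)"
    using sym_group_is_group
    by (simp add: finite_group_def finite_group_axioms_def sym_group_def finite_permutations)
  have D8: "finite_group (dihedral_group 4)"
    using group_dihedral_group[of 4]
    by (simp add: finite_group_def finite_group_axioms_def dihedral_group_def)
  have Q8: "finite_group quaternion_group"
    using group_quaternion_group
    by (simp add: finite_group_def finite_group_axioms_def quaternion_group_def)
  have self: "finite_group G" by (rule finite_group_axioms)
  obtain u v where uv: "dihedral_like (sym_group 3) 3 0 u v" using dihedral_like_sym_group by blast
  show ?thesis
  proof
    assume ?L
    then have "CD1_group G" "max_irr_degree G = real r" by auto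
    from prime_degree_CD1_cases[OF this(1) assms(3) this(2)] show "?S \<or> ?F"
    proof
      assume "r = 2 \<and> ((\<exists>x y. dihedral_like G 3 0 x y) \<or> (\<exists>x y. dihedral_like G 4 0 x y \<or> dihedral_like G 4 2 x y))"
      then have ?S
        using dihedral_like_unique[OF self S3 _ uv]
          dihedral_like_unique[OF self D8 _ dihedral_like_dihedral_group]
          dihedral_like_unique[OF self Q8 _ dihedral_like_quaternion_group] by blast
      then show ?thesis ..
    next
      assume "\<exists>n. Suc r = 2 ^ n \<and> doubly_transitive_frobenius_group G \<and> Coset.order G = r * Suc r"
      then obtain n where n: "Suc r = 2 ^ n" "doubly_transitive_frobenius_group G"
        "Coset.order G = r * Suc r" by blast
      moreover have "r = 2 ^ n - 1" using n(1) by (metis diff_Suc_1)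
      ultimately have ?F by metis
      then show ?thesis ..
    qed
  next
    assume "?S \<or> ?F"
    then show ?L
    proof
      assume S: ?S
      then have "(\<exists>x y. dihedral_like G 3 0 x y) \<or> (\<exists>e x y. dihedral_like G 4 e x y)"
        using dihedral_like_transfer[OF self S3 _ uv]
          dihedral_like_transfer[OF self D8 _ dihedral_like_dihedral_group]
          dihedral_like_transfer[OF self Q8 _ dihedral_like_quaternion_group] by blast
      then have "CD1_group G \<and> max_irr_degree G = 2"
        using CD1_dihedral_like_3 CD1_dihedral_like_4 by blast
      then show ?thesis using S by simp
    next
      assume ?F
      then obtain n where n: "r = 2 ^ n - 1" "doubly_transitive_frobenius_group G"
        "Coset.order G = (2 ^ n - 1) * 2 ^ n" by blast
      have "Suc r = 2 ^ n" using n(1) by simp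
      moreover have "Coset.order G = r * Suc r" unfolding calculation using n by simp
      ultimately show ?thesis using CD1_if_doubly_transitive_frobenius[OF n(2) assms(3)] by simp
    qed
  qed
qed

end
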